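(* Let $(G,S)$ be an admissible tempered pair, with associated decomposition $\mathfrak g=\bigoplus_{n=0}^N V_n$ and differential operators $\mathbf D_{\vec r}$, $\vec r\in\mathbb N^{N+1}$. Let $\mathcal E$ be a complex Fréchet space whose topology is given by seminorms $\{\|\cdot\|_j\}_{j\in\mathbb N}$, and let $\underline\mu=\{\mu_j\}_{j\in\mathbb N}$ be a family of tempered weights on $G$. Then for every $j\in\mathbb N$ there exist $\vec r_j\in\mathbb N^{N+1}$, $C_j>0$ and $k_j\in\mathbb N$ such that for every $F\in\mathcal B^{\underline\mu}(G,\mathcal E)$ $$\int_G\|\mathbf D_{\vec r_j}F(g)\|_j\,\mathrm d_G(g)\;\le\; C_j\,\sup_{X\in\mathcal U_{k_j}(\mathfrak g)}\ \sup_{g\in G}\frac{\|\widetilde XF(g)\|_j}{\mu_j(g)\,|X|_{k_j}}\;=\;C_j\,\|F\|_{j,k_j,\underline\mu}.$$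
   Context: $G$ is a connected non-compact real Lie group with Lie algebra $\mathfrak g$, $\mathrm d_G$ a left Haar measure. For $X\in\mathfrak g$, $(\widetilde Xf)(g)=\frac{d}{dt}|_{t=0}f(ge^{tX})$ and $(\underline Xf)(g)=\frac{d}{dt}|_{t=0}f(e^{-tX}g)$; both are extended to the enveloping algebra $\mathcal U(\mathfrak g)$ as algebra homomorphisms. Fix an ordered basis of $\mathfrak g$; $\mathcal U_k(\mathfrak g)$ is the span of the PBW monomials of degree $\le k$, and $|X|_k$ is the $\ell^1$-norm of the PBW coefficients of $X\in\mathcal U_k(\mathfrak g)$ (suprema are over $X\ne0$). Weights: $\mu\in C^\infty(G,\mathbb R_+^* )$ is a weight if (i) for all $X\in\mathcal U(\mathfrak g)$ there is $C$ with $|\widetilde X\mu|\le C\mu$ and $|\underline X\mu|\le C\mu$; (ii) there are $C,L,R>0$ with $\mu(gh)\le C\mu(g)^L\mu(h)^R$ for all $g,h$. $\mathcal B^{\underline\mu}(G,\mathcal E)=\{F\in C^\infty(G,\mathcal E):\forall X\in\mathcal U(\mathfrak g),\forall j,\exists C:\ \|\widetilde XF\|_j\le C\mu_j\}$, with seminorms $\|F\|_{j,k,\underline\mu}=\sup_{X\in\mathcal U_k(\mathfrak g)}\sup_{g}\frac{\|\widetilde XF(g)\|_j}{\mu_j(g)|X|_k}$. Tempered pair: for $S\in C^\infty(G,\mathbb R)$, $(G,S)$ is tempered if $\phi:G\to\mathfrak g^\star$, $\phi(x)(X)=(\widetilde XS)(x)$, is a global diffeomorphism and the multiplication and inversion of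 $G$, transported to $\mathfrak g^\star\cong\mathbb R^m$ by $\phi$, are tempered maps (smooth, all derivatives polynomially bounded). A function $f$ on $G$ (e.g. a weight) is tempered if $f\circ\phi^{-1}$ is tempered. Admissibility: put $\mathbf E=e^{iS}$. Given a vector space decomposition $\mathfrak g=\bigoplus_{n=0}^NV_n$ with bases $\{e^n_j\}$ of $V_n$, let $x_n^j=\widetilde{e^n_j}S$ (global coordinates), $x_n=(x_n^j)_j$, $|x_n|$ a Euclidean norm, $V^{(n)}=\bigoplus_{k\le n}V_k$, and let $\mathcal U(V)$ denote the unital subalgebra of $\mathcal U(\mathfrak g)$ generated by a subspace $V$. The tempered pair is admissible if such a decomposition exists with: (a) for all $n$ and $A\in\mathcal U(V_n)$ there is $B\in\mathcal U(V^{(n)})$ such that the formal $L^2(G)$-adjoint of $\widetilde A$ is $\widetilde A^*=\widetilde B$; (b) for all $n$ there is $X_n\in\mathcal U(V_n)$ whose multiplier $\alpha_n:=\mathbf E^{-1}\widetilde X_n\mathbf E$ satisfies $|\alpha_n|\ge C_n(1+|x_n|^{\rho_n})$ for some $C_n,\rho_n>0$, and there is a tempered function $\mu_n\in C^\infty(G,\mathbb R_+^* )$, independent of the variables $x_r^j$ for all $r\le n$, such that for all $A\in\mathcal U(V^{(n)})$ there is $C_A$ with $|\widetilde A\alpha_n|\le C_A|\alpha_n|\mu_n$. (These $\mu_n$ are unrelated to the family $\underline\mu$.) Operators: $D_n\Phi=\widetilde X_n^*(\Phi/\alpha_n)$ and $\mathbf D_{\vec r}=D_0^{r_0}D_1^{r_1}\cdots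 D_N^{r_N}$. *)

theory Defs
  imports "HOL-Analysis.Analysis" "HOL-Algebra.Group" "HOL-Library.Poly_Mapping"
begin

section \<open>Universal enveloping algebra\<close>

class lie_algebra = real_vector +
  fixes lie_bracket :: "'a \<Rightarrow> 'a \<Rightarrow> 'a"
  assumes lie_bracket_add_left: "lie_bracket (x + y) z = lie_bracket x z + lie_bracket y z"
    and lie_bracket_scaleR_left: "lie_bracket (a *\<^sub>R x) y = a *\<^sub>R lie_bracket x y"
    and lie_bracket_add_right: "lie_bracket x (y + z) = lie_bracket x y + lie_bracket x z"
    and lie_bracket_scaleR_right: "lie_bracket x (a *\<^sub>R y) = a *\<^sub>R lie_bracket x y"
    and lie_bracket_self: "lie_bracket x x = 0"
    and jacobi: "lie_bracket x (lie_bracket y z) + lie_bracket y (lie_bracket z x)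
                 + lie_bracket z (lie_bracket x y) = 0"

text \<open>
  Words under concatenation, written additively because multiplication of
  \<^typ>\<open>'m \<Rightarrow>\<^sub>0 real\<close> is the convolution over an additive monoid \<open>'m\<close>.
  Thus \<open>'a tword \<Rightarrow>\<^sub>0 real\<close> is the free unital algebra on the set \<open>'a\<close>.
\<close>

datatype 'a tword = Tword (letters: "'a list")

instantiation tword :: (type) monoid_add
begin
definition zero_tword :: "'a tword" where "0 = Tword []"
definition plus_tword :: "'a tword \<Rightarrow> 'a tword \<Rightarrow> 'a tword"
  where "u + v = Tword (letters u @ letters v)"
instance by standard (simp_all add: zero_tword_def plus_tword_def)
end

lemma tword_add_eq_0_iff: "u + v = (0 :: 'a tword) \<longleftrightarrow> u = 0 \<and> v = 0"
  by (cases u; cases v) (simp add: zero_tword_def plus_tword_def)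

definition free_gen :: "'a \<Rightarrow> 'a tword \<Rightarrow>\<^sub>0 real"
  where "free_gen x = Poly_Mapping.single (Tword [x]) 1"

definition free_const :: "real \<Rightarrow> 'a tword \<Rightarrow>\<^sub>0 real"
  where "free_const c = Poly_Mapping.single 0 c"

text \<open>
  The relations \<open>linear\<close> cut the free algebra on the set \<open>'a\<close> down to the tensor algebra of the
  vector space \<open>'a\<close>.
\<close>

inductive_set uea_ideal :: "('a::lie_algebra tword \<Rightarrow>\<^sub>0 real) set" where
  linear: "free_gen (a *\<^sub>R x + b *\<^sub>R y)
             - free_const a * free_gen x - free_const b * free_gen y \<in> uea_ideal"
| commutator: "free_gen x * free_gen y - free_gen y * free_gen x
             - free_gen (lie_bracket x y) \<in> uea_ideal"
| add: "p \<in> uea_ideal \<Longrightarrow> q \<in> uea_ideal \<Longrightarrow> p + q \<in> uea_ideal"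
| mult: "p \<in> uea_ideal \<Longrightarrow> r * p * s \<in> uea_ideal"

lemma uea_ideal_0: "0 \<in> uea_ideal"
  using uea_ideal.mult[OF uea_ideal.commutator, of 0 _ _ 0] by simp

lemma uea_ideal_multl: "p \<in> uea_ideal \<Longrightarrow> r * p \<in> uea_ideal"
  using uea_ideal.mult[of p r 1] by simp

lemma uea_ideal_multr: "p \<in> uea_ideal \<Longrightarrow> p * r \<in> uea_ideal"
  using uea_ideal.mult[of p 1 r] by simp

lemma uea_ideal_minus: "p \<in> uea_ideal \<Longrightarrow> - p \<in> uea_ideal"
  using uea_ideal_multl[of p "- 1"] by simp

quotient_type (overloaded) 'a uea = "'a::lie_algebra tword \<Rightarrow>\<^sub>0 real"
  / "\<lambda>p q. p - q \<in> uea_ideal"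
  morphisms rep_uea abs_uea
proof (rule equivpI)
  show "reflp (\<lambda>p q::'a tword \<Rightarrow>\<^sub>0 real. p - q \<in> uea_ideal)"
    by (simp add: reflp_def uea_ideal_0)
  show "symp (\<lambda>p q::'a tword \<Rightarrow>\<^sub>0 real. p - q \<in> uea_ideal)"
    using uea_ideal_minus by (fastforce simp: symp_def)
  show "transp (\<lambda>p q::'a tword \<Rightarrow>\<^sub>0 real. p - q \<in> uea_ideal)"
  proof (rule transpI)
    fix x y z :: "'a tword \<Rightarrow>\<^sub>0 real"
    assume "x - y \<in> uea_ideal" "y - z \<in> uea_ideal"
    from uea_ideal.add[OF this] show "x - z \<in> uea_ideal" by simp
  qed
qed

lemma tword_alg_induct [case_names single sum]:
  fixes p :: "'a tword \<Rightarrow>\<^sub>0 real"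
  assumes single: "\<And>k v. P (Poly_Mapping.single k v)"
    and sum: "\<And>f g. P f \<Longrightarrow> P g \<Longrightarrow> P (f + g)"
  shows "P p"
proof (induction p rule: update_induct)
  case const
  show ?case using single[of 0 0] by simp
next
  case (update f a b)
  have "Poly_Mapping.update a b f = f + Poly_Mapping.single a b"
    by (rule poly_mapping_eqI)
       (use update.hyps in \<open>auto simp: lookup_update lookup_add lookup_single when_def in_keys_iff\<close>)
  then show ?case using sum[OF update.IH single] by simp
qed

lemma free_const_commute: "free_const c * p = p * free_const c"
proof (induction p rule: tword_alg_induct)
  case (single k v)
  show ?case by (simp add: free_const_def mult_single mult.commute)
next
  case (sum f g)
  then show ?case by (simp add: algebra_simps)
qed

lemma free_const_add: "free_const (a + b) = free_const a + free_const b"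
  by (simp add: free_const_def single_add)

lemma free_const_mult: "free_const (a * b) = free_const a * free_const b"
  by (simp add: free_const_def mult_single)

lemma free_const_1: "free_const 1 = 1"
  by (simp add: free_const_def)

lemma lookup_0_mult:
  "Poly_Mapping.lookup (p * q) (0::'a tword)
     = Poly_Mapping.lookup p 0 * Poly_Mapping.lookup (q :: 'a tword \<Rightarrow>\<^sub>0 real) 0"
proof (induction p rule: tword_alg_induct)
  case (single k v)
  show ?case
  proof (induction q rule: tword_alg_induct)
    case (single l w)
    show ?case
      by (auto simp: mult_single lookup_single when_def tword_add_eq_0_iff)
  next
    case (sum f g)
    then show ?case by (simp add: algebra_simps lookup_add)
  qed
next
  case (sum f g)
  then show ?case by (simp add: algebra_simps lookup_add)
qed

lemma uea_ideal_lookup_0: "p \<in> uea_ideal \<Longrightarrow> Poly_Mapping.lookup p 0 = 0"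
proof (induction rule: uea_ideal.induct)
  have gen: "Poly_Mapping.lookup (free_gen x) 0 = 0" for x :: 'a
    by (simp add: free_gen_def lookup_single zero_tword_def)
  show "Poly_Mapping.lookup (free_gen (a *\<^sub>R x + b *\<^sub>R y)
      - free_const a * free_gen x - free_const b * free_gen y) 0 = 0" for a b and x y :: 'a
    by (simp add: lookup_minus lookup_0_mult gen)
  show "Poly_Mapping.lookup (free_gen x * free_gen y - free_gen y * free_gen x
      - free_gen (lie_bracket x y)) 0 = 0" for x y :: 'a
    by (simp add: lookup_minus lookup_0_mult gen)
qed (simp_all add: lookup_add lookup_0_mult)

instantiation uea :: (lie_algebra) "{ring_1, real_algebra_1}"
begin

lift_definition zero_uea :: "'a uea" is 0 .
lift_definition one_uea :: "'a uea" is 1 .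
lift_definition plus_uea :: "'a uea \<Rightarrow> 'a uea \<Rightarrow> 'a uea" is "(+)"
  by (metis add_diff_add uea_ideal.add)
lift_definition uminus_uea :: "'a uea \<Rightarrow> 'a uea" is uminus
  using uea_ideal_minus by fastforce
lift_definition minus_uea :: "'a uea \<Rightarrow> 'a uea \<Rightarrow> 'a uea" is "(-)"
proof -
  fix p q r s :: "'a tword \<Rightarrow>\<^sub>0 real"
  assume "p - q \<in> uea_ideal" "r - s \<in> uea_ideal"
  from uea_ideal.add[OF this(1) uea_ideal_minus[OF this(2)]]
  show "p - r - (q - s) \<in> uea_ideal" by (simp add: algebra_simps)
qed
lift_definition times_uea :: "'a uea \<Rightarrow> 'a uea \<Rightarrow> 'a uea" is "(*)"
proof -
  fix p q r s :: "'a tword \<Rightarrow>\<^sub>0 real"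
  assume "p - q \<in> uea_ideal" "r - s \<in> uea_ideal"
  from uea_ideal.add[OF uea_ideal_multr[OF this(1), of r] uea_ideal_multl[OF this(2), of q]]
  show "p * r - q * s \<in> uea_ideal" by (simp add: algebra_simps)
qed
lift_definition scaleR_uea :: "real \<Rightarrow> 'a uea \<Rightarrow> 'a uea" is "\<lambda>c p. free_const c * p"
proof -
  fix c and p q :: "'a tword \<Rightarrow>\<^sub>0 real"
  assume "p - q \<in> uea_ideal"
  from uea_ideal_multl[OF this, of "free_const c"]
  show "free_const c * p - free_const c * q \<in> uea_ideal" by (simp add: algebra_simps)
qed

instance
proof
  show "0 \<noteq> (1 :: 'a uea)"
    by transfer (use uea_ideal_lookup_0[of "- 1"] in \<open>auto simp: lookup_one\<close>)
  fix x y :: "'a uea" and c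
  show "x * c *\<^sub>R y = c *\<^sub>R (x * y)"
    by transfer (metis (no_types) free_const_commute mult.assoc right_minus_eq uea_ideal_0)
qed (transfer; simp add: algebra_simps free_const_add free_const_mult free_const_1 uea_ideal_0)+

end

definition uea_gen :: "'a::lie_algebra \<Rightarrow> 'a uea"
  where "uea_gen x = abs_uea (free_gen x)"

text \<open>\<open>\<U>(V)\<close>, the unital subalgebra generated by \<open>V\<close>.\<close>

inductive_set uea_sub :: "'a::lie_algebra set \<Rightarrow> 'a uea set" for V where
  one: "1 \<in> uea_sub V"
| gen: "x \<in> V \<Longrightarrow> uea_gen x \<in> uea_sub V"
| add: "u \<in> uea_sub V \<Longrightarrow> v \<in> uea_sub V \<Longrightarrow> u + v \<in> uea_sub V"
| scaleR: "u \<in> uea_sub V \<Longrightarrow> c *\<^sub>R u \<in> uea_sub V"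
| mult: "u \<in> uea_sub V \<Longrightarrow> v \<in> uea_sub V \<Longrightarrow> u * v \<in> uea_sub V"

definition basis_of :: "'a::real_vector list \<Rightarrow> 'a set \<Rightarrow> bool" where
  "basis_of bs V \<longleftrightarrow> distinct bs \<and> independent (set bs) \<and> span (set bs) = V"

definition pbw_idx :: "'a list \<Rightarrow> nat \<Rightarrow> nat list set" where
  "pbw_idx bs k = {\<beta>. length \<beta> = length bs \<and> sum_list \<beta> \<le> k}"

definition pbw_monomial :: "'a::lie_algebra list \<Rightarrow> nat list \<Rightarrow> 'a uea" where
  "pbw_monomial bs \<beta> = prod_list (map2 (\<lambda>x i. uea_gen x ^ i) bs \<beta>)"

definition uea_filt :: "'a::lie_algebra list \<Rightarrow> nat \<Rightarrow> 'a uea set" where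
  "uea_filt bs k = span (pbw_monomial bs ` pbw_idx bs k)"

text \<open>The coefficients are unique by the Poincare--Birkhoff--Witt theorem.\<close>

definition pbw_coeffs :: "'a::lie_algebra list \<Rightarrow> nat \<Rightarrow> 'a uea \<Rightarrow> nat list \<Rightarrow> real" where
  "pbw_coeffs bs k u = (SOME c. u = (\<Sum>\<beta>\<in>pbw_idx bs k. c \<beta> *\<^sub>R pbw_monomial bs \<beta>))"

definition pbw_norm :: "'a::lie_algebra list \<Rightarrow> nat \<Rightarrow> 'a uea \<Rightarrow> real" where
  "pbw_norm bs k u = (\<Sum>\<beta>\<in>pbw_idx bs k. \<bar>pbw_coeffs bs k u \<beta>\<bar>)"

text \<open>
  The extension of \<open>D\<close> from the Lie algebra to words, in the order of an algebra homomorphism: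
  \<open>X\<^sub>1 \<cdots> X\<^sub>k\<close> acts as \<open>D X\<^sub>1 \<circ> \<cdots> \<circ> D X\<^sub>k\<close>. It is applied to a representative; on smooth
  functions the result is independent of the representative if \<open>D\<close> is linear and respects brackets.
\<close>

definition uea_op ::
  "('a::lie_algebra \<Rightarrow> ('g \<Rightarrow> 'e) \<Rightarrow> 'g \<Rightarrow> 'e::real_vector) \<Rightarrow> 'a uea \<Rightarrow> ('g \<Rightarrow> 'e) \<Rightarrow> 'g \<Rightarrow> 'e" where
  "uea_op D u f g = (\<Sum>w\<in>Poly_Mapping.keys (rep_uea u).
      Poly_Mapping.lookup (rep_uea u) w *\<^sub>R foldr D (letters w) f g)"

section \<open>Smooth and tempered maps on Euclidean spaces\<close>

text \<open>
  Values lie in a Hausdorff real topological vector space, so that real-, complex-, vector- and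
  Frechet-valued maps are all covered.
\<close>

definition pd :: "'a::real_vector \<Rightarrow> ('a \<Rightarrow> 'e::{real_vector,t2_space}) \<Rightarrow> 'a \<Rightarrow> 'e" where
  "pd v f x = Lim (at 0) (\<lambda>t::real. (f (x + t *\<^sub>R v) - f x) /\<^sub>R t)"

primrec Ck_on :: "nat \<Rightarrow> 'a::euclidean_space set \<Rightarrow> ('a \<Rightarrow> 'e::{real_vector,t2_space}) \<Rightarrow> bool" where
  "Ck_on 0 U f \<longleftrightarrow> continuous_on U f"
| "Ck_on (Suc k) U f \<longleftrightarrow> continuous_on U f \<and>
     (\<forall>v\<in>Basis. (\<forall>x\<in>U. ((\<lambda>t::real. (f (x + t *\<^sub>R v) - f x) /\<^sub>R t) \<longlongrightarrow> pd v f x) (at 0))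
        \<and> Ck_on k U (pd v f))"

definition smooth_on :: "'a::euclidean_space set \<Rightarrow> ('a \<Rightarrow> 'e::{real_vector,t2_space}) \<Rightarrow> bool" where
  "smooth_on U f \<longleftrightarrow> open U \<and> (\<forall>k. Ck_on k U f)"

definition tempered_map :: "('a::euclidean_space \<Rightarrow> 'b::real_normed_vector) \<Rightarrow> bool" where
  "tempered_map f \<longleftrightarrow> smooth_on UNIV f \<and>
     (\<forall>vs\<in>lists Basis. \<exists>C k. \<forall>x. norm (foldr pd vs f x) \<le> C * (1 + norm x) ^ k)"

section \<open>Lie groups\<close>

record ('g, 'a) lie_group_data = "'g monoid" +
  charts :: "('g set \<times> ('g \<Rightarrow> 'a)) set"
  expo :: "'a \<Rightarrow> 'g"

definition smooth_fun ::
  "('g, 'a::euclidean_space) lie_group_data \<Rightarrow> ('g \<Rightarrow> 'e::{real_vector,t2_space}) \<Rightarrow> bool" where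
  "smooth_fun G f \<longleftrightarrow> (\<forall>(U, \<kappa>)\<in>charts G. smooth_on (\<kappa> ` U) (f \<circ> inv_into U \<kappa>))"

definition smooth_into ::
  "('g::topological_space, 'a::euclidean_space) lie_group_data
     \<Rightarrow> 'b::euclidean_space set \<Rightarrow> ('b \<Rightarrow> 'g) \<Rightarrow> bool" where
  "smooth_into G W f \<longleftrightarrow> open W \<and> continuous_on W f \<and>
     (\<forall>(U, \<kappa>)\<in>charts G. smooth_on (W \<inter> f -` U) (\<kappa> \<circ> f))"

text \<open>\<open>(\<widetilde>Xf)(g) = d/dt f(g e\<^sup>t\<^sup>X)\<close> and \<open>(Xf)(g) = d/dt f(e\<^sup>-\<^sup>t\<^sup>X g)\<close> at \<open>t = 0\<close>.\<close>

definition lder ::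
  "('g, 'a::real_vector) lie_group_data \<Rightarrow> 'a \<Rightarrow> ('g \<Rightarrow> 'e::{real_vector,t2_space}) \<Rightarrow> 'g \<Rightarrow> 'e" where
  "lder G X f g = Lim (at 0) (\<lambda>t::real. (f (g \<otimes>\<^bsub>G\<^esub> expo G (t *\<^sub>R X)) - f g) /\<^sub>R t)"

definition rder ::
  "('g, 'a::real_vector) lie_group_data \<Rightarrow> 'a \<Rightarrow> ('g \<Rightarrow> 'e::{real_vector,t2_space}) \<Rightarrow> 'g \<Rightarrow> 'e" where
  "rder G X f g = Lim (at 0) (\<lambda>t::real. (f (expo G (- t *\<^sub>R X) \<otimes>\<^bsub>G\<^esub> g) - f g) /\<^sub>R t)"

definition lop ::
  "('g, 'a::lie_algebra) lie_group_data \<Rightarrow> 'a uea \<Rightarrow> ('g \<Rightarrow> 'e::{real_vector,t2_space}) \<Rightarrow> 'g \<Rightarrow> 'e" where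
  "lop G = uea_op (lder G)"

definition rop ::
  "('g, 'a::lie_algebra) lie_group_data \<Rightarrow> 'a uea \<Rightarrow> ('g \<Rightarrow> 'e::{real_vector,t2_space}) \<Rightarrow> 'g \<Rightarrow> 'e" where
  "rop G = uea_op (rder G)"

text \<open>
  The Lie algebra is the type \<open>'a\<close>, which also serves as the model space of the charts.
  Assumptions \<open>expo_hom\<close>, \<open>expo_smooth\<close> and \<open>expo_tangent\<close> say that \<open>t \<mapsto> expo G (t X)\<close> are the
  one-parameter subgroups of \<open>G\<close> and that \<open>X \<mapsto> d/dt expo G (t X)\<close> at \<open>t = 0\<close> identifies \<open>'a\<close>
  with the tangent space at the identity; \<open>bracket\<close> says that the bracket of \<open>'a\<close> is the
  commutator of left-invariant vector fields.
\<close>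

locale lie_group = group G
  for G :: "('g::{t2_space,second_countable_topology}, 'a::{euclidean_space,lie_algebra}) lie_group_data"
    (structure) +
  assumes carrier_UNIV: "carrier G = UNIV"
    and chart_open: "(U, \<kappa>) \<in> charts G \<Longrightarrow> open U"
    and chart_homeo: "(U, \<kappa>) \<in> charts G \<Longrightarrow> homeomorphism U (\<kappa> ` U) \<kappa> (inv_into U \<kappa>)"
    and chart_cover: "(\<Union>(U, \<kappa>)\<in>charts G. U) = UNIV"
    and chart_image_open: "(U, \<kappa>) \<in> charts G \<Longrightarrow> open (\<kappa> ` U)"
    and chart_compat: "(U, \<kappa>) \<in> charts G \<Longrightarrow> (V, \<eta>) \<in> charts G
          \<Longrightarrow> smooth_on (\<kappa> ` (U \<inter> V)) (\<eta> \<circ> inv_into U \<kappa>)"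
    and mult_smooth: "(U, \<kappa>) \<in> charts G \<Longrightarrow> (V, \<eta>) \<in> charts G
          \<Longrightarrow> smooth_into G (\<kappa> ` U \<times> \<eta> ` V) (\<lambda>(x, y). inv_into U \<kappa> x \<otimes> inv_into V \<eta> y)"
    and inv_smooth: "(U, \<kappa>) \<in> charts G
          \<Longrightarrow> smooth_into G (\<kappa> ` U) (\<lambda>x. m_inv G (inv_into U \<kappa> x))"
    and expo_hom: "expo G ((s + t) *\<^sub>R X) = expo G (s *\<^sub>R X) \<otimes> expo G (t *\<^sub>R X)"
    and expo_smooth: "smooth_into G UNIV (\<lambda>t::real. expo G (t *\<^sub>R X))"
    and expo_tangent: "(U, \<kappa>) \<in> charts G \<Longrightarrow> \<one> \<in> U
          \<Longrightarrow> \<exists>T. linear T \<and> bij T \<and>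
                (\<forall>X. ((\<lambda>t. \<kappa> (expo G (t *\<^sub>R X))) has_vector_derivative T X) (at 0))"
    and bracket: "smooth_fun G (f :: 'g \<Rightarrow> real)
          \<Longrightarrow> lder G (lie_bracket X Y) f g = lder G X (lder G Y f) g - lder G Y (lder G X f) g"

definition left_haar_measure ::
  "('g::topological_space, 'a) lie_group_data \<Rightarrow> 'g measure \<Rightarrow> bool" where
  "left_haar_measure G M \<longleftrightarrow> sets M = sets borel \<and>
     (\<forall>g. \<forall>A\<in>sets borel. emeasure M ((\<lambda>x. g \<otimes>\<^bsub>G\<^esub> x) ` A) = emeasure M A) \<and>
     (\<forall>K. compact K \<longrightarrow> emeasure M K < \<infinity>) \<and>
     emeasure M UNIV \<noteq> 0"

definition is_formal_adjoint ::
  "('g::topological_space, 'a::{euclidean_space,lie_algebra}) lie_group_data \<Rightarrow> 'g measure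
     \<Rightarrow> 'a uea \<Rightarrow> 'a uea \<Rightarrow> bool" where
  "is_formal_adjoint G M A B \<longleftrightarrow>
     (\<forall>f h :: 'g \<Rightarrow> complex.
        smooth_fun G f \<and> compact (closure {x. f x \<noteq> 0}) \<and>
        smooth_fun G h \<and> compact (closure {x. h x \<noteq> 0}) \<longrightarrow>
        (\<integral>x. lop G A f x * cnj (h x) \<partial>M) = (\<integral>x. f x * cnj (lop G B h x) \<partial>M))"

section \<open>Weights and symbol spaces\<close>

definition weight ::
  "('g, 'a::{euclidean_space,lie_algebra}) lie_group_data \<Rightarrow> ('g \<Rightarrow> real) \<Rightarrow> bool" where
  "weight G \<mu> \<longleftrightarrow> smooth_fun G \<mu> \<and> (\<forall>g. 0 < \<mu> g) \<and>
     (\<forall>u. \<exists>C. \<forall>g. \<bar>lop G u \<mu> g\<bar> \<le> C * \<mu> g \<and> \<bar>rop G u \<mu> g\<bar> \<le> C * \<mu> g) \<and>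
     (\<exists>C L R. 0 < C \<and> 0 < L \<and> 0 < R \<and>
        (\<forall>g h. \<mu> (g \<otimes>\<^bsub>G\<^esub> h) \<le> C * \<mu> g powr L * \<mu> h powr R))"

definition frechet_space ::
  "(complex \<Rightarrow> 'e \<Rightarrow> 'e::{real_vector,t2_space}) \<Rightarrow> (nat \<Rightarrow> 'e \<Rightarrow> real) \<Rightarrow> bool" where
  "frechet_space sc p \<longleftrightarrow>
     vector_space sc \<and> (\<forall>r x. sc (complex_of_real r) x = r *\<^sub>R x) \<and>
     (\<forall>j x y. p j (x + y) \<le> p j x + p j y) \<and>
     (\<forall>j c x. p j (sc c x) = cmod c * p j x) \<and>
     (\<forall>j x. 0 \<le> p j x) \<and>
     (\<forall>U. open U \<longleftrightarrow> (\<forall>x\<in>U. \<exists>J \<epsilon>. finite J \<and> 0 < \<epsilon> \<and> {y. \<forall>j\<in>J. p j (y - x) < \<epsilon>} \<subseteq> U)) \<and>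
     (\<forall>s :: nat \<Rightarrow> 'e.
        (\<forall>j. \<forall>\<epsilon>>0. \<exists>N. \<forall>m\<ge>N. \<forall>n\<ge>N. p j (s m - s n) < \<epsilon>) \<longrightarrow> (\<exists>l. s \<longlonglongrightarrow> l))"

definition B_space ::
  "('g, 'a::{euclidean_space,lie_algebra}) lie_group_data
     \<Rightarrow> (nat \<Rightarrow> 'e::{real_vector,t2_space} \<Rightarrow> real) \<Rightarrow> (nat \<Rightarrow> 'g \<Rightarrow> real) \<Rightarrow> ('g \<Rightarrow> 'e) set" where
  "B_space G p \<mu> = {F. smooth_fun G F \<and>
     (\<forall>u j. \<exists>C. \<forall>g. p j (lop G u F g) \<le> C * \<mu> j g)}"

text \<open>The first argument \<open>bs\<close> of \<open>B_seminorm G bs\<close> is the ordered basis used for \<open>\<U>\<^sub>k\<close>.\<close>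

definition B_seminorm ::
  "('g, 'a::{euclidean_space,lie_algebra}) lie_group_data \<Rightarrow> 'a list
     \<Rightarrow> (nat \<Rightarrow> 'e::{real_vector,t2_space} \<Rightarrow> real) \<Rightarrow> (nat \<Rightarrow> 'g \<Rightarrow> real)
     \<Rightarrow> nat \<Rightarrow> nat \<Rightarrow> ('g \<Rightarrow> 'e) \<Rightarrow> ennreal" where
  "B_seminorm G bs p \<mu> j k F =
     (SUP u\<in>uea_filt bs k - {0}. SUP g. ennreal (p j (lop G u F g) / (\<mu> j g * pbw_norm bs k u)))"

section \<open>Admissible tempered pairs\<close>

text \<open>
  The moment map, with the dual of \<open>'a\<close> identified with \<open>'a\<close> by the inner product:
  \<open>moment G S x \<bullet> X = (\<widetilde>XS)(x)\<close>.
\<close>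

definition moment ::
  "('g, 'a::euclidean_space) lie_group_data \<Rightarrow> ('g \<Rightarrow> real) \<Rightarrow> 'g \<Rightarrow> 'a" where
  "moment G S x = (\<Sum>b\<in>Basis. lder G b S x *\<^sub>R b)"

definition tempered_pair ::
  "('g::topological_space, 'a::euclidean_space) lie_group_data \<Rightarrow> ('g \<Rightarrow> real) \<Rightarrow> bool" where
  "tempered_pair G S \<longleftrightarrow>
     (let \<phi> = moment G S; \<psi> = inv_into UNIV \<phi> in
       smooth_fun G S \<and>
       bij \<phi> \<and> smooth_fun G \<phi> \<and> smooth_into G UNIV \<psi> \<and>
       tempered_map (\<lambda>(\<xi>, \<eta>). \<phi> (\<psi> \<xi> \<otimes>\<^bsub>G\<^esub> \<psi> \<eta>)) \<and>
       tempered_map (\<lambda>\<xi>. \<phi> (m_inv G (\<psi> \<xi>))))"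

definition tempered_fun ::
  "('g, 'a::euclidean_space) lie_group_data \<Rightarrow> ('g \<Rightarrow> real) \<Rightarrow> ('g \<Rightarrow> real) \<Rightarrow> bool" where
  "tempered_fun G S f \<longleftrightarrow> tempered_map (f \<circ> inv_into UNIV (moment G S))"

definition direct_sum_decomp :: "nat \<Rightarrow> (nat \<Rightarrow> 'a::real_vector set) \<Rightarrow> bool" where
  "direct_sum_decomp N V \<longleftrightarrow> (\<forall>n\<le>N. subspace (V n)) \<and>
     (\<forall>x. \<exists>!v. (\<forall>n\<le>N. v n \<in> V n) \<and> (\<forall>n>N. v n = 0) \<and> x = (\<Sum>n\<le>N. v n))"

definition Vupto :: "(nat \<Rightarrow> 'a::real_vector set) \<Rightarrow> nat \<Rightarrow> 'a set" where
  "Vupto V n = span (\<Union>k\<le>n. V k)"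

definition coord ::
  "('g, 'a::real_vector) lie_group_data \<Rightarrow> ('g \<Rightarrow> real) \<Rightarrow> (nat \<Rightarrow> 'a list) \<Rightarrow> nat \<Rightarrow> nat \<Rightarrow> 'g \<Rightarrow> real" where
  "coord G S e n j = lder G (e n ! j) S"

definition coord_norm ::
  "('g, 'a::real_vector) lie_group_data \<Rightarrow> ('g \<Rightarrow> real) \<Rightarrow> (nat \<Rightarrow> 'a list) \<Rightarrow> nat \<Rightarrow> 'g \<Rightarrow> real" where
  "coord_norm G S e n g = L2_set (\<lambda>j. coord G S e n j g) {..<length (e n)}"

definition indep_of_coords_upto ::
  "('g, 'a::real_vector) lie_group_data \<Rightarrow> ('g \<Rightarrow> real) \<Rightarrow> nat \<Rightarrow> (nat \<Rightarrow> 'a list) \<Rightarrow> nat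
     \<Rightarrow> ('g \<Rightarrow> real) \<Rightarrow> bool" where
  "indep_of_coords_upto G S N e n f \<longleftrightarrow>
     (\<forall>g h. (\<forall>m j. n < m \<and> m \<le> N \<and> j < length (e m) \<longrightarrow> coord G S e m j g = coord G S e m j h)
        \<longrightarrow> f g = f h)"

definition multiplier ::
  "('g, 'a::lie_algebra) lie_group_data \<Rightarrow> ('g \<Rightarrow> real) \<Rightarrow> 'a uea \<Rightarrow> 'g \<Rightarrow> complex" where
  "multiplier G S A g =
     (let E = (\<lambda>x. exp (\<i> * complex_of_real (S x))) in lop G A E g / E g)"

text \<open>
  \<open>(V, e, X)\<close> is a decomposition with bases \<open>e n\<close> of \<open>V n\<close> and elements \<open>X n\<close>
  that witnesses the admissibility of \<open>(G, S)\<close>.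
\<close>

definition admissible_by ::
  "('g::topological_space, 'a::{euclidean_space,lie_algebra}) lie_group_data \<Rightarrow> 'g measure
     \<Rightarrow> ('g \<Rightarrow> real) \<Rightarrow> nat \<Rightarrow> (nat \<Rightarrow> 'a set) \<Rightarrow> (nat \<Rightarrow> 'a list) \<Rightarrow> (nat \<Rightarrow> 'a uea) \<Rightarrow> bool" where
  "admissible_by G M S N V e X \<longleftrightarrow>
     direct_sum_decomp N V \<and> (\<forall>n\<le>N. basis_of (e n) (V n)) \<and>
     (\<forall>n\<le>N. \<forall>A\<in>uea_sub (V n). \<exists>B\<in>uea_sub (Vupto V n). is_formal_adjoint G M A B) \<and>
     (\<forall>n\<le>N. X n \<in> uea_sub (V n) \<and>
        (\<exists>C \<rho>. 0 < C \<and> 0 < \<rho> \<and>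
           (\<forall>g. C * (1 + coord_norm G S e n g powr \<rho>) \<le> cmod (multiplier G S (X n) g))) \<and>
        (\<exists>\<mu>. smooth_fun G \<mu> \<and> (\<forall>g. 0 < \<mu> g) \<and> tempered_fun G S \<mu> \<and>
           indep_of_coords_upto G S N e n \<mu> \<and>
           (\<forall>A\<in>uea_sub (Vupto V n). \<exists>C. \<forall>g.
              cmod (lop G A (multiplier G S (X n)) g) \<le> C * cmod (multiplier G S (X n) g) * \<mu> g)))"

text \<open>
  The element of \<open>\<U>(V\<^sup>(\<^sup>n\<^sup>))\<close> that implements the formal adjoint of \<open>A\<close>. It exists for \<open>A \<in> \<U>(V n)\<close>
  by admissibility, and it is unique since an element of the enveloping algebra is determined by its
  left-invariant differential operator.
\<close>

definition adjoint_elem ::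
  "('g::topological_space, 'a::{euclidean_space,lie_algebra}) lie_group_data \<Rightarrow> 'g measure
     \<Rightarrow> (nat \<Rightarrow> 'a set) \<Rightarrow> nat \<Rightarrow> 'a uea \<Rightarrow> 'a uea" where
  "adjoint_elem G M V n A = (SOME B. B \<in> uea_sub (Vupto V n) \<and> is_formal_adjoint G M A B)"

definition D_op ::
  "('g::topological_space, 'a::{euclidean_space,lie_algebra}) lie_group_data \<Rightarrow> 'g measure
     \<Rightarrow> ('g \<Rightarrow> real) \<Rightarrow> (nat \<Rightarrow> 'a set) \<Rightarrow> (nat \<Rightarrow> 'a uea) \<Rightarrow> (complex \<Rightarrow> 'e \<Rightarrow> 'e)
     \<Rightarrow> nat \<Rightarrow> ('g \<Rightarrow> 'e::{real_vector,t2_space}) \<Rightarrow> 'g \<Rightarrow> 'e" where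
  "D_op G M S V X sc n \<Phi> =
     lop G (adjoint_elem G M V n (X n)) (\<lambda>g. sc (1 / multiplier G S (X n) g) (\<Phi> g))"

definition D_vec ::
  "('g::topological_space, 'a::{euclidean_space,lie_algebra}) lie_group_data \<Rightarrow> 'g measure
     \<Rightarrow> ('g \<Rightarrow> real) \<Rightarrow> nat \<Rightarrow> (nat \<Rightarrow> 'a set) \<Rightarrow> (nat \<Rightarrow> 'a uea) \<Rightarrow> (complex \<Rightarrow> 'e \<Rightarrow> 'e)
     \<Rightarrow> (nat \<Rightarrow> nat) \<Rightarrow> ('g \<Rightarrow> 'e::{real_vector,t2_space}) \<Rightarrow> 'g \<Rightarrow> 'e" where
  "D_vec G M S N V X sc r F = foldr (\<lambda>n. D_op G M S V X sc n ^^ r n) [0..<Suc N] F"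

end

theory Submission
  imports Defs
begin

text \<open>
  Expanding \<open>D\<^sub>0\<^bsup>r\<^sub>0\<^esup> \<cdots> D\<^sub>N\<^bsup>r\<^sub>N\<^esup> F\<close> by the Leibniz rule bounds it by
  \<open>\<Prod>\<^sub>n \<bar>\<alpha>\<^sub>n\<bar>\<^bsup>-r\<^sub>n\<^esup> (1 + \<mu>\<^sub>n)\<^bsup>m\<^sub>n\<^esup>\<close> times finitely many left-invariant derivatives of \<open>F\<close>.
  The operators \<open>D\<^sub>k\<close> with \<open>k > n\<close> act before the factor \<open>1 / \<alpha>\<^sub>n\<close> appears, so \<open>m\<^sub>n\<close> depends only on
  \<open>r\<^sub>0, \<dots>, r\<^sub>n\<close>. Since \<open>\<mu>\<^sub>n\<close> grows polynomially in \<open>x\<^sub>m\<close>, \<open>m > n\<close>, only, choosing \<open>r\<^sub>0, r\<^sub>1, \<dots>\<close> successively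
  makes the product, multiplied by the weight, decay like any prescribed power of the moment map.
  Such a power is integrable because the Haar measure has polynomial volume growth: the group law is
  tempered, so a ball in the moment coordinates is covered by polynomially many left translates of one
  compact set.

  Identities for functions with values in a Frechet space are reduced to real functions by composing
  with linear functionals that are dominated by one of the seminorms.
\<close>

section \<open>Seminorms and dominated functionals\<close>

text \<open>Two obstacles shape the proof. Values lie in a space with a topology but no norm, so
  derivatives are limits of difference quotients, and the chain rule comes from a mean value
  inequality in each seminorm separately. And an enveloping algebra element acts through an
  arbitrary representative, whose letters need not lie in V^(n). It is replaced by a combination of
  words with letters there, which requires the defining ideal to act by zero. Only then do the
  bounds on A \<alpha>_n, A in U(V^(n)), apply to each derivative falling on 1 / \<alpha>_n: since
  V^(n) grows with n, the letters contributed by D_k, k \<le> n, all lie in V^(n). Growth is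
  measured in z_m = ln (1 + |x_m|). Up to constants, 1 / |\<alpha>_n| is at most exp (- \<rho>_n
  z_n), while \<mu>_n and the weight are at most exponentials of q times a sum of z_m; the choice of
  exponents becomes a triangular system of linear inequalities. That \<mu>_n does not depend on x_0,
  ..., x_n enters by evaluating it at the point where these coordinates are set to zero.\<close>

definition sublinear :: "('e::real_vector \<Rightarrow> real) \<Rightarrow> bool" where
  "sublinear q \<longleftrightarrow> (\<forall>x y. q (x + y) \<le> q x + q y) \<and> (\<forall>c\<ge>0. \<forall>x. q (c *\<^sub>R x) = c * q x)"

text \<open>Banach's auxiliary functional. For sublinear \<open>q\<close> it stays below
  \<open>q\<close>, keeps the value \<open>q y\<close> at \<open>y\<close> and takes the value
  \<open>- q y\<close> at \<open>- y\<close>, so it is linear on the line through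
  \<open>y\<close>.\<close>

definition shrink_along :: "'e::real_vector \<Rightarrow> ('e \<Rightarrow> real) \<Rightarrow> 'e \<Rightarrow> real" where
  "shrink_along y q x = (INF t\<in>{0..}. q (x + t *\<^sub>R y) - t * q y)"

lemma sublinear_zero: "sublinear q \<Longrightarrow> q 0 = 0"
  unfolding sublinear_def by (metis mult_zero_left order_refl scaleR_zero_left)

lemma sublinear_ge: "sublinear q \<Longrightarrow> - q (- x) \<le> q x"
  using sublinear_zero[of q] unfolding sublinear_def
  by (metis add.commute add.right_inverse le_add_same_cancel2 neg_le_iff_le
      add_le_cancel_left minus_add_cancel)

lemma shrink_along_aux:
  assumes "sublinear q"
  shows "bdd_below ((\<lambda>t. q (x + t *\<^sub>R y) - t * q y) ` {0..})"
proof (rule bdd_belowI2)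
  fix t :: real assume "t \<in> {0..}"
  then have t: "0 \<le> t" by simp
  have "t * q y = q (t *\<^sub>R y)" using assms t by (simp add: sublinear_def)
  also have "\<dots> = q ((x + t *\<^sub>R y) + (- x))" by simp
  also have "\<dots> \<le> q (x + t *\<^sub>R y) + q (- x)" using assms unfolding sublinear_def by blast
  finally show "- q (- x) \<le> q (x + t *\<^sub>R y) - t * q y" by linarith
qed

lemma shrink_along_le:
  assumes "sublinear q" "0 \<le> t"
  shows "shrink_along y q x \<le> q (x + t *\<^sub>R y) - t * q y"
  unfolding shrink_along_def
  by (rule cINF_lower[OF shrink_along_aux[OF assms(1)]]) (use assms in auto)

lemma shrink_along_greatest:
  assumes "\<And>t. 0 \<le> t \<Longrightarrow> c \<le> q (x + t *\<^sub>R y) - t * q y"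
  shows "c \<le> shrink_along y q x"
  unfolding shrink_along_def by (rule cINF_greatest) (use assms in auto)

text \<open>For subadditivity the parameters \<open>t\<close> and \<open>s\<close> of two points
  enter as \<open>t + s\<close> at their sum. For homogeneity \<open>t\<close> is rescaled to
  \<open>c * t\<close>, and the inequality for \<open>1 / c\<close> gives the reverse one.\<close>

lemma sublinear_shrink_along:
  assumes q: "sublinear q"
  shows "sublinear (shrink_along y q)"
proof -
  have add: "q (x + x') \<le> q x + q x'" for x x' using q by (simp add: sublinear_def)
  have hom: "0 \<le> c \<Longrightarrow> q (c *\<^sub>R x) = c * q x" for c x using q by (simp add: sublinear_def)
  have 1: "shrink_along y q (x + x') \<le> shrink_along y q x + shrink_along y q x'" for x x'
  proof -
    have "shrink_along y q (x + x') - shrink_along y q x' \<le> shrink_along y q x"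
    proof (rule shrink_along_greatest)
      fix t :: real assume t: "0 \<le> t"
      have "shrink_along y q (x + x') - (q (x + t *\<^sub>R y) - t * q y) \<le> shrink_along y q x'"
      proof (rule shrink_along_greatest)
        fix s :: real assume s: "0 \<le> s"
        have "shrink_along y q (x + x') \<le> q ((x + x') + (t + s) *\<^sub>R y) - (t + s) * q y"
          by (rule shrink_along_le) (use q t s in auto)
        also have "(x + x') + (t + s) *\<^sub>R y = (x + t *\<^sub>R y) + (x' + s *\<^sub>R y)"
          by (simp add: algebra_simps)
        finally show "shrink_along y q (x + x') - (q (x + t *\<^sub>R y) - t * q y)
            \<le> q (x' + s *\<^sub>R y) - s * q y"
          using add[of "x + t *\<^sub>R y" "x' + s *\<^sub>R y"] by (simp add: algebra_simps)
      qed
      then show "shrink_along y q (x + x') - shrink_along y q x' \<le> q (x + t *\<^sub>R y) - t * q y"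
        by linarith
    qed
    then show ?thesis by linarith
  qed
  have 2: "shrink_along y q (c *\<^sub>R x) \<le> c * shrink_along y q x" if c: "0 < c" for c x
  proof -
    have "shrink_along y q (c *\<^sub>R x) / c \<le> shrink_along y q x"
    proof (rule shrink_along_greatest)
      fix t :: real assume t: "0 \<le> t"
      have "shrink_along y q (c *\<^sub>R x) \<le> q (c *\<^sub>R x + (c * t) *\<^sub>R y) - (c * t) * q y"
        by (rule shrink_along_le) (use q t c in auto)
      also have "c *\<^sub>R x + (c * t) *\<^sub>R y = c *\<^sub>R (x + t *\<^sub>R y)" by (simp add: algebra_simps)
      also have "q (c *\<^sub>R (x + t *\<^sub>R y)) = c * q (x + t *\<^sub>R y)" using c by (simp add: hom)
      finally show "shrink_along y q (c *\<^sub>R x) / c \<le> q (x + t *\<^sub>R y) - t * q y"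
        using c by (simp add: field_simps)
    qed
    then show ?thesis using c by (simp add: field_simps)
  qed
  have 3: "shrink_along y q (c *\<^sub>R x) = c * shrink_along y q x" if c: "0 < c" for c x
  proof -
    have "c * shrink_along y q ((1 / c) *\<^sub>R (c *\<^sub>R x)) \<le> c * ((1 / c) * shrink_along y q (c *\<^sub>R x))"
      using 2[of "1 / c" "c *\<^sub>R x"] c by (intro mult_left_mono) auto
    then show ?thesis using 2[OF c, of x] c by simp
  qed
  have "shrink_along y q 0 \<le> 0"
    using shrink_along_le[OF q, of 0 y 0] sublinear_zero[OF q] by simp
  moreover have "0 \<le> shrink_along y q 0"
    by (rule shrink_along_greatest) (simp add: hom)
  ultimately have 4: "shrink_along y q 0 = 0" by simp
  show ?thesis unfolding sublinear_def
  proof (intro conjI allI impI)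
    fix c :: real and x :: 'a assume "0 \<le> c"
    then show "shrink_along y q (c *\<^sub>R x) = c * shrink_along y q x"
      using 3 4 by (cases "c = 0") auto
  qed (rule 1)
qed

text \<open>Subadditivity is where the chain is used: nearly optimal functionals at \<open>x\<close>
  and at \<open>y\<close> may differ, but the smaller of the two serves at both points.\<close>

lemma sublinear_INF_chain:
  assumes ne: "C \<noteq> {}" and sub: "\<And>q. q \<in> C \<Longrightarrow> sublinear q"
    and chain: "\<And>q r. q \<in> C \<Longrightarrow> r \<in> C \<Longrightarrow> (\<forall>x. q x \<le> r x) \<or> (\<forall>x. r x \<le> q x)"
    and bdd: "\<And>x. bdd_below ((\<lambda>q. q x) ` C)"
  shows "sublinear (\<lambda>x. INF q\<in>C. q x)"
  unfolding sublinear_def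
proof (intro conjI allI impI)
  have low: "(INF q\<in>C. q x) \<le> q x" if "q \<in> C" for q x
    using that bdd by (intro cINF_lower)
  fix x y
  have "(INF q\<in>C. q (x + y)) - (INF q\<in>C. q y) \<le> (INF q\<in>C. q x)"
  proof (rule cINF_greatest[OF ne])
    fix q assume q: "q \<in> C"
    have "(INF q\<in>C. q (x + y)) - q x \<le> (INF q\<in>C. q y)"
    proof (rule cINF_greatest[OF ne])
      fix r assume r: "r \<in> C"
      obtain m where m: "m \<in> C" "m x \<le> q x" "m y \<le> r y"
        using chain[OF q r] q r by blast
      have "(INF q\<in>C. q (x + y)) \<le> m (x + y)" using low m by blast
      also have "\<dots> \<le> m x + m y" using sub[OF m(1)] by (simp add: sublinear_def)
      finally show "(INF q\<in>C. q (x + y)) - q x \<le> r y" using m by linarith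
    qed
    then show "(INF q\<in>C. q (x + y)) - (INF q\<in>C. q y) \<le> q x" by linarith
  qed
  then show "(INF q\<in>C. q (x + y)) \<le> (INF q\<in>C. q x) + (INF q\<in>C. q y)" by linarith
next
  fix c :: real and x :: 'a assume c: "0 \<le> c"
  have low: "(INF q\<in>C. q x) \<le> q x" if "q \<in> C" for q x
    using that bdd by (intro cINF_lower)
  have hom: "q (c *\<^sub>R x) = c * q x" if "q \<in> C" "0 \<le> c" for q c x
    using sub that by (simp add: sublinear_def)
  show "(INF q\<in>C. q (c *\<^sub>R x)) = c * (INF q\<in>C. q x)"
  proof (cases "c = 0")
    case True
    then have "(INF q\<in>C. q (c *\<^sub>R x)) = (INF q\<in>C. 0)"
      by (intro INF_cong) (auto simp: hom sublinear_zero sub)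
    then show ?thesis using True ne by simp
  next
    case False
    then have c: "0 < c" using c by simp
    show ?thesis
    proof (rule antisym)
      have "(INF q\<in>C. q (c *\<^sub>R x)) / c \<le> (INF q\<in>C. q x)"
      proof (rule cINF_greatest[OF ne])
        fix q assume q: "q \<in> C"
        show "(INF q\<in>C. q (c *\<^sub>R x)) / c \<le> q x"
          using low[OF q, of "c *\<^sub>R x"] c by (simp add: hom[OF q] field_simps)
      qed
      then show "(INF q\<in>C. q (c *\<^sub>R x)) \<le> c * (INF q\<in>C. q x)" using c by (simp add: field_simps)
      show "c * (INF q\<in>C. q x) \<le> (INF q\<in>C. q (c *\<^sub>R x))"
        by (rule cINF_greatest[OF ne]) (use c low in \<open>simp add: hom\<close>)
    qed
  qed
qed

text \<open>Minimal sublinear functionals are linear: shrinking one along any vector does not change it.\<close>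

theorem hahn_banach_at:
  fixes p :: "'e::real_vector \<Rightarrow> real"
  assumes p: "sublinear p"
  shows "\<exists>l. linear l \<and> (\<forall>x. l x \<le> p x) \<and> l x0 = p x0"
proof -
  \<comment> \<open>Zorn's lemma is applied below this functional instead of \<open>p\<close>. Its
    value at \<open>- x0\<close> is at most \<open>- p x0\<close>, which forces the minimal
    functional to attain \<open>p x0\<close> at \<open>x0\<close>.\<close>
  define q0 where "q0 = shrink_along x0 p"
  have q0: "sublinear q0" unfolding q0_def by (rule sublinear_shrink_along[OF p])
  define A where "A = {q. sublinear q \<and> (\<forall>x. q x \<le> q0 x)}"
  \<comment> \<open>The order is reversed: a maximal element is a minimal functional, and a chain is
    bounded by its pointwise infimum.\<close>
  define R where "R = (\<lambda>q r :: 'e \<Rightarrow> real. \<forall>x. r x \<le> q x)"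
  have po: "partial_order_on A (relation_of R A)"
  proof (rule partial_order_on_relation_ofI)
    show "R q q" for q by (simp add: R_def)
    show "R q s" if "R q r" "R r s" for q r s
      using that order_trans unfolding R_def by blast
    show "q = r" if "R q r" "R r q" for q r
      using that unfolding R_def by (intro ext order_antisym) auto
  qed
  have "\<exists>u\<in>A. \<forall>a\<in>C. R a u" if C: "C \<in> Chains (relation_of R A)" for C
  proof (cases "C = {}")
    case True
    have "q0 \<in> A" using q0 by (simp add: A_def)
    then show ?thesis using True by blast
  next
    case ne: False
    have CA: "C \<subseteq> A" using C by (auto simp: Chains_def relation_of_def)
    have bdd: "bdd_below ((\<lambda>q. q x) ` C)" for x
    proof (rule bdd_belowI2)
      fix q assume "q \<in> C"
      then have "q \<in> A" using CA by blast
      then have "- q (- x) \<le> q x" "q (- x) \<le> q0 (- x)" using sublinear_ge by (auto simp: A_def)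
      then show "- q0 (- x) \<le> q x" by linarith
    qed
    define u where "u = (\<lambda>x. INF q\<in>C. q x)"
    have low: "u x \<le> q x" if "q \<in> C" for q x
      unfolding u_def using that bdd by (intro cINF_lower)
    have "sublinear u" unfolding u_def
    proof (rule sublinear_INF_chain[OF ne])
      show "sublinear q" if "q \<in> C" for q using that CA by (auto simp: A_def)
      show "(\<forall>x. q x \<le> r x) \<or> (\<forall>x. r x \<le> q x)" if "q \<in> C" "r \<in> C" for q r
        using C that unfolding Chains_def relation_of_def R_def by blast
    qed (rule bdd)
    moreover have "u x \<le> q0 x" for x
    proof -
      obtain q where "q \<in> C" using ne by blast
      then show ?thesis using order_trans[OF low] CA by (auto simp: A_def)
    qed
    ultimately have "u \<in> A" by (simp add: A_def)
    then show ?thesis using low by (auto simp: R_def)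
  qed
  from predicate_Zorn[OF po this] obtain q where q: "q \<in> A" and min: "\<And>r. r \<in> A \<Longrightarrow> R q r \<Longrightarrow> r = q"
    by blast
  have sq: "sublinear q" and qq0: "\<And>x. q x \<le> q0 x" using q by (auto simp: A_def)
  have le: "q x \<le> q (x + y) - q y" for x y
  proof -
    have l: "shrink_along y q z \<le> q z" for z using shrink_along_le[OF sq, of 0 y z] by simp
    have "shrink_along y q \<in> A" unfolding A_def
      using sublinear_shrink_along[OF sq] order_trans[OF l qq0] by simp
    then have "shrink_along y q = q" using min l by (auto simp: R_def)
    then show ?thesis using shrink_along_le[OF sq, of 1 y x] by simp
  qed
  have add: "q (x + y) = q x + q y" for x y
  proof (rule order_antisym)
    show "q (x + y) \<le> q x + q y" using sq by (simp add: sublinear_def)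
    show "q x + q y \<le> q (x + y)" using le[of x y] by simp
  qed
  have neg: "q (- x) = - q x" for x
    using add[of x "- x"] sublinear_zero[OF sq] by simp
  have "linear q"
  proof
    fix c x show "q (c *\<^sub>R x) = c *\<^sub>R q x"
    proof (cases "0 \<le> c")
      case False
      then have "0 \<le> - c" by simp
      then have "q ((- c) *\<^sub>R x) = (- c) * q x" using sq unfolding sublinear_def by blast
      then show ?thesis using neg[of "c *\<^sub>R x"] by simp
    qed (use sq in \<open>simp add: sublinear_def\<close>)
  qed (rule add)
  moreover have qp: "q x \<le> p x" for x
    using qq0[of x] shrink_along_le[OF p, of 0 x0 x] by (simp add: q0_def)
  moreover have "q x0 = p x0"
  proof -
    have "q (- x0) \<le> - p x0"
      using qq0[of "- x0"] shrink_along_le[OF p, of 1 x0 "- x0"] sublinear_zero[OF p]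
      by (simp add: q0_def)
    then show ?thesis using neg[of x0] qp[of x0] by simp
  qed
  ultimately show ?thesis by blast
qed

text \<open>The real-linear part of a Frechet structure. Every normed space is an instance with the
  constant family \<open>norm\<close>, so one calculus serves chart maps, complex multipliers and
  vector-valued symbols.\<close>

locale seminorm_space =
  fixes p :: "nat \<Rightarrow> 'e::{real_vector,t2_space} \<Rightarrow> real"
  assumes p_add: "p j (x + y) \<le> p j x + p j y"
    and p_scaleR: "p j (c *\<^sub>R x) = \<bar>c\<bar> * p j x"
    and open_p: "open U \<longleftrightarrow> (\<forall>x\<in>U. \<exists>J \<epsilon>. finite J \<and> 0 < \<epsilon> \<and> {y. \<forall>j\<in>J. p j (y - x) < \<epsilon>} \<subseteq> U)"
begin

lemma p_zero [simp]: "p j 0 = 0"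
  using p_scaleR[of j 0 0] by simp

lemma p_minus [simp]: "p j (- x) = p j x"
  using p_scaleR[of j "-1" x] by simp

lemma p_nonneg [simp]: "0 \<le> p j x"
  using p_add[of j x "- x"] by simp

lemma p_triangle_diff: "p j (x - z) \<le> p j (x - y) + p j (y - z)"
  using p_add[of j "x - y" "y - z"] by simp

lemma p_sum: "p j (sum f A) \<le> (\<Sum>a\<in>A. p j (f a))"
proof (induction A rule: infinite_finite_induct)
  case (insert x F)
  then show ?case using p_add[of j "f x" "sum f F"] by auto
qed auto

lemma p_sum_list: "p j (\<Sum>x\<leftarrow>xs. f x) \<le> (\<Sum>x\<leftarrow>xs. p j (f x))"
proof (induction xs)
  case (Cons x xs)
  then show ?case using p_add[of j "f x" "\<Sum>x\<leftarrow>xs. f x"] by auto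
qed auto

lemma sublinear_p: "sublinear (p j)"
  unfolding sublinear_def by (auto simp: p_add p_scaleR)

lemma open_p_ball: "open {y. p j (y - l) < \<epsilon>}"
  unfolding open_p
proof (rule ballI)
  fix x assume x: "x \<in> {y. p j (y - l) < \<epsilon>}"
  show "\<exists>J \<epsilon>'. finite J \<and> 0 < \<epsilon>' \<and> {y. \<forall>j\<in>J. p j (y - x) < \<epsilon>'} \<subseteq> {y. p j (y - l) < \<epsilon>}"
  proof (rule exI[of _ "{j}"], rule exI[of _ "\<epsilon> - p j (x - l)"], intro conjI)
  show "finite {j}" by simp
  show "0 < \<epsilon> - p j (x - l)" using x by simp
  show "{y. \<forall>i\<in>{j}. p i (y - x) < \<epsilon> - p j (x - l)} \<subseteq> {y. p j (y - l) < \<epsilon>}"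
  proof
    fix y assume "y \<in> {y. \<forall>i\<in>{j}. p i (y - x) < \<epsilon> - p j (x - l)}"
    then show "y \<in> {y. p j (y - l) < \<epsilon>}" using p_triangle_diff[of j y l x] by simp
  qed
  qed
qed

text \<open>The sort of \<open>'e\<close> does not relate topology and linear structure. This
  equivalence does, and continuity of addition and scaling is read off from it.\<close>

lemma tendsto_p_iff: "(f \<longlongrightarrow> l) F \<longleftrightarrow> (\<forall>j. ((\<lambda>x. p j (f x - l)) \<longlongrightarrow> 0) F)"
proof
  assume f: "(f \<longlongrightarrow> l) F"
  show "\<forall>j. ((\<lambda>x. p j (f x - l)) \<longlongrightarrow> 0) F"
  proof
    fix j
    show "((\<lambda>x. p j (f x - l)) \<longlongrightarrow> 0) F"
    proof (rule tendstoI)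
      fix e :: real assume e: "0 < e"
      have "l \<in> {y. p j (y - l) < e}" using e by simp
      from topological_tendstoD[OF f open_p_ball this]
      show "\<forall>\<^sub>F x in F. dist (p j (f x - l)) 0 < e" by simp
    qed
  qed
next
  assume r: "\<forall>j. ((\<lambda>x. p j (f x - l)) \<longlongrightarrow> 0) F"
  show "(f \<longlongrightarrow> l) F"
  proof (rule topological_tendstoI)
    fix U assume U: "open U" "l \<in> U"
    have "\<exists>J \<epsilon>. finite J \<and> 0 < \<epsilon> \<and> {y. \<forall>j\<in>J. p j (y - l) < \<epsilon>} \<subseteq> U"
      by (rule open_p[THEN iffD1, OF U(1), THEN bspec, OF U(2)])
    then obtain J \<epsilon> where J: "finite J" "0 < \<epsilon>" "{y. \<forall>j\<in>J. p j (y - l) < \<epsilon>} \<subseteq> U"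
      by (elim exE conjE)
    have "\<forall>\<^sub>F x in F. p j (f x - l) < \<epsilon>" for j
      using order_tendstoD(2)[OF r[rule_format] J(2)] .
    then have "\<forall>\<^sub>F x in F. \<forall>j\<in>J. p j (f x - l) < \<epsilon>"
      using J(1) by (simp add: eventually_ball_finite_distrib)
    then show "\<forall>\<^sub>F x in F. f x \<in> U" by eventually_elim (use J(3) in blast)
  qed
qed

text \<open>By the Hausdorff property: the constant sequence \<open>x\<close> converges to
  \<open>0\<close> as well as to \<open>x\<close>.\<close>

lemma eq_0_if_p_0:
  assumes "\<And>j. p j x = 0"
  shows "x = 0"
proof -
  have "((\<lambda>_::nat. x) \<longlongrightarrow> 0) sequentially" unfolding tendsto_p_iff using assms by simp
  moreover have "((\<lambda>_::nat. x) \<longlongrightarrow> x) sequentially" by simp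
  ultimately show ?thesis using tendsto_unique trivial_limit_sequentially by blast
qed

lemma sn_tendsto_add:
  fixes f g :: "'b \<Rightarrow> 'e"
  assumes "(f \<longlongrightarrow> a) F" "(g \<longlongrightarrow> b) F"
  shows "((\<lambda>x. f x + g x) \<longlongrightarrow> a + b) F"
  unfolding tendsto_p_iff
proof
  fix j
  have s: "((\<lambda>x. p j (f x - a) + p j (g x - b)) \<longlongrightarrow> 0) F"
    using tendsto_add[of "\<lambda>x. p j (f x - a)" 0 F "\<lambda>x. p j (g x - b)" 0] assms
    unfolding tendsto_p_iff by simp
  have e: "f x + g x - (a + b) = (f x - a) + (g x - b)" for x by simp
  show "((\<lambda>x. p j (f x + g x - (a + b))) \<longlongrightarrow> 0) F"
    by (rule tendsto_sandwich[OF _ _ tendsto_const s])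
      (auto intro!: always_eventually simp only: e p_nonneg p_add)
qed

lemma sn_tendsto_scaleR:
  fixes f :: "'b \<Rightarrow> 'e"
  assumes c: "(c \<longlongrightarrow> c0) F" and f: "(f \<longlongrightarrow> a) F"
  shows "((\<lambda>x. c x *\<^sub>R f x) \<longlongrightarrow> c0 *\<^sub>R a) F"
  unfolding tendsto_p_iff
proof
  fix j
  have "((\<lambda>x. \<bar>c x\<bar> * p j (f x - a) + \<bar>c x - c0\<bar> * p j a) \<longlongrightarrow> \<bar>c0\<bar> * 0 + \<bar>c0 - c0\<bar> * p j a) F"
    using f c unfolding tendsto_p_iff by (intro tendsto_intros) auto
  then have s: "((\<lambda>x. \<bar>c x\<bar> * p j (f x - a) + \<bar>c x - c0\<bar> * p j a) \<longlongrightarrow> 0) F" by simp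
  have le: "p j (c x *\<^sub>R f x - c0 *\<^sub>R a) \<le> \<bar>c x\<bar> * p j (f x - a) + \<bar>c x - c0\<bar> * p j a" for x
  proof -
    have "c x *\<^sub>R f x - c0 *\<^sub>R a = c x *\<^sub>R (f x - a) + (c x - c0) *\<^sub>R a" by (simp add: algebra_simps)
    then show ?thesis using p_add p_scaleR by metis
  qed
  show "((\<lambda>x. p j (c x *\<^sub>R f x - c0 *\<^sub>R a)) \<longlongrightarrow> 0) F"
    by (rule tendsto_sandwich[OF _ _ tendsto_const s]) (auto intro!: always_eventually simp: le)
qed

lemma sn_continuous_on_add:
  fixes f g :: "'b::topological_space \<Rightarrow> 'e"
  shows "continuous_on U f \<Longrightarrow> continuous_on U g \<Longrightarrow> continuous_on U (\<lambda>x. f x + g x)"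
  unfolding continuous_on_def by (intro ballI sn_tendsto_add) auto

lemma ex_functional: "\<exists>l. linear l \<and> (\<forall>x. \<bar>l x\<bar> \<le> p j x) \<and> l x0 = p j x0"
proof -
  obtain l where l: "linear l" "\<forall>x. l x \<le> p j x" "l x0 = p j x0"
    using hahn_banach_at[OF sublinear_p, of j x0] by (elim exE conjE)
  have "\<bar>l x\<bar> \<le> p j x" for x
    using l(2)[rule_format, of x] l(2)[rule_format, of "- x"] linear_neg[OF l(1), of x] by simp
  with l show ?thesis by (intro exI[of _ l]) simp
qed

lemma tendsto_functional:
  fixes f :: "'b \<Rightarrow> 'e"
  assumes "linear l" "\<And>x. \<bar>l x\<bar> \<le> p j x" "(f \<longlongrightarrow> a) F"
  shows "((\<lambda>x. l (f x)) \<longlongrightarrow> (l a :: real)) F"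
proof -
  have "((\<lambda>x. l (f x) - l a) \<longlongrightarrow> 0) F"
  proof (rule tendsto_rabs_zero_cancel, rule tendsto_sandwich[OF _ _ tendsto_const])
    show "((\<lambda>x. p j (f x - a)) \<longlongrightarrow> 0) F" using assms(3) unfolding tendsto_p_iff by blast
    show "\<forall>\<^sub>F x in F. \<bar>l (f x) - l a\<bar> \<le> p j (f x - a)"
      using assms(2) by (simp add: linear_diff[OF assms(1), symmetric])
  qed simp
  then show ?thesis by (simp add: LIM_zero_iff)
qed

lemma continuous_functional:
  assumes "linear l" "\<And>x. \<bar>l x\<bar> \<le> p j x"
  shows "continuous_on UNIV (l :: 'e \<Rightarrow> real)"
  unfolding continuous_on_def by (intro ballI tendsto_functional[OF assms] tendsto_ident_at)

lemma eqI_functional: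
  assumes "\<And>l j. linear l \<Longrightarrow> (\<And>x. \<bar>l x\<bar> \<le> p j x) \<Longrightarrow> l a = (l b :: real)"
  shows "a = b"
proof -
  have "p j (a - b) = 0" for j
  proof -
    obtain l where l: "linear l" "\<forall>x. \<bar>l x\<bar> \<le> p j x" "l (a - b) = p j (a - b)"
      using ex_functional[of j "a - b"] by (elim exE conjE)
    have "l a = l b" by (rule assms[OF l(1) l(2)[rule_format]])
    then show ?thesis using l(3) linear_diff[OF l(1), of a b] by simp
  qed
  then have "a - b = 0" by (rule eq_0_if_p_0)
  then show ?thesis by simp
qed

end

lemma seminorm_space_normed: "seminorm_space (\<lambda>_. norm :: 'b::real_normed_vector \<Rightarrow> real)"
proof
  fix U :: "'b set"
  have b: "{y. \<forall>j\<in>J. norm (y - x) < \<epsilon>} = ball x \<epsilon>" if "J \<noteq> {}" for J :: "nat set" and x :: 'b and \<epsilon>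
    using that by (auto simp: dist_norm norm_minus_commute)
  \<comment> \<open>For empty \<open>J\<close> the set on the right is the whole space, so for
    general \<open>J\<close> there is only an inclusion.\<close>
  have s: "ball x \<epsilon> \<subseteq> {y. \<forall>j\<in>J. norm (y - x) < \<epsilon>}" for J :: "nat set" and x :: 'b and \<epsilon>
    by (auto simp: dist_norm norm_minus_commute)
  show "open U \<longleftrightarrow> (\<forall>x\<in>U. \<exists>J \<epsilon>. finite J \<and> 0 < \<epsilon> \<and> {y. \<forall>j\<in>(J :: nat set). norm (y - x) < \<epsilon>} \<subseteq> U)"
  proof
    assume U: "open U"
    show "\<forall>x\<in>U. \<exists>J \<epsilon>. finite J \<and> 0 < \<epsilon> \<and> {y. \<forall>j\<in>(J :: nat set). norm (y - x) < \<epsilon>} \<subseteq> U"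
    proof
      fix x assume "x \<in> U"
      then obtain \<epsilon> where e: "0 < \<epsilon>" "ball x \<epsilon> \<subseteq> U" by (rule openE[OF U])
      show "\<exists>J \<epsilon>. finite J \<and> 0 < \<epsilon> \<and> {y. \<forall>j\<in>(J :: nat set). norm (y - x) < \<epsilon>} \<subseteq> U"
        by (rule exI[of _ "{0}"], rule exI[of _ \<epsilon>], subst b) (use e in auto)
    qed
  next
    assume r: "\<forall>x\<in>U. \<exists>J \<epsilon>. finite J \<and> 0 < \<epsilon> \<and> {y. \<forall>j\<in>(J :: nat set). norm (y - x) < \<epsilon>} \<subseteq> U"
    show "open U" unfolding open_contains_ball
    proof
      fix x assume x: "x \<in> U"
      obtain J :: "nat set" and \<epsilon> where e: "0 < \<epsilon>" "{y. \<forall>j\<in>J. norm (y - x) < \<epsilon>} \<subseteq> U"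
        using bspec[OF r x] by (elim exE conjE)
      show "\<exists>e>0. ball x e \<subseteq> U" by (intro exI[of _ \<epsilon>] conjI e(1) order_trans[OF s e(2)])
    qed
  qed
qed (simp_all add: norm_triangle_ineq)

section \<open>Difference quotients along curves\<close>

text \<open>The base value \<open>c0\<close> is a separate argument because the limit ignores
  \<open>c 0\<close>. For \<open>c t = f (g \<otimes> expo G (t *\<^sub>R X))\<close> it can be
  taken to be \<open>f g\<close>, exactly as in \<open>lder\<close>.\<close>

definition has_dq :: "(real \<Rightarrow> 'e::{real_vector,t2_space}) \<Rightarrow> 'e \<Rightarrow> 'e \<Rightarrow> bool" where
  "has_dq c c0 l \<longleftrightarrow> ((\<lambda>t. (c t - c0) /\<^sub>R t) \<longlongrightarrow> l) (at 0)"

lemma has_dq_Lim: "has_dq c c0 l \<Longrightarrow> Lim (at 0) (\<lambda>t. (c t - c0) /\<^sub>R t) = l"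
  unfolding has_dq_def by (rule tendsto_Lim) auto

lemma has_dq_cong:
  assumes "\<forall>\<^sub>F t in at 0. c t = d t"
  shows "has_dq c c0 l \<longleftrightarrow> has_dq d c0 l"
  unfolding has_dq_def by (rule tendsto_cong) (use assms in eventually_elim, simp)

lemma has_dq_linear:
  assumes "linear l" "continuous_on UNIV l" "has_dq c c0 d"
  shows "has_dq (\<lambda>t. l (c t)) (l c0) (l d)"
proof -
  have "((\<lambda>t. l ((c t - c0) /\<^sub>R t)) \<longlongrightarrow> l d) (at 0)"
    using assms(3) continuous_on_tendsto_compose[OF assms(2)] unfolding has_dq_def by simp
  then show ?thesis unfolding has_dq_def
    using assms(1) by (simp add: linear_diff linear_scale)
qed

lemma has_dq_const: "has_dq (\<lambda>t. c) c 0"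
  by (simp add: has_dq_def)

lemma has_dq_has_vector_derivative:
  "has_dq c (c 0) d \<longleftrightarrow> (c has_vector_derivative d) (at 0)"
  for c :: "real \<Rightarrow> 'b::real_normed_vector"
proof -
  have "(c has_vector_derivative d) (at 0) \<longleftrightarrow> ((\<lambda>y. norm ((c y - c 0 - y *\<^sub>R d) /\<^sub>R norm y)) \<longlongrightarrow> 0) (at 0)"
    unfolding has_vector_derivative_def has_derivative_at_within tendsto_norm_zero_iff
    by (simp add: bounded_linear_scaleR_left)
  also have "\<dots> \<longleftrightarrow> ((\<lambda>y. norm ((c y - c 0) /\<^sub>R y - d)) \<longlongrightarrow> 0) (at 0)"
  proof (rule tendsto_cong, rule eventually_at_filter[THEN iffD2, OF always_eventually], intro allI impI)
    fix y :: real assume y: "y \<noteq> 0"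
    then have "c y - c 0 - y *\<^sub>R d = y *\<^sub>R ((c y - c 0) /\<^sub>R y - d)" by (simp add: algebra_simps)
    then show "norm ((c y - c 0 - y *\<^sub>R d) /\<^sub>R norm y) = norm ((c y - c 0) /\<^sub>R y - d)"
      using y by (simp add: abs_mult)
  qed
  also have "\<dots> \<longleftrightarrow> has_dq c (c 0) d"
    unfolding has_dq_def tendsto_norm_zero_iff by (rule LIM_zero_iff)
  finally show ?thesis by simp
qed

context seminorm_space
begin

lemma has_dq_add: "has_dq c c0 l \<Longrightarrow> has_dq d d0 m \<Longrightarrow> has_dq (\<lambda>t. c t + d t) (c0 + d0) (l + m)"
  for c :: "real \<Rightarrow> 'e"
  unfolding has_dq_def using sn_tendsto_add[of "\<lambda>t. (c t - c0) /\<^sub>R t" l "at 0" "\<lambda>t. (d t - d0) /\<^sub>R t" m]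
  by (simp add: algebra_simps)

lemma has_dq_tendsto:
  fixes c :: "real \<Rightarrow> 'e"
  assumes "has_dq c c0 l"
  shows "(c \<longlongrightarrow> c0) (at 0)"
proof -
  have "((\<lambda>t. t *\<^sub>R ((c t - c0) /\<^sub>R t) + c0) \<longlongrightarrow> 0 *\<^sub>R l + c0) (at 0)"
    using assms unfolding has_dq_def by (intro sn_tendsto_add sn_tendsto_scaleR tendsto_intros)
  moreover have "\<forall>\<^sub>F t in at 0. t *\<^sub>R ((c t - c0) /\<^sub>R t) + c0 = c t"
    by (simp add: eventually_at_filter)
  ultimately show ?thesis by (simp add: tendsto_cong)
qed

end

text \<open>The instances are \<open>scaleR\<close>, complex scaling in a Frechet space and
  multiplication in a normed algebra; one product rule serves all three.\<close>

definition cont_bilinear :: "('b::{real_vector,t2_space} \<Rightarrow> 'c::{real_vector,t2_space} \<Rightarrow> 'd::{real_vector,t2_space}) \<Rightarrow> bool" where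
  "cont_bilinear B \<longleftrightarrow> (\<forall>x y z. B (x + y) z = B x z + B y z) \<and> (\<forall>x y z. B x (y + z) = B x y + B x z)
     \<and> (\<forall>c x y. B (c *\<^sub>R x) y = c *\<^sub>R B x y) \<and> (\<forall>c x y. B x (c *\<^sub>R y) = c *\<^sub>R B x y)
     \<and> continuous_on UNIV (\<lambda>(x, y). B x y)"

lemma cont_bilinear_tendsto:
  assumes "cont_bilinear B" "(f \<longlongrightarrow> a) F" "(g \<longlongrightarrow> b) F"
  shows "((\<lambda>x. B (f x) (g x)) \<longlongrightarrow> B a b) F"
proof -
  have "continuous_on UNIV (\<lambda>(x, y). B x y)" using assms(1) by (simp add: cont_bilinear_def)
  from continuous_on_tendsto_compose[OF this tendsto_Pair[OF assms(2,3)]]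
  show ?thesis by simp
qed

lemma cont_bilinear_continuous_on:
  assumes "cont_bilinear B" "continuous_on U f" "continuous_on U g"
  shows "continuous_on U (\<lambda>x. B (f x) (g x))"
  using assms(2,3) unfolding continuous_on_def by (intro ballI cont_bilinear_tendsto[OF assms(1)]) auto

lemma cont_bilinear_diff:
  assumes "cont_bilinear B"
  shows "B (x - x') y = B x y - B x' y" "B x (y - y') = B x y - B x y'"
proof -
  have "B (x + (-1) *\<^sub>R x') y = B x y + (-1) *\<^sub>R B x' y" "B x (y + (-1) *\<^sub>R y') = B x y + (-1) *\<^sub>R B x y'"
    using assms unfolding cont_bilinear_def by metis+
  then show "B (x - x') y = B x y - B x' y" "B x (y - y') = B x y - B x y'" by simp_all
qed

lemma has_dq_bilinear:
  fixes B :: "'b::{real_vector,t2_space} \<Rightarrow> 'c::{real_vector,t2_space} \<Rightarrow> 'd::{real_vector,t2_space}"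
  assumes B: "cont_bilinear B" and b: "seminorm_space (pc :: nat \<Rightarrow> 'c \<Rightarrow> real)"
    and d: "seminorm_space (pe :: nat \<Rightarrow> 'd \<Rightarrow> real)"
    and f: "has_dq f f0 f'" and g: "has_dq g g0 g'"
  shows "has_dq (\<lambda>t. B (f t) (g t)) (B f0 g0) (B f' g0 + B f0 g')"
proof -
  have "(g \<longlongrightarrow> g0) (at 0)" by (rule seminorm_space.has_dq_tendsto[OF b g])
  then have "((\<lambda>t. B ((f t - f0) /\<^sub>R t) (g t) + B f0 ((g t - g0) /\<^sub>R t)) \<longlongrightarrow> B f' g0 + B f0 g') (at 0)"
    using f g unfolding has_dq_def
    by (intro seminorm_space.sn_tendsto_add[OF d] cont_bilinear_tendsto[OF B] tendsto_const)
  moreover have "B ((f t - f0) /\<^sub>R t) (g t) + B f0 ((g t - g0) /\<^sub>R t) = (B (f t) (g t) - B f0 g0) /\<^sub>R t" for t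
  proof -
    have "B (r *\<^sub>R x) y = r *\<^sub>R B x y" "B x (r *\<^sub>R y) = r *\<^sub>R B x y" for r x y
      using B by (auto simp: cont_bilinear_def)
    then show ?thesis by (simp add: cont_bilinear_diff[OF B] algebra_simps)
  qed
  ultimately show ?thesis unfolding has_dq_def by simp
qed

lemma cont_bilinear_scaleR:
  assumes "seminorm_space (pe :: nat \<Rightarrow> 'e::{real_vector,t2_space} \<Rightarrow> real)"
  shows "cont_bilinear (scaleR :: real \<Rightarrow> 'e \<Rightarrow> 'e)"
  unfolding cont_bilinear_def
proof (intro conjI allI)
  show "continuous_on UNIV (\<lambda>(x::real, y::'e). x *\<^sub>R y)"
    unfolding continuous_on_def case_prod_beta
    by (intro ballI seminorm_space.sn_tendsto_scaleR[OF assms] tendsto_fst tendsto_snd tendsto_ident_at)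
qed (auto simp: algebra_simps)

lemma cont_bilinear_bounded:
  assumes "bounded_bilinear B"
  shows "cont_bilinear B"
proof -
  interpret bounded_bilinear B by fact
  show ?thesis unfolding cont_bilinear_def case_prod_beta
    by (intro conjI allI add_left add_right scaleR_left scaleR_right continuous_on continuous_on_fst
      continuous_on_snd continuous_on_id)
qed

section \<open>Closure properties of smooth maps\<close>

lemma pd_eqI: "has_dq (\<lambda>t. f (x + t *\<^sub>R v)) (f x) l \<Longrightarrow> pd v f x = l"
  unfolding pd_def by (rule has_dq_Lim)

lemma Ck_on_continuous: "Ck_on k U f \<Longrightarrow> continuous_on U f"
  by (cases k) auto

lemma Ck_on_Suc_dq:
  assumes "Ck_on (Suc k) U f" "v \<in> Basis" "x \<in> U"
  shows "has_dq (\<lambda>t. f (x + t *\<^sub>R v)) (f x) (pd v f x)"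
  using assms by (simp add: has_dq_def)

lemma eventually_shift_in_open:
  fixes x :: "'a::real_normed_vector"
  assumes "open U" "x \<in> U"
  shows "\<forall>\<^sub>F t in at (0::real). x + t *\<^sub>R v \<in> U"
proof -
  have "((\<lambda>t::real. x + t *\<^sub>R v) \<longlongrightarrow> x + 0 *\<^sub>R v) (at 0)" by (intro tendsto_intros)
  then show ?thesis using assms topological_tendstoD by fastforce
qed

lemma has_dq_cong_open:
  fixes x :: "'a::real_normed_vector"
  assumes "open U" "x \<in> U" "\<And>x. x \<in> U \<Longrightarrow> f x = g x"
  shows "has_dq (\<lambda>t. f (x + t *\<^sub>R v)) (f x) l \<longleftrightarrow> has_dq (\<lambda>t. g (x + t *\<^sub>R v)) (g x) l"
proof -
  have "\<forall>\<^sub>F t in at (0::real). f (x + t *\<^sub>R v) = g (x + t *\<^sub>R v)"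
    using eventually_shift_in_open[OF assms(1,2), of v] by eventually_elim (rule assms(3))
  then show ?thesis using has_dq_cong assms(2,3) by fastforce
qed

lemma pd_cong_open:
  fixes x :: "'a::real_normed_vector"
  assumes "open U" "x \<in> U" "\<And>x. x \<in> U \<Longrightarrow> f x = g x"
  shows "pd v f x = pd v g x"
  using has_dq_cong_open[of U x f g v, OF assms] unfolding pd_def has_dq_def Topological_Spaces.Lim_def by simp

lemma Ck_on_cong:
  fixes f :: "'a::euclidean_space \<Rightarrow> 'e::{real_vector,t2_space}"
  assumes "open U" "\<And>x. x \<in> U \<Longrightarrow> f x = g x" "Ck_on k U f"
  shows "Ck_on k U g"
  using assms(2,3)
proof (induction k arbitrary: f g)
  case 0
  then show ?case using continuous_on_cong[of U U f g] by simp
next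
  case (Suc k)
  have c: "continuous_on U g" using Suc.prems continuous_on_cong[of U U f g] by simp
  have e: "pd v f x = pd v g x" if "x \<in> U" for v x
    by (rule pd_cong_open[OF assms(1) that]) (rule Suc.prems(1))
  have "has_dq (\<lambda>t. g (x + t *\<^sub>R v)) (g x) (pd v g x)" if "v \<in> Basis" "x \<in> U" for v x
  proof -
    have "has_dq (\<lambda>t. f (x + t *\<^sub>R v)) (f x) (pd v f x)"
      using Suc.prems that by (simp add: has_dq_def)
    then show ?thesis
      using has_dq_cong_open[OF assms(1) that(2), of f g] Suc.prems(1) e[OF that(2)] by simp
  qed
  moreover have "Ck_on k U (pd v g)" if "v \<in> Basis" for v
    by (rule Suc.IH[of "pd v f"]) (use Suc.prems that e in auto)
  ultimately show ?case using c by (simp add: has_dq_def)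
qed

text \<open>\<open>pd\<close> is a \<open>Lim\<close>, hence determined by uniqueness of limits: it
  suffices to exhibit some functions to which the difference quotients converge.\<close>

lemma Ck_on_SucI:
  fixes f :: "'a::euclidean_space \<Rightarrow> 'e::{real_vector,t2_space}"
  assumes "open U" "continuous_on U f"
    and "\<And>v. v \<in> Basis \<Longrightarrow> \<exists>f'. (\<forall>x\<in>U. has_dq (\<lambda>t. f (x + t *\<^sub>R v)) (f x) (f' x)) \<and> Ck_on k U f'"
  shows "Ck_on (Suc k) U f"
proof -
  have "(\<forall>x\<in>U. ((\<lambda>t::real. (f (x + t *\<^sub>R v) - f x) /\<^sub>R t) \<longlongrightarrow> pd v f x) (at 0)) \<and> Ck_on k U (pd v f)"
    if "v \<in> Basis" for v
  proof -
    obtain f' where f': "\<And>x. x \<in> U \<Longrightarrow> has_dq (\<lambda>t. f (x + t *\<^sub>R v)) (f x) (f' x)" "Ck_on k U f'"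
      using assms(3)[OF \<open>v \<in> Basis\<close>] by blast
    then have e: "f' x = pd v f x" if "x \<in> U" for x using pd_eqI that by metis
    then show ?thesis using f' Ck_on_cong[OF assms(1) e f'(2)] by (auto simp: has_dq_def)
  qed
  then show ?thesis using assms(2) by simp
qed

lemma Ck_on_Suc_lower: "Ck_on (Suc k) U f \<Longrightarrow> Ck_on k U f"
proof (induction k arbitrary: f)
  case (Suc k)
  have "continuous_on U f" using Suc.prems Ck_on_continuous by blast
  moreover have "\<forall>v\<in>Basis. Ck_on k U (pd v f)" using Suc.prems Suc.IH by simp
  ultimately show ?case using Suc.prems by simp
qed simp

lemma Ck_on_const: "open U \<Longrightarrow> Ck_on k U (\<lambda>_. c)"
proof (induction k arbitrary: c)
  case (Suc k)
  then show ?case by (intro Ck_on_SucI) (auto intro: has_dq_const)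
qed simp

lemma Ck_on_linear:
  fixes f :: "'a::euclidean_space \<Rightarrow> 'b::{real_vector,t2_space}" and l :: "'b \<Rightarrow> 'c::{real_vector,t2_space}"
  assumes "linear l" "continuous_on UNIV l" "open U"
  shows "Ck_on k U f \<Longrightarrow> Ck_on k U (\<lambda>x. l (f x))"
proof (induction k arbitrary: f)
  case 0
  then show ?case using continuous_on_compose2[OF assms(2)] by simp
next
  case (Suc k)
  show ?case
  proof (rule Ck_on_SucI[OF assms(3)])
    show "continuous_on U (\<lambda>x. l (f x))"
      using continuous_on_compose2[OF assms(2) Ck_on_continuous[OF Suc.prems]] by simp
    fix v :: 'a assume v: "v \<in> Basis"
    show "\<exists>f'. (\<forall>x\<in>U. has_dq (\<lambda>t. l (f (x + t *\<^sub>R v))) (l (f x)) (f' x)) \<and> Ck_on k U f'"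
      using Ck_on_Suc_dq[OF Suc.prems v] has_dq_linear[OF assms(1,2)] Suc.IH[of "pd v f"] Suc.prems v
      by (intro exI[of _ "\<lambda>x. l (pd v f x)"]) auto
  qed
qed

lemma (in seminorm_space) Ck_on_add:
  fixes f g :: "'a::euclidean_space \<Rightarrow> 'e"
  assumes "open U"
  shows "Ck_on k U f \<Longrightarrow> Ck_on k U g \<Longrightarrow> Ck_on k U (\<lambda>x. f x + g x)"
proof (induction k arbitrary: f g)
  case 0
  then show ?case by (simp add: sn_continuous_on_add)
next
  case (Suc k)
  show ?case
  proof (rule Ck_on_SucI[OF assms])
    show "continuous_on U (\<lambda>x. f x + g x)"
      by (intro sn_continuous_on_add Ck_on_continuous[OF Suc.prems(1)] Ck_on_continuous[OF Suc.prems(2)])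
    fix v :: 'a assume v: "v \<in> Basis"
    show "\<exists>f'. (\<forall>x\<in>U. has_dq (\<lambda>t. f (x + t *\<^sub>R v) + g (x + t *\<^sub>R v)) (f x + g x) (f' x)) \<and> Ck_on k U f'"
      using Ck_on_Suc_dq[OF Suc.prems(1) v] Ck_on_Suc_dq[OF Suc.prems(2) v] has_dq_add
        Suc.IH[of "pd v f" "pd v g"] Suc.prems v
      by (intro exI[of _ "\<lambda>x. pd v f x + pd v g x"]) auto
  qed
qed

lemma (in seminorm_space) Ck_on_sum:
  fixes f :: "'i \<Rightarrow> 'a::euclidean_space \<Rightarrow> 'e"
  assumes "open U"
  shows "(\<And>i. i \<in> A \<Longrightarrow> Ck_on k U (f i)) \<Longrightarrow> Ck_on k U (\<lambda>x. \<Sum>i\<in>A. f i x)"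
proof (induction A rule: infinite_finite_induct)
  case (insert i A)
  then show ?case using Ck_on_add[OF assms, of k "f i" "\<lambda>x. \<Sum>i\<in>A. f i x"] by simp
qed (simp_all add: Ck_on_const[OF assms])

lemma Ck_on_bilinear:
  fixes f :: "'a::euclidean_space \<Rightarrow> 'b::{real_vector,t2_space}"
    and g :: "'a \<Rightarrow> 'c::{real_vector,t2_space}" and B :: "'b \<Rightarrow> 'c \<Rightarrow> 'd::{real_vector,t2_space}"
  assumes "open U" and B: "cont_bilinear B"
    and c: "seminorm_space (pc :: nat \<Rightarrow> 'c \<Rightarrow> real)" and d: "seminorm_space (pe :: nat \<Rightarrow> 'd \<Rightarrow> real)"
  shows "Ck_on k U f \<Longrightarrow> Ck_on k U g \<Longrightarrow> Ck_on k U (\<lambda>x. B (f x) (g x))"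
proof (induction k arbitrary: f g)
  case 0
  then show ?case by (simp add: cont_bilinear_continuous_on[OF B])
next
  case (Suc k)
  show ?case
  proof (rule Ck_on_SucI[OF assms(1)])
    show "continuous_on U (\<lambda>x. B (f x) (g x))"
      by (intro cont_bilinear_continuous_on[OF B] Ck_on_continuous[OF Suc.prems(1)] Ck_on_continuous[OF Suc.prems(2)])
    fix v :: 'a assume v: "v \<in> Basis"
    have a: "has_dq (\<lambda>t. B (f (x + t *\<^sub>R v)) (g (x + t *\<^sub>R v))) (B (f x) (g x))
        (B (pd v f x) (g x) + B (f x) (pd v g x))" if "x \<in> U" for x
      using has_dq_bilinear[OF B c d Ck_on_Suc_dq[OF Suc.prems(1) v that] Ck_on_Suc_dq[OF Suc.prems(2) v that]]
      by simp
    have b: "Ck_on k U (\<lambda>x. B (pd v f x) (g x) + B (f x) (pd v g x))"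
      using Suc.prems v Ck_on_Suc_lower[OF Suc.prems(1)] Ck_on_Suc_lower[OF Suc.prems(2)]
      by (intro seminorm_space.Ck_on_add[OF d assms(1)] Suc.IH) auto
    show "\<exists>f'. (\<forall>x\<in>U. has_dq (\<lambda>t. B (f (x + t *\<^sub>R v)) (g (x + t *\<^sub>R v))) (B (f x) (g x)) (f' x)) \<and> Ck_on k U f'"
      by (rule exI, rule conjI, rule ballI, rule a, assumption, rule b)
  qed
qed

lemma Ck_on_mult:
  fixes f g :: "'a::euclidean_space \<Rightarrow> 'b::real_normed_algebra"
  assumes "open U" "Ck_on k U f" "Ck_on k U g"
  shows "Ck_on k U (\<lambda>x. f x * g x)"
  using Ck_on_bilinear[OF assms(1) cont_bilinear_bounded[OF bounded_bilinear_mult]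
    seminorm_space_normed seminorm_space_normed assms(2,3)] .

text \<open>Bootstrapping: the derivative is a product of \<open>pd v f\<close> and two copies of
  the inverse itself, so order \<open>k\<close> of the inverse yields order \<open>k + 1\<close>.
  The phase factor in \<open>Ck_on_exp_ii\<close> is treated in the same way.\<close>

lemma Ck_on_inverse:
  fixes f :: "'a::euclidean_space \<Rightarrow> complex"
  assumes U: "open U" and nz: "\<And>x. x \<in> U \<Longrightarrow> f x \<noteq> 0"
  shows "Ck_on k U f \<Longrightarrow> Ck_on k U (\<lambda>x. inverse (f x))"
proof (induction k)
  case 0
  then show ?case using nz by (auto intro: continuous_on_inverse)
next
  case (Suc k)
  have IH: "Ck_on k U (\<lambda>x. inverse (f x))" by (rule Suc.IH[OF Ck_on_Suc_lower[OF Suc.prems]])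
  show ?case
  proof (rule Ck_on_SucI[OF U])
    show "continuous_on U (\<lambda>x. inverse (f x))"
      using Ck_on_continuous[OF Suc.prems] nz by (auto intro: continuous_on_inverse)
    fix v :: 'a assume v: "v \<in> Basis"
    have a: "has_dq (\<lambda>t. inverse (f (x + t *\<^sub>R v))) (inverse (f x)) (- 1 * (inverse (f x) * pd v f x * inverse (f x)))"
      if x: "x \<in> U" for x
    proof -
      have "((\<lambda>t. f (x + t *\<^sub>R v)) has_vector_derivative pd v f x) (at 0)"
        using Ck_on_Suc_dq[OF Suc.prems v x] has_dq_has_vector_derivative[of "\<lambda>t. f (x + t *\<^sub>R v)"] by simp
      then have "((\<lambda>t. f (x + t *\<^sub>R v)) has_derivative (\<lambda>h. h *\<^sub>R pd v f x)) (at 0)"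
        by (simp add: has_vector_derivative_def)
      from Deriv.has_derivative_inverse[OF _ this]
      have "((\<lambda>t. inverse (f (x + t *\<^sub>R v))) has_vector_derivative
          (- 1 * (inverse (f x) * pd v f x * inverse (f x)))) (at 0)"
        using nz[OF x] unfolding has_vector_derivative_def by simp
      then show ?thesis
        using has_dq_has_vector_derivative[of "\<lambda>t. inverse (f (x + t *\<^sub>R v))"] by simp
    qed
    have b: "Ck_on k U (\<lambda>x. - 1 * (inverse (f x) * pd v f x * inverse (f x)))"
      using Suc.prems v by (intro Ck_on_mult U IH Ck_on_const) auto
    show "\<exists>f'. (\<forall>x\<in>U. has_dq (\<lambda>t. inverse (f (x + t *\<^sub>R v))) (inverse (f x)) (f' x)) \<and> Ck_on k U f'"
      by (rule exI, rule conjI, rule ballI, rule a, assumption, rule b)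
  qed
qed

lemma Ck_on_of_real:
  "open U \<Longrightarrow> Ck_on k U f \<Longrightarrow> Ck_on k U (\<lambda>x. complex_of_real (f x))"
  by (rule Ck_on_linear) (auto intro!: linearI continuous_intros simp: scaleR_conv_of_real)

lemma Ck_on_exp_ii:
  fixes f :: "'a::euclidean_space \<Rightarrow> real"
  assumes U: "open U"
  shows "Ck_on k U f \<Longrightarrow> Ck_on k U (\<lambda>x. exp (\<i> * complex_of_real (f x)))"
proof (induction k)
  case 0
  then show ?case by (auto intro!: continuous_intros)
next
  case (Suc k)
  have IH: "Ck_on k U (\<lambda>x. exp (\<i> * complex_of_real (f x)))" by (rule Suc.IH[OF Ck_on_Suc_lower[OF Suc.prems]])
  show ?case
  proof (rule Ck_on_SucI[OF U])
    show "continuous_on U (\<lambda>x. exp (\<i> * complex_of_real (f x)))"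
      using Ck_on_continuous[OF Suc.prems] by (auto intro!: continuous_intros)
    fix v :: 'a assume v: "v \<in> Basis"
    have a: "has_dq (\<lambda>t. exp (\<i> * complex_of_real (f (x + t *\<^sub>R v)))) (exp (\<i> * complex_of_real (f x)))
        (\<i> * complex_of_real (pd v f x) * exp (\<i> * complex_of_real (f x)))"
      if x: "x \<in> U" for x
    proof -
      have "((\<lambda>t. f (x + t *\<^sub>R v)) has_vector_derivative pd v f x) (at 0)"
        using Ck_on_Suc_dq[OF Suc.prems v x] has_dq_has_vector_derivative[of "\<lambda>t. f (x + t *\<^sub>R v)"] by simp
      then have "((\<lambda>t. \<i> * complex_of_real (f (x + t *\<^sub>R v))) has_vector_derivative
          \<i> * complex_of_real (pd v f x)) (at 0)"
        by (intro has_vector_derivative_mult_right has_vector_derivative_of_real)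
          (simp add: has_real_derivative_iff_has_vector_derivative)
      from field_vector_diff_chain_at[OF this DERIV_exp]
      have "((\<lambda>t. exp (\<i> * complex_of_real (f (x + t *\<^sub>R v)))) has_vector_derivative
          (\<i> * complex_of_real (pd v f x) * exp (\<i> * complex_of_real (f x)))) (at 0)"
        by (simp add: o_def)
      then show ?thesis
        using has_dq_has_vector_derivative[of "\<lambda>t. exp (\<i> * complex_of_real (f (x + t *\<^sub>R v)))"] by simp
    qed
    have b: "Ck_on k U (\<lambda>x. \<i> * complex_of_real (pd v f x) * exp (\<i> * complex_of_real (f x)))"
      using Suc.prems v by (intro Ck_on_mult U IH Ck_on_const Ck_on_of_real) auto
    show "\<exists>f'. (\<forall>x\<in>U. has_dq (\<lambda>t. exp (\<i> * complex_of_real (f (x + t *\<^sub>R v)))) (exp (\<i> * complex_of_real (f x))) (f' x)) \<and> Ck_on k U f'"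
      by (rule exI, rule conjI, rule ballI, rule a, assumption, rule b)
  qed
qed

lemma Ck_on_slice:
  fixes m :: "'a::euclidean_space \<times> 'b::euclidean_space \<Rightarrow> 'e::{real_vector,t2_space}"
  assumes "open U" "U \<times> {y0} \<subseteq> W"
  shows "Ck_on k W m \<Longrightarrow> Ck_on k U (\<lambda>x. m (x, y0))"
proof (induction k arbitrary: m)
  case 0
  then show ?case using assms by (auto intro!: continuous_on_compose2[of W m] continuous_intros)
next
  case (Suc k)
  show ?case
  proof (rule Ck_on_SucI[OF assms(1)])
    show "continuous_on U (\<lambda>x. m (x, y0))"
      using assms Ck_on_continuous[OF Suc.prems]
      by (auto intro!: continuous_on_compose2[of W m] continuous_intros)
    fix v :: 'a assume v: "v \<in> Basis"
    then have v': "(v, 0::'b) \<in> Basis" by (simp add: Basis_prod_def)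
    show "\<exists>f'. (\<forall>x\<in>U. has_dq (\<lambda>t. m (x + t *\<^sub>R v, y0)) (m (x, y0)) (f' x)) \<and> Ck_on k U f'"
      using Ck_on_Suc_dq[OF Suc.prems v'] Suc.IH[of "pd (v, 0) m"] Suc.prems v' assms(2)
      by (intro exI[of _ "\<lambda>x. pd (v, 0) m (x, y0)"]) fastforce
  qed
qed

text \<open>Built from partial derivatives, so that linearity in the direction and smooth dependence
  on point and direction come by construction. That it is the derivative along curves with velocity
  \<open>v\<close> is the content of \<open>has_dq_chain\<close>.\<close>

definition dir_deriv :: "('a::euclidean_space \<Rightarrow> 'e::{real_vector,t2_space}) \<Rightarrow> 'a \<Rightarrow> 'a \<Rightarrow> 'e" where
  "dir_deriv f x v = (\<Sum>b\<in>Basis. (v \<bullet> b) *\<^sub>R pd b f x)"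

section \<open>Mean value inequality and chain rule in a seminorm\<close>

context seminorm_space
begin

text \<open>A functional dominated by \<open>p j\<close> and attaining it at the vector to be
  estimated reduces the claim to the real mean value inequality for
  \<open>l (c s) - s * l d\<close>.\<close>

lemma segment_estimate:
  fixes c :: "real \<Rightarrow> 'e"
  assumes c: "\<And>s. s \<in> closed_segment 0 t \<Longrightarrow> has_dq (\<lambda>h. c (s + h)) (c s) (c' s)"
    and b: "\<And>s. s \<in> closed_segment 0 t \<Longrightarrow> p j (c' s - d) \<le> \<epsilon>"
  shows "p j (c t - c 0 - t *\<^sub>R d) \<le> \<bar>t\<bar> * \<epsilon>"
proof -
  obtain l where l: "linear l" "\<forall>x. \<bar>l x\<bar> \<le> p j x" "l (c t - c 0 - t *\<^sub>R d) = p j (c t - c 0 - t *\<^sub>R d)"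
    using ex_functional[of j "c t - c 0 - t *\<^sub>R d"] by (elim exE conjE)
  have lc: "continuous_on UNIV l" by (rule continuous_functional[OF l(1)]) (use l(2) in blast)
  have D: "((\<lambda>s. l (c s) - s * l d) has_field_derivative (l (c' s) - l d)) (at s within closed_segment 0 t)"
    if s: "s \<in> closed_segment 0 t" for s
  proof -
    have "has_dq (\<lambda>h. l (c (s + h))) (l (c s)) (l (c' s))"
      by (rule has_dq_linear[OF l(1) lc c[OF s]])
    then have "((\<lambda>h. l (c (s + h))) has_field_derivative l (c' s)) (at 0)"
      using has_dq_has_vector_derivative[of "\<lambda>h. l (c (s + h))"]
      by (simp add: has_real_derivative_iff_has_vector_derivative)
    then have "((\<lambda>s. l (c s)) has_field_derivative l (c' s)) (at s)"
      using DERIV_shift[of "\<lambda>s. l (c s)" "l (c' s)" 0 s] by (simp add: add.commute)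
    then have "((\<lambda>s. l (c s) - s * l d) has_field_derivative (l (c' s) - l d)) (at s)"
      by (auto intro!: derivative_eq_intros)
    then show ?thesis by (rule has_field_derivative_at_within)
  qed
  have "norm ((l (c t) - t * l d) - (l (c 0) - 0 * l d)) \<le> \<epsilon> * norm (t - 0)"
  proof (rule field_differentiable_bound[OF convex_closed_segment D])
    fix s assume s: "s \<in> closed_segment 0 t"
    have "norm (l (c' s) - l d) = \<bar>l (c' s - d)\<bar>" using linear_diff[OF l(1)] by simp
    then show "norm (l (c' s) - l d) \<le> \<epsilon>" using l(2)[rule_format, of "c' s - d"] b[OF s] by simp
  qed auto
  moreover have "(l (c t) - t * l d) - (l (c 0) - 0 * l d) = p j (c t - c 0 - t *\<^sub>R d)"
    using l(3) by (simp add: linear_diff[OF l(1)] linear_scale[OF l(1)])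
  ultimately show ?thesis by (simp add: mult.commute)
qed

text \<open>The point moves from \<open>x\<close> to \<open>x + h\<close> one coordinate at a time.
  Every intermediate displacement is componentwise at most \<open>h\<close>, so the path stays in
  the ball, and each of the \<open>DIM('a)\<close> steps costs
  \<open>norm h * \<epsilon>\<close>.\<close>

lemma C1_estimate:
  fixes f :: "'a::euclidean_space \<Rightarrow> 'e"
  assumes f: "Ck_on (Suc k) U f" and U: "\<And>z. norm (z - x) \<le> r \<Longrightarrow> z \<in> U"
    and b: "\<And>b z. b \<in> Basis \<Longrightarrow> norm (z - x) \<le> r \<Longrightarrow> p j (pd b f z - pd b f x) \<le> \<epsilon>"
    and h: "norm h \<le> r"
  shows "p j (f (x + h) - f x - dir_deriv f x h) \<le> real DIM('a) * norm h * \<epsilon>"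
proof -
  have comp: "(\<Sum>b\<in>A. (h \<bullet> b) *\<^sub>R b) \<bullet> c = (if c \<in> A then h \<bullet> c else 0)"
    if "A \<subseteq> Basis" "c \<in> Basis" for A :: "'a set" and c
  proof -
    have fin: "finite A" using that finite_subset finite_Basis by blast
    have "(\<Sum>b\<in>A. (h \<bullet> b) *\<^sub>R b) \<bullet> c = (\<Sum>b\<in>A. if b = c then h \<bullet> c else 0)"
      unfolding inner_sum_left by (rule sum.cong) (use that in \<open>auto simp: inner_Basis\<close>)
    then show ?thesis using fin by simp
  qed
  have "p j (f (x + (\<Sum>b\<in>A. (h \<bullet> b) *\<^sub>R b)) - f x - (\<Sum>b\<in>A. (h \<bullet> b) *\<^sub>R pd b f x))
      \<le> real (card A) * norm h * \<epsilon>" if "A \<subseteq> Basis" for A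
  proof -
    have "finite A" using that finite_subset finite_Basis by blast
    then show ?thesis using that
    proof (induction A rule: finite_induct)
      case (insert b A)
      define y where "y = x + (\<Sum>b\<in>A. (h \<bullet> b) *\<^sub>R b)"
      define t where "t = h \<bullet> b"
      have bB: "b \<in> Basis" and AB: "A \<subseteq> Basis" using insert.prems by auto
      have seg: "norm (y + s *\<^sub>R b - x) \<le> r" if s: "s \<in> closed_segment 0 t" for s
      proof -
        have "\<bar>s\<bar> \<le> \<bar>t\<bar>" using s by (auto simp: closed_segment_eq_real_ivl split: if_splits)
        then have "norm ((\<Sum>b\<in>A. (h \<bullet> b) *\<^sub>R b) + s *\<^sub>R b) \<le> norm h"
          using bB insert.hyps
          by (intro norm_le_componentwise) (auto simp: inner_add_left comp[OF AB] inner_Basis t_def)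
        then show ?thesis using h by (simp add: y_def algebra_simps)
      qed
      have "p j (f (y + t *\<^sub>R b) - f (y + 0 *\<^sub>R b) - t *\<^sub>R pd b f x) \<le> \<bar>t\<bar> * \<epsilon>"
      proof (rule segment_estimate[where c = "\<lambda>s. f (y + s *\<^sub>R b)" and c' = "\<lambda>s. pd b f (y + s *\<^sub>R b)"])
        fix s assume s: "s \<in> closed_segment 0 t"
        show "has_dq (\<lambda>h. f (y + (s + h) *\<^sub>R b)) (f (y + s *\<^sub>R b)) (pd b f (y + s *\<^sub>R b))"
          using Ck_on_Suc_dq[OF f bB U[OF seg[OF s]]] by (simp add: algebra_simps)
        show "p j (pd b f (y + s *\<^sub>R b) - pd b f x) \<le> \<epsilon>" by (rule b[OF bB seg[OF s]])
      qed
      moreover have "\<bar>t\<bar> * \<epsilon> \<le> norm h * \<epsilon>"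
      proof (rule mult_right_mono)
        show "\<bar>t\<bar> \<le> norm h" using Basis_le_norm[OF bB] by (simp add: t_def)
        have "p j (pd b f x - pd b f x) \<le> \<epsilon>" using b[OF bB, of x] h norm_ge_zero[of h] by simp
        then show "0 \<le> \<epsilon>" by simp
      qed
      ultimately have 1: "p j (f (y + t *\<^sub>R b) - f y - t *\<^sub>R pd b f x) \<le> norm h * \<epsilon>" by simp
      have 2: "p j (f y - f x - (\<Sum>b\<in>A. (h \<bullet> b) *\<^sub>R pd b f x)) \<le> real (card A) * norm h * \<epsilon>"
        using insert.IH[OF AB] by (simp add: y_def)
      have eq: "f (x + (\<Sum>b\<in>insert b A. (h \<bullet> b) *\<^sub>R b)) - f x - (\<Sum>b\<in>insert b A. (h \<bullet> b) *\<^sub>R pd b f x)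
          = (f (y + t *\<^sub>R b) - f y - t *\<^sub>R pd b f x) + (f y - f x - (\<Sum>b\<in>A. (h \<bullet> b) *\<^sub>R pd b f x))"
        using insert.hyps by (simp add: y_def t_def algebra_simps)
      have "p j (f (x + (\<Sum>b\<in>insert b A. (h \<bullet> b) *\<^sub>R b)) - f x - (\<Sum>b\<in>insert b A. (h \<bullet> b) *\<^sub>R pd b f x))
          \<le> p j (f (y + t *\<^sub>R b) - f y - t *\<^sub>R pd b f x) + p j (f y - f x - (\<Sum>b\<in>A. (h \<bullet> b) *\<^sub>R pd b f x))"
        unfolding eq by (rule p_add)
      then show ?case using 1 2 insert.hyps by (simp add: algebra_simps)
    qed simp
  qed
  from this[OF order_refl] show ?thesis by (simp add: euclidean_representation dir_deriv_def)
qed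

lemma has_dq_chain:
  fixes f :: "'a::euclidean_space \<Rightarrow> 'e"
  assumes f: "Ck_on (Suc k) U f" and U: "open U" "x \<in> U" and \<gamma>: "has_dq \<gamma> x v"
  shows "has_dq (\<lambda>t. f (\<gamma> t)) (f x) (dir_deriv f x v)"
  unfolding has_dq_def tendsto_p_iff
proof
  fix j
  define q where "q = (\<lambda>t. (\<gamma> t - x) /\<^sub>R t)"
  have q: "(q \<longlongrightarrow> v) (at 0)" using \<gamma> by (simp add: has_dq_def q_def)
  have g: "(\<gamma> \<longlongrightarrow> x) (at 0)"
    by (rule seminorm_space.has_dq_tendsto[OF seminorm_space_normed \<gamma>])
  show "((\<lambda>t. p j ((f (\<gamma> t) - f x) /\<^sub>R t - dir_deriv f x v)) \<longlongrightarrow> 0) (at 0)"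
  proof (rule tendstoI)
    fix e :: real assume e: "0 < e"
    \<comment> \<open>Near \<open>0\<close> the quotient \<open>q t\<close> has norm below
      \<open>norm v + 1\<close>, so \<open>K * \<epsilon>\<close> bounds the remainder of the linear
      approximation. It takes one half of \<open>e\<close>; the other half is for replacing
      \<open>q t\<close> by \<open>v\<close>.\<close>
    define K where "K = real DIM('a) * (norm v + 1)"
    have K: "0 < K" by (simp add: K_def add_nonneg_pos)
    define \<epsilon> where "\<epsilon> = e / (2 * K)"
    have \<epsilon>: "0 < \<epsilon>" using e K by (simp add: \<epsilon>_def)
    have "\<forall>\<^sub>F z in nhds x. \<forall>b\<in>Basis. z \<in> U \<and> p j (pd b f z - pd b f x) \<le> \<epsilon>"
      unfolding eventually_ball_finite_distrib[OF finite_Basis]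
    proof
      fix b :: 'a assume b: "b \<in> Basis"
      have "continuous_on U (pd b f)" using f b Ck_on_continuous by auto
      then have "isCont (pd b f) x" using U continuous_on_eq_continuous_at by blast
      then have t: "(pd b f \<longlongrightarrow> pd b f x) (at x)" by (simp add: isCont_def)
      have "((\<lambda>z. p j (pd b f z - pd b f x)) \<longlongrightarrow> 0) (at x)"
        using t unfolding tendsto_p_iff by simp
      then have "\<forall>\<^sub>F z in at x. p j (pd b f z - pd b f x) < \<epsilon>" using \<epsilon> order_tendstoD(2) by blast
      then have "\<forall>\<^sub>F z in nhds x. p j (pd b f z - pd b f x) \<le> \<epsilon>"
        unfolding eventually_at_filter using \<epsilon> by (auto elim!: eventually_mono)
      moreover have "\<forall>\<^sub>F z in nhds x. z \<in> U" using U eventually_nhds by blast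
      ultimately show "\<forall>\<^sub>F z in nhds x. z \<in> U \<and> p j (pd b f z - pd b f x) \<le> \<epsilon>"
        by eventually_elim simp
    qed
    then obtain d where d: "0 < d" "\<And>z. dist z x < d \<Longrightarrow> \<forall>b\<in>Basis. z \<in> U \<and> p j (pd b f z - pd b f x) \<le> \<epsilon>"
      unfolding eventually_nhds_metric by blast
    have est: "p j (f (x + h) - f x - dir_deriv f x h) \<le> real DIM('a) * norm h * \<epsilon>" if "norm h \<le> d / 2" for h
    proof (rule C1_estimate[OF f _ _ that])
      fix z assume "norm (z - x) \<le> d / 2"
      then have z: "dist z x < d" using d(1) by (simp add: dist_norm)
      show "z \<in> U" using d(2)[OF z] nonempty_Basis by blast
      show "b \<in> Basis \<Longrightarrow> p j (pd b f z - pd b f x) \<le> \<epsilon>" for b using d(2)[OF z] by blast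
    qed
    have "((\<lambda>t. norm (\<gamma> t - x)) \<longlongrightarrow> 0) (at 0)" using g by (simp add: LIM_zero tendsto_norm_zero)
    then have ev1: "\<forall>\<^sub>F t in at 0. norm (\<gamma> t - x) < d / 2" using d(1) order_tendstoD(2) half_gt_zero by blast
    have "((\<lambda>t. norm (q t)) \<longlongrightarrow> norm v) (at 0)" using q by (rule tendsto_norm)
    then have ev2: "\<forall>\<^sub>F t in at 0. norm (q t) < norm v + 1" by (rule order_tendstoD(2)) simp
    have "((\<lambda>t. \<Sum>b\<in>Basis. \<bar>(q t - v) \<bullet> b\<bar> * p j (pd b f x)) \<longlongrightarrow> (\<Sum>b\<in>Basis. \<bar>(v - v) \<bullet> b\<bar> * p j (pd b f x))) (at 0)"
      using q by (intro tendsto_intros)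
    then have "((\<lambda>t. \<Sum>b\<in>Basis. \<bar>(q t - v) \<bullet> b\<bar> * p j (pd b f x)) \<longlongrightarrow> 0) (at 0)" by simp
    then have ev3: "\<forall>\<^sub>F t in at 0. (\<Sum>b\<in>Basis. \<bar>(q t - v) \<bullet> b\<bar> * p j (pd b f x)) < e / 2"
      using e order_tendstoD(2) half_gt_zero by blast
    have ev0: "\<forall>\<^sub>F t in at (0::real). t \<noteq> 0" by (simp add: eventually_at_filter)
    show "\<forall>\<^sub>F t in at 0. dist (p j ((f (\<gamma> t) - f x) /\<^sub>R t - dir_deriv f x v)) 0 < e"
      using ev0 ev1 ev2 ev3
    proof eventually_elim
      case (elim t)
      define h where "h = \<gamma> t - x"
      have h: "h = t *\<^sub>R q t" using elim(1) by (simp add: h_def q_def)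
      have lin: "dir_deriv f x h /\<^sub>R t - dir_deriv f x v = (\<Sum>b\<in>Basis. ((q t - v) \<bullet> b) *\<^sub>R pd b f x)"
        using elim(1) unfolding dir_deriv_def h
        by (simp add: scaleR_sum_right inner_diff_left sum_subtractf[symmetric] scaleR_diff_left
            mult.assoc[symmetric])
      have eq: "(f (\<gamma> t) - f x) /\<^sub>R t - dir_deriv f x v
          = (f (x + h) - f x - dir_deriv f x h) /\<^sub>R t + (\<Sum>b\<in>Basis. ((q t - v) \<bullet> b) *\<^sub>R pd b f x)"
        unfolding lin[symmetric] by (simp add: h_def algebra_simps)
      have "p j ((f (\<gamma> t) - f x) /\<^sub>R t - dir_deriv f x v)
          \<le> p j ((f (x + h) - f x - dir_deriv f x h) /\<^sub>R t) + p j (\<Sum>b\<in>Basis. ((q t - v) \<bullet> b) *\<^sub>R pd b f x)"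
        unfolding eq by (rule p_add)
      also have "p j ((f (x + h) - f x - dir_deriv f x h) /\<^sub>R t) = p j (f (x + h) - f x - dir_deriv f x h) / \<bar>t\<bar>"
        by (simp add: p_scaleR divide_inverse)
      also have "\<dots> \<le> (real DIM('a) * norm h * \<epsilon>) / \<bar>t\<bar>"
        by (rule divide_right_mono[OF est]) (use elim(2) in \<open>auto simp: h_def\<close>)
      also have "\<dots> = real DIM('a) * norm (q t) * \<epsilon>" using elim(1) by (simp add: h)
      also have "\<dots> \<le> K * \<epsilon>" unfolding K_def
        using elim(3) \<epsilon> by (intro mult_right_mono mult_left_mono) auto
      also have "K * \<epsilon> = e / 2" using K by (simp add: \<epsilon>_def)
      also have "p j (\<Sum>b\<in>Basis. ((q t - v) \<bullet> b) *\<^sub>R pd b f x) \<le> (\<Sum>b\<in>Basis. \<bar>(q t - v) \<bullet> b\<bar> * p j (pd b f x))"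
        using p_sum[of j "\<lambda>b. ((q t - v) \<bullet> b) *\<^sub>R pd b f x" Basis] by (simp add: p_scaleR)
      finally show ?case using elim(4) by simp
    qed
  qed
qed

end

lemma smooth_on_Ck: "smooth_on U f \<Longrightarrow> Ck_on k U f"
  by (simp add: smooth_on_def)

lemma smooth_on_open: "smooth_on U f \<Longrightarrow> open U"
  by (simp add: smooth_on_def)

lemma smooth_on_pd:
  assumes "smooth_on U f" "b \<in> Basis"
  shows "smooth_on U (pd b f)"
proof -
  have "Ck_on k U (pd b f)" for k using smooth_on_Ck[OF assms(1), of "Suc k"] assms(2) by simp
  then show ?thesis using smooth_on_open[OF assms(1)] by (simp add: smooth_on_def)
qed

lemma smooth_on_slice:
  fixes m :: "'a::euclidean_space \<times> 'b::euclidean_space \<Rightarrow> 'e::{real_vector,t2_space}"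
  assumes "smooth_on W m" "open U" "U \<times> {y0} \<subseteq> W"
  shows "smooth_on U (\<lambda>x. m (x, y0))"
  using assms(1,2) by (auto simp: smooth_on_def intro: Ck_on_slice[OF assms(2,3)])

lemma smooth_on_cong:
  assumes "smooth_on U f" "\<And>x. x \<in> U \<Longrightarrow> f x = g x"
  shows "smooth_on U g"
  using assms Ck_on_cong[of U f g] by (simp add: smooth_on_def)

lemma smooth_on_dir_deriv:
  fixes f :: "'a::euclidean_space \<Rightarrow> 'e::{real_vector,t2_space}"
    and \<xi> :: "'a \<Rightarrow> 'a"
  assumes p: "seminorm_space (p :: nat \<Rightarrow> 'e \<Rightarrow> real)" and f: "smooth_on U f" and \<xi>: "smooth_on U \<xi>"
  shows "smooth_on U (\<lambda>x. dir_deriv f x (\<xi> x))"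
proof -
  have U: "open U" using f by (rule smooth_on_open)
  have "Ck_on k U (\<lambda>x. \<Sum>b\<in>Basis. (\<xi> x \<bullet> b) *\<^sub>R pd b f x)" for k
  proof (intro seminorm_space.Ck_on_sum[OF p U] Ck_on_bilinear[OF U cont_bilinear_scaleR[OF p] p p])
    fix b :: 'a assume b: "b \<in> Basis"
    show "Ck_on k U (pd b f)" using smooth_on_Ck[OF smooth_on_pd[OF f b]] .
    show "Ck_on k U (\<lambda>x. \<xi> x \<bullet> b)"
      by (rule Ck_on_linear[OF _ _ U smooth_on_Ck[OF \<xi>]])
         (auto intro!: linearI continuous_intros simp: inner_add_left)
  qed
  then show ?thesis using U by (simp add: smooth_on_def dir_deriv_def)
qed

lemma has_dq_Pair:
  assumes "has_dq f f0 f'" "has_dq g g0 g'"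
  shows "has_dq (\<lambda>t. (f t, g t)) (f0, g0) (f', g')"
  using tendsto_Pair[OF assms[unfolded has_dq_def]] by (simp add: has_dq_def)

lemma linear_dir_deriv: "linear (dir_deriv f x)"
  by (rule linearI) (simp_all add: dir_deriv_def inner_add_left scaleR_add_left sum.distrib scaleR_sum_right)

section \<open>Left-invariant derivatives in charts\<close>

context lie_group
begin

lemma mem_carrier [simp]: "x \<in> carrier G"
  by (simp add: carrier_UNIV)

lemma chart_inv [simp]:
  assumes "(U, \<kappa>) \<in> charts G" "x \<in> U"
  shows "inv_into U \<kappa> (\<kappa> x) = x"
  using chart_homeo[OF assms(1)] assms(2) by (simp add: homeomorphism_def)

lemma chart_at: obtains U \<kappa> where "(U, \<kappa>) \<in> charts G" "g \<in> U"
proof -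
  have "g \<in> (\<Union>(U, \<kappa>)\<in>charts G. U)" using chart_cover by simp
  then show ?thesis using that by auto
qed

lemma expo_0 [simp]: "expo G 0 = \<one>"
proof -
  have "expo G 0 = expo G 0 \<otimes> expo G 0" using expo_hom[of 0 0 0] by simp
  then show ?thesis using l_cancel_one'[of "expo G 0" "expo G 0"] by simp
qed

lemma expo_tendsto: "((\<lambda>t. expo G (t *\<^sub>R X)) \<longlongrightarrow> \<one>) (at (0::real))"
proof -
  have "continuous_on UNIV (\<lambda>t::real. expo G (t *\<^sub>R X))"
    using expo_smooth[of X] by (simp add: smooth_into_def)
  then have "isCont (\<lambda>t::real. expo G (t *\<^sub>R X)) 0" using continuous_on_eq_continuous_at open_UNIV by blast
  then show ?thesis by (simp add: isCont_def)
qed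

text \<open>
  The field \<open>\<xi> X\<close> is the partial derivative of the multiplication in the second variable at the
  identity, which makes its smoothness and its linearity in \<open>X\<close> visible.
\<close>

lemma left_invariant_field:
  assumes ch: "(U, \<kappa>) \<in> charts G"
  shows "\<exists>\<xi>. (\<forall>x. linear (\<lambda>X. \<xi> X x)) \<and> (\<forall>X. smooth_on (\<kappa> ` U) (\<xi> X)) \<and>
    (\<forall>X. \<forall>g\<in>U. has_dq (\<lambda>t. \<kappa> (g \<otimes> expo G (t *\<^sub>R X))) (\<kappa> g) (\<xi> X (\<kappa> g)) \<and>
       (\<forall>\<^sub>F t in at 0. g \<otimes> expo G (t *\<^sub>R X) \<in> U))"
proof -
  obtain W \<eta> where W: "(W, \<eta>) \<in> charts G" "\<one> \<in> W" by (rule chart_at)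
  obtain T where T: "linear T" "\<And>X. ((\<lambda>t. \<eta> (expo G (t *\<^sub>R X))) has_vector_derivative T X) (at 0)"
    using expo_tangent[OF W] by auto
  define f where "f = (\<lambda>(x, y). inv_into U \<kappa> x \<otimes> inv_into W \<eta> y)"
  define m where "m = \<kappa> \<circ> f"
  \<comment> \<open>The coordinates of pairs whose product stays in the chart \<open>U\<close>; it
    contains all points \<open>(\<kappa> g, \<eta> \<one>)\<close>, around which the multiplication
    is differentiated.\<close>
  define \<Omega> where "\<Omega> = (\<kappa> ` U \<times> \<eta> ` W) \<inter> f -` U"
  have m: "smooth_on \<Omega> m"
    using mult_smooth[OF ch W(1)] ch unfolding smooth_into_def f_def[symmetric] m_def \<Omega>_def by auto
  have f_eq: "f (\<kappa> g, \<eta> h) = g \<otimes> h" if "g \<in> U" "h \<in> W" for g h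
    using that ch W by (simp add: f_def)
  have in\<Omega>: "(\<kappa> g, \<eta> \<one>) \<in> \<Omega>" if "g \<in> U" for g
    using that W f_eq[OF that W(2)] by (simp add: \<Omega>_def)
  define \<xi> where "\<xi> = (\<lambda>X x. dir_deriv m (x, \<eta> \<one>) (0, T X))"
  have "linear (\<lambda>X. \<xi> X x)" for x
  proof -
    have "linear (\<lambda>X. (0::'a, T X))"
      by (rule linearI) (simp_all add: linear_add[OF T(1)] linear_scale[OF T(1)])
    from linear_compose[OF this linear_dir_deriv] show ?thesis by (simp add: \<xi>_def o_def)
  qed
  moreover have "smooth_on (\<kappa> ` U) (\<xi> X)" for X
  proof -
    have op: "open (\<kappa> ` U)" by (rule chart_image_open[OF ch])
    have sub: "\<kappa> ` U \<times> {\<eta> \<one>} \<subseteq> \<Omega>" using in\<Omega> by auto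
    have const: "smooth_on \<Omega> (\<lambda>_. (0::'a, T X))"
      using smooth_on_open[OF m] by (simp add: smooth_on_def Ck_on_const)
    show ?thesis unfolding \<xi>_def
      by (rule smooth_on_slice[where m = "\<lambda>z. dir_deriv m z (0, T X)", OF _ op sub])
         (rule smooth_on_dir_deriv[OF seminorm_space_normed m const])
  qed
  moreover have "has_dq (\<lambda>t. \<kappa> (g \<otimes> expo G (t *\<^sub>R X))) (\<kappa> g) (\<xi> X (\<kappa> g)) \<and>
       (\<forall>\<^sub>F t in at 0. g \<otimes> expo G (t *\<^sub>R X) \<in> U)" if g: "g \<in> U" for X g
  proof -
    have e: "has_dq (\<lambda>t. \<eta> (expo G (t *\<^sub>R X))) (\<eta> \<one>) (T X)"
      using T(2)[of X] has_dq_has_vector_derivative[of "\<lambda>t. \<eta> (expo G (t *\<^sub>R X))"] by simp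
    have c: "has_dq (\<lambda>t. (\<kappa> g, \<eta> (expo G (t *\<^sub>R X)))) (\<kappa> g, \<eta> \<one>) (0, T X)"
      by (rule has_dq_Pair[OF has_dq_const e])
    have "has_dq (\<lambda>t. m (\<kappa> g, \<eta> (expo G (t *\<^sub>R X)))) (m (\<kappa> g, \<eta> \<one>)) (\<xi> X (\<kappa> g))"
      unfolding \<xi>_def
      by (rule seminorm_space.has_dq_chain[OF seminorm_space_normed smooth_on_Ck[OF m] smooth_on_open[OF m] in\<Omega>[OF g] c])
    moreover have "m (\<kappa> g, \<eta> \<one>) = \<kappa> g" using f_eq[OF g W(2)] by (simp add: m_def)
    moreover have evW: "\<forall>\<^sub>F t in at 0. expo G (t *\<^sub>R X) \<in> W"
      using topological_tendstoD[OF expo_tendsto chart_open[OF W(1)] W(2)] .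
    moreover have "\<forall>\<^sub>F t in at 0. m (\<kappa> g, \<eta> (expo G (t *\<^sub>R X))) = \<kappa> (g \<otimes> expo G (t *\<^sub>R X))"
      using evW by eventually_elim (simp add: m_def f_eq g)
    moreover have "\<forall>\<^sub>F t in at 0. g \<otimes> expo G (t *\<^sub>R X) \<in> U"
    proof -
      have "((\<lambda>t. (\<kappa> g, \<eta> (expo G (t *\<^sub>R X)))) \<longlongrightarrow> (\<kappa> g, \<eta> \<one>)) (at 0)"
        by (rule seminorm_space.has_dq_tendsto[OF seminorm_space_normed c])
      from topological_tendstoD[OF this smooth_on_open[OF m] in\<Omega>[OF g]] evW
      show ?thesis by eventually_elim (simp add: \<Omega>_def f_eq g)
    qed
    ultimately show ?thesis using has_dq_cong by fastforce
  qed
  ultimately show ?thesis by (intro exI[of _ \<xi>]) simp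
qed

lemma smooth_fun_chart: "smooth_fun G f \<Longrightarrow> (U, \<kappa>) \<in> charts G \<Longrightarrow> smooth_on (\<kappa> ` U) (f \<circ> inv_into U \<kappa>)"
  unfolding smooth_fun_def by auto

lemma has_dq_chart:
  fixes f :: "'g \<Rightarrow> 'e::{real_vector,t2_space}"
  assumes p: "seminorm_space (p :: nat \<Rightarrow> 'e \<Rightarrow> real)" and f: "smooth_fun G f"
    and ch: "(U, \<kappa>) \<in> charts G" and g: "g \<in> U"
    and v: "has_dq (\<lambda>t. \<kappa> (g \<otimes> expo G (t *\<^sub>R X))) (\<kappa> g) v"
    and ev: "\<forall>\<^sub>F t in at 0. g \<otimes> expo G (t *\<^sub>R X) \<in> U"
  shows "has_dq (\<lambda>t. f (g \<otimes> expo G (t *\<^sub>R X))) (f g) (dir_deriv (f \<circ> inv_into U \<kappa>) (\<kappa> g) v)"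
proof -
  have "has_dq (\<lambda>t. (f \<circ> inv_into U \<kappa>) (\<kappa> (g \<otimes> expo G (t *\<^sub>R X)))) ((f \<circ> inv_into U \<kappa>) (\<kappa> g))
      (dir_deriv (f \<circ> inv_into U \<kappa>) (\<kappa> g) v)"
    by (rule seminorm_space.has_dq_chain[OF p smooth_on_Ck[OF smooth_fun_chart[OF f ch]] chart_image_open[OF ch] _ v])
       (use g in auto)
  moreover have "\<forall>\<^sub>F t in at 0. (f \<circ> inv_into U \<kappa>) (\<kappa> (g \<otimes> expo G (t *\<^sub>R X))) = f (g \<otimes> expo G (t *\<^sub>R X))"
    using ev by eventually_elim (simp add: ch)
  ultimately show ?thesis using has_dq_cong ch g by fastforce
qed

lemma has_dq_lder:
  fixes f :: "'g \<Rightarrow> 'e::{real_vector,t2_space}"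
  assumes p: "seminorm_space (p :: nat \<Rightarrow> 'e \<Rightarrow> real)" and f: "smooth_fun G f"
  shows "has_dq (\<lambda>t. f (g \<otimes> expo G (t *\<^sub>R X))) (f g) (lder G X f g)"
proof -
  obtain U \<kappa> where ch: "(U, \<kappa>) \<in> charts G" and g: "g \<in> U" by (rule chart_at)
  obtain \<xi> where \<xi>: "has_dq (\<lambda>t. \<kappa> (g \<otimes> expo G (t *\<^sub>R X))) (\<kappa> g) (\<xi> X (\<kappa> g))"
       "\<forall>\<^sub>F t in at 0. g \<otimes> expo G (t *\<^sub>R X) \<in> U"
    using left_invariant_field[OF ch] g by blast
  have "has_dq (\<lambda>t. f (g \<otimes> expo G (t *\<^sub>R X))) (f g) (dir_deriv (f \<circ> inv_into U \<kappa>) (\<kappa> g) (\<xi> X (\<kappa> g)))"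
    by (rule has_dq_chart[OF p f ch g \<xi>])
  then show ?thesis using has_dq_Lim unfolding lder_def by fastforce
qed

lemma lder_eqI:
  "has_dq (\<lambda>t. f (g \<otimes> expo G (t *\<^sub>R X))) (f g) l \<Longrightarrow> lder G X f g = l"
  unfolding lder_def by (rule has_dq_Lim)

lemma lder_chart:
  fixes f :: "'g \<Rightarrow> 'e::{real_vector,t2_space}"
  assumes p: "seminorm_space (p :: nat \<Rightarrow> 'e \<Rightarrow> real)" and f: "smooth_fun G f"
    and ch: "(U, \<kappa>) \<in> charts G"
  shows "\<exists>\<xi>. (\<forall>x. linear (\<lambda>X. \<xi> X x)) \<and> (\<forall>X. smooth_on (\<kappa> ` U) (\<xi> X)) \<and>
    (\<forall>X. \<forall>g\<in>U. lder G X f g = dir_deriv (f \<circ> inv_into U \<kappa>) (\<kappa> g) (\<xi> X (\<kappa> g)))"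
proof -
  obtain \<xi> where \<xi>: "\<forall>x. linear (\<lambda>X. \<xi> X x)" "\<forall>X. smooth_on (\<kappa> ` U) (\<xi> X)"
    "\<forall>X. \<forall>g\<in>U. has_dq (\<lambda>t. \<kappa> (g \<otimes> expo G (t *\<^sub>R X))) (\<kappa> g) (\<xi> X (\<kappa> g)) \<and>
       (\<forall>\<^sub>F t in at 0. g \<otimes> expo G (t *\<^sub>R X) \<in> U)"
    using left_invariant_field[OF ch] by (elim exE conjE)
  have "lder G X f g = dir_deriv (f \<circ> inv_into U \<kappa>) (\<kappa> g) (\<xi> X (\<kappa> g))" if "g \<in> U" for X g
    by (rule lder_eqI[OF has_dq_chart[OF p f ch that]]) (use \<xi>(3) that in auto)
  with \<xi>(1,2) show ?thesis by (intro exI[of _ \<xi>]) simp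
qed

lemma linear_lder:
  fixes f :: "'g \<Rightarrow> 'e::{real_vector,t2_space}"
  assumes p: "seminorm_space (p :: nat \<Rightarrow> 'e \<Rightarrow> real)" and f: "smooth_fun G f"
  shows "linear (\<lambda>X. lder G X f g)"
proof -
  obtain U \<kappa> where ch: "(U, \<kappa>) \<in> charts G" and g: "g \<in> U" by (rule chart_at)
  obtain \<xi> where \<xi>: "\<forall>x. linear (\<lambda>X. \<xi> X x)" "\<forall>X. smooth_on (\<kappa> ` U) (\<xi> X)"
    "\<forall>X. \<forall>g\<in>U. lder G X f g = dir_deriv (f \<circ> inv_into U \<kappa>) (\<kappa> g) (\<xi> X (\<kappa> g))"
    using lder_chart[OF p f ch] by (elim exE conjE)
  have "linear (dir_deriv (f \<circ> inv_into U \<kappa>) (\<kappa> g) \<circ> (\<lambda>X. \<xi> X (\<kappa> g)))"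
    by (rule linear_compose[OF \<xi>(1)[rule_format] linear_dir_deriv])
  then show ?thesis using \<xi>(3) g by (simp add: o_def)
qed

lemma smooth_fun_lder:
  fixes f :: "'g \<Rightarrow> 'e::{real_vector,t2_space}"
  assumes p: "seminorm_space (p :: nat \<Rightarrow> 'e \<Rightarrow> real)" and f: "smooth_fun G f"
  shows "smooth_fun G (lder G X f)"
  unfolding smooth_fun_def
proof clarify
  fix U \<kappa> assume ch: "(U, \<kappa>) \<in> charts G"
  obtain \<xi> where \<xi>: "\<forall>x. linear (\<lambda>X. \<xi> X x)" "\<forall>X. smooth_on (\<kappa> ` U) (\<xi> X)"
    "\<forall>X. \<forall>g\<in>U. lder G X f g = dir_deriv (f \<circ> inv_into U \<kappa>) (\<kappa> g) (\<xi> X (\<kappa> g))"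
    using lder_chart[OF p f ch] by (elim exE conjE)
  show "smooth_on (\<kappa> ` U) (lder G X f \<circ> inv_into U \<kappa>)"
  proof (rule smooth_on_cong)
    show "smooth_on (\<kappa> ` U) (\<lambda>x. dir_deriv (f \<circ> inv_into U \<kappa>) x (\<xi> X x))"
      by (rule smooth_on_dir_deriv[OF p smooth_fun_chart[OF f ch] \<xi>(2)[rule_format]])
    fix x assume "x \<in> \<kappa> ` U"
    then show "dir_deriv (f \<circ> inv_into U \<kappa>) x (\<xi> X x) = (lder G X f \<circ> inv_into U \<kappa>) x"
      using \<xi>(3) ch by auto
  qed
qed

lemma smooth_funI:
  assumes "\<And>U \<kappa> k. (U, \<kappa>) \<in> charts G \<Longrightarrow> open (\<kappa> ` U) \<Longrightarrow> Ck_on k (\<kappa> ` U) (f \<circ> inv_into U \<kappa>)"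
  shows "smooth_fun G f"
  unfolding smooth_fun_def smooth_on_def using assms chart_image_open by auto

lemma smooth_fun_Ck: "smooth_fun G f \<Longrightarrow> (U, \<kappa>) \<in> charts G \<Longrightarrow> Ck_on k (\<kappa> ` U) (f \<circ> inv_into U \<kappa>)"
  using smooth_fun_chart smooth_on_Ck by blast

lemma smooth_fun_linear:
  assumes "linear l" "continuous_on UNIV l" "smooth_fun G f"
  shows "smooth_fun G (\<lambda>x. l (f x))"
  by (rule smooth_funI) (use Ck_on_linear[OF assms(1,2) _ smooth_fun_Ck[OF assms(3)]] in \<open>simp add: o_def\<close>)

lemma lder_linear:
  fixes f :: "'g \<Rightarrow> 'e::{real_vector,t2_space}"
  assumes "linear l" "continuous_on UNIV l" and p: "seminorm_space (p :: nat \<Rightarrow> 'e \<Rightarrow> real)" and f: "smooth_fun G f"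
  shows "lder G X (\<lambda>x. l (f x)) g = l (lder G X f g)"
  by (rule lder_eqI, rule has_dq_linear[OF assms(1,2) has_dq_lder[OF p f]])

lemma lder_bracket:
  fixes f :: "'g \<Rightarrow> 'e::{real_vector,t2_space}"
  assumes p: "seminorm_space (p :: nat \<Rightarrow> 'e \<Rightarrow> real)" and f: "smooth_fun G f"
  shows "lder G (lie_bracket X Y) f g = lder G X (lder G Y f) g - lder G Y (lder G X f) g"
proof (rule seminorm_space.eqI_functional[OF p])
  fix l :: "'e \<Rightarrow> real" and j assume l: "linear l" "\<And>x. \<bar>l x\<bar> \<le> p j x"
  have c: "continuous_on UNIV l" by (rule seminorm_space.continuous_functional[OF p l])
  have e: "lder G X (\<lambda>x. l (h x)) = (\<lambda>g. l (lder G X h g))" if "smooth_fun G h" for X h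
    using lder_linear[OF l(1) c p that] by blast
  have s: "smooth_fun G (lder G X f)" for X by (rule smooth_fun_lder[OF p f])
  have "lder G (lie_bracket X Y) (\<lambda>x. l (f x)) g
      = lder G X (lder G Y (\<lambda>x. l (f x))) g - lder G Y (lder G X (\<lambda>x. l (f x))) g"
    by (rule bracket[OF smooth_fun_linear[OF l(1) c f]])
  then show "l (lder G (lie_bracket X Y) f g) = l (lder G X (lder G Y f) g - lder G Y (lder G X f) g)"
    by (simp add: e f s linear_diff[OF l(1)])
qed

lemma smooth_fun_const: "smooth_fun G (\<lambda>_. c)"
  by (rule smooth_funI) (simp add: o_def Ck_on_const)

lemma lder_const: "lder G X (\<lambda>_. c) g = 0"
  by (rule lder_eqI) (rule has_dq_const)

lemma smooth_fun_add:
  fixes f h :: "'g \<Rightarrow> 'e::{real_vector,t2_space}"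
  assumes p: "seminorm_space (p :: nat \<Rightarrow> 'e \<Rightarrow> real)" and f: "smooth_fun G f" and h: "smooth_fun G h"
  shows "smooth_fun G (\<lambda>x. f x + h x)"
  by (rule smooth_funI)
    (use seminorm_space.Ck_on_add[OF p _ smooth_fun_Ck[OF f] smooth_fun_Ck[OF h]] in \<open>simp add: o_def\<close>)

lemma lder_add:
  fixes f h :: "'g \<Rightarrow> 'e::{real_vector,t2_space}"
  assumes p: "seminorm_space (p :: nat \<Rightarrow> 'e \<Rightarrow> real)" and f: "smooth_fun G f" and h: "smooth_fun G h"
  shows "lder G X (\<lambda>x. f x + h x) g = lder G X f g + lder G X h g"
  by (rule lder_eqI, rule seminorm_space.has_dq_add[OF p has_dq_lder[OF p f] has_dq_lder[OF p h]])

lemma smooth_fun_scaleR: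
  fixes f :: "'g \<Rightarrow> 'e::{real_vector,t2_space}"
  assumes p: "seminorm_space (p :: nat \<Rightarrow> 'e \<Rightarrow> real)" and f: "smooth_fun G f"
  shows "smooth_fun G (\<lambda>x. c *\<^sub>R f x)" "lder G X (\<lambda>x. c *\<^sub>R f x) g = c *\<^sub>R lder G X f g"
proof -
  have l: "linear (\<lambda>v::'e. c *\<^sub>R v)" by (rule linearI) (simp_all add: algebra_simps)
  have c: "continuous_on UNIV (\<lambda>v::'e. c *\<^sub>R v)"
    unfolding continuous_on_def by (intro ballI seminorm_space.sn_tendsto_scaleR[OF p] tendsto_const tendsto_ident_at)
  show "smooth_fun G (\<lambda>x. c *\<^sub>R f x)" by (rule smooth_fun_linear[OF l c f])
  show "lder G X (\<lambda>x. c *\<^sub>R f x) g = c *\<^sub>R lder G X f g" by (rule lder_linear[OF l c p f])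
qed

lemma smooth_fun_bilinear:
  fixes f :: "'g \<Rightarrow> 'b::{real_vector,t2_space}" and h :: "'g \<Rightarrow> 'c::{real_vector,t2_space}"
    and B :: "'b \<Rightarrow> 'c \<Rightarrow> 'd::{real_vector,t2_space}"
  assumes B: "cont_bilinear B" and c: "seminorm_space (pc :: nat \<Rightarrow> 'c \<Rightarrow> real)"
    and d: "seminorm_space (pe :: nat \<Rightarrow> 'd \<Rightarrow> real)" and f: "smooth_fun G f" and h: "smooth_fun G h"
  shows "smooth_fun G (\<lambda>x. B (f x) (h x))"
  by (rule smooth_funI)
    (use Ck_on_bilinear[OF _ B c d smooth_fun_Ck[OF f] smooth_fun_Ck[OF h]] in \<open>simp add: o_def\<close>)

lemma lder_bilinear:
  fixes f :: "'g \<Rightarrow> 'b::{real_vector,t2_space}" and h :: "'g \<Rightarrow> 'c::{real_vector,t2_space}"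
    and B :: "'b \<Rightarrow> 'c \<Rightarrow> 'd::{real_vector,t2_space}"
  assumes B: "cont_bilinear B" and b: "seminorm_space (pb :: nat \<Rightarrow> 'b \<Rightarrow> real)"
    and c: "seminorm_space (pc :: nat \<Rightarrow> 'c \<Rightarrow> real)"
    and d: "seminorm_space (pe :: nat \<Rightarrow> 'd \<Rightarrow> real)" and f: "smooth_fun G f" and h: "smooth_fun G h"
  shows "lder G X (\<lambda>x. B (f x) (h x)) g = B (lder G X f g) (h g) + B (f g) (lder G X h g)"
  by (rule lder_eqI, rule has_dq_bilinear[OF B c d has_dq_lder[OF b f] has_dq_lder[OF c h]])

lemma smooth_fun_inverse:
  assumes "smooth_fun G (f :: 'g \<Rightarrow> complex)" "\<And>x. f x \<noteq> 0"
  shows "smooth_fun G (\<lambda>x. inverse (f x))"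
  by (rule smooth_funI)
    (use Ck_on_inverse[OF _ _ smooth_fun_Ck[OF assms(1)]] assms(2) in \<open>simp add: o_def\<close>)

lemma smooth_fun_exp_ii:
  assumes "smooth_fun G f"
  shows "smooth_fun G (\<lambda>x. exp (\<i> * complex_of_real (f x)))"
  by (rule smooth_funI) (use Ck_on_exp_ii[OF _ smooth_fun_Ck[OF assms]] in \<open>simp add: o_def\<close>)

lemma smooth_fun_continuous:
  assumes "smooth_fun G f"
  shows "continuous_on UNIV f"
proof -
  have "continuous (at g) f" for g
  proof -
    obtain U \<kappa> where ch: "(U, \<kappa>) \<in> charts G" and g: "g \<in> U" by (rule chart_at)
    have "continuous_on (\<kappa> ` U) (f \<circ> inv_into U \<kappa>)"
      using smooth_fun_Ck[OF assms ch, of 0] by simp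
    moreover have "continuous_on U \<kappa>" using chart_homeo[OF ch] by (simp add: homeomorphism_def)
    ultimately have "continuous_on U ((f \<circ> inv_into U \<kappa>) \<circ> \<kappa>)"
      using continuous_on_compose[of U \<kappa> "f \<circ> inv_into U \<kappa>"] by simp
    then have "continuous_on U f" by (rule continuous_on_eq) (simp add: ch)
    then show ?thesis using chart_open[OF ch] g continuous_on_eq_continuous_at by blast
  qed
  then show ?thesis using continuous_at_imp_continuous_on by blast
qed

end

section \<open>The action of the enveloping algebra\<close>

definition lders ::
  "('g, 'a::real_vector) lie_group_data \<Rightarrow> 'a list \<Rightarrow> ('g \<Rightarrow> 'e::{real_vector,t2_space}) \<Rightarrow> 'g \<Rightarrow> 'e" where
  "lders G w f = foldr (lder G) w f"

text \<open>\<open>uea_op\<close> for the left-invariant derivatives, with an arbitrary element of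
  the free algebra in place of the chosen representative \<open>rep_uea\<close>.\<close>

definition free_act ::
  "('g, 'a::real_vector) lie_group_data \<Rightarrow> ('a tword \<Rightarrow>\<^sub>0 real) \<Rightarrow> ('g \<Rightarrow> 'e::{real_vector,t2_space}) \<Rightarrow> 'g \<Rightarrow> 'e" where
  "free_act G q f g = (\<Sum>w\<in>Poly_Mapping.keys q. Poly_Mapping.lookup q w *\<^sub>R lders G (letters w) f g)"

definition word_uea :: "'a::lie_algebra list \<Rightarrow> 'a uea" where
  "word_uea w = prod_list (map uea_gen w)"

lemma lders_simps [simp]: "lders G [] f = f" "lders G (x # w) f = lder G x (lders G w f)"
  "lders G (v @ w) f = lders G v (lders G w f)"
  by (simp_all add: lders_def)

lemma free_act_superset:
  assumes "finite A" "Poly_Mapping.keys q \<subseteq> A"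
  shows "free_act G q f g = (\<Sum>w\<in>A. Poly_Mapping.lookup q w *\<^sub>R lders G (letters w) f g)"
  unfolding free_act_def
  by (rule sum.mono_neutral_left) (use assms in \<open>auto simp: in_keys_iff\<close>)

lemma free_act_single [simp]:
  "free_act G (Poly_Mapping.single w c) f g = c *\<^sub>R lders G (letters w) f g"
  by (subst free_act_superset[of "{w}"]) (auto simp: lookup_single)

lemma free_act_add [simp]: "free_act G (q + r) f g = free_act G q f g + free_act G r f g"
proof -
  let ?A = "Poly_Mapping.keys q \<union> Poly_Mapping.keys r"
  have A: "finite ?A" by simp
  show ?thesis
    using free_act_superset[OF A, of q G f g] free_act_superset[OF A, of r G f g]
      free_act_superset[OF A, of "q + r" G f g] Poly_Mapping.keys_add[of q r]
    by (simp add: lookup_add scaleR_add_left sum.distrib)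
qed

lemma free_act_diff [simp]: "free_act G (q - r) f g = free_act G q f g - free_act G r f g"
  using free_act_add[of G "q - r" r f g] by simp

lemma letters_zero [simp]: "letters (0 :: 'a tword) = []"
  by (simp add: zero_tword_def)

lemma letters_add [simp]: "letters (u + v) = letters u @ letters v"
  by (simp add: plus_tword_def)

lemma abs_uea_eq_iff: "abs_uea q = abs_uea r \<longleftrightarrow> q - r \<in> uea_ideal"
  using uea.abs_eq_iff by blast

lemma rep_abs_uea: "rep_uea (abs_uea q) - q \<in> uea_ideal"
  by (rule abs_uea_eq_iff[THEN iffD1, OF Quotient3_abs_rep[OF Quotient3_uea]])

lemma abs_uea_cases: obtains q where "u = abs_uea q"
  using Quotient3_abs_rep[OF Quotient3_uea, of u] by metis

lemma linear_uea_gen: "linear (uea_gen :: 'a::lie_algebra \<Rightarrow> 'a uea)"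
proof (rule linearI)
  have gen: "uea_gen (a *\<^sub>R x + b *\<^sub>R y) = a *\<^sub>R uea_gen x + b *\<^sub>R uea_gen y" for a b and x y :: 'a
  proof -
    have "free_gen (a *\<^sub>R x + b *\<^sub>R y) - (free_const a * free_gen x + free_const b * free_gen y) \<in> uea_ideal"
      using uea_ideal.linear[of a x b y] by (simp add: algebra_simps)
    then show ?thesis
      by (simp add: uea_gen_def scaleR_uea.abs_eq plus_uea.abs_eq abs_uea_eq_iff)
  qed
  show "uea_gen (x + y) = uea_gen x + uea_gen y" for x y :: 'a using gen[of 1 x 1 y] by simp
  show "uea_gen (c *\<^sub>R x) = c *\<^sub>R uea_gen x" for c and x :: 'a using gen[of c x 0 x] by simp
qed

lemma uea_gen_commutator:
  "uea_gen x * uea_gen y - uea_gen y * uea_gen x = uea_gen (lie_bracket x y)"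
  using uea_ideal.commutator[of x y]
  by (simp add: uea_gen_def times_uea.abs_eq minus_uea.abs_eq abs_uea_eq_iff)

lemma word_uea_simps [simp]: "word_uea [] = 1" "word_uea (x # w) = uea_gen x * word_uea w"
  "word_uea (v @ w) = word_uea v * word_uea w"
  by (simp_all add: word_uea_def)

lemma word_uea_abs: "word_uea w = abs_uea (Poly_Mapping.single (Tword w) 1)"
proof (induction w)
  case Nil
  show ?case by (simp add: one_uea.abs_eq single_one[symmetric] zero_tword_def)
next
  case (Cons x w)
  have "Tword [x] + Tword w = Tword (x # w)" by (simp add: plus_tword_def)
  then show ?case using Cons by (simp add: uea_gen_def free_gen_def times_uea.abs_eq mult_single)
qed

lemma word_uea_in_uea_sub: "w \<in> lists V \<Longrightarrow> word_uea w \<in> uea_sub V"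
  by (induction w) (auto intro: uea_sub.intros)

text \<open>\<open>rep_uea\<close> may involve letters outside \<open>V\<close>. The representative
  obtained here consists of words over \<open>V\<close>, so each derivative it produces is one for
  which the bounds on the multipliers are available.\<close>

lemma uea_sub_rep:
  assumes "u \<in> uea_sub V"
  shows "\<exists>q. u = abs_uea q \<and> letters ` Poly_Mapping.keys q \<subseteq> lists V"
  using assms
proof (induction rule: uea_sub.induct)
  case one
  show ?case by (rule exI[of _ 1]) (auto simp: one_uea.abs_eq)
next
  case (gen x)
  then show ?case by (intro exI[of _ "free_gen x"]) (auto simp: uea_gen_def free_gen_def)
next
  case (add u v)
  then obtain q r where q: "u = abs_uea q" "letters ` Poly_Mapping.keys q \<subseteq> lists V"
    and r: "v = abs_uea r" "letters ` Poly_Mapping.keys r \<subseteq> lists V" by blast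
  show ?case
    by (rule exI[of _ "q + r"]) (use q r Poly_Mapping.keys_add[of q r] in \<open>fastforce simp: plus_uea.abs_eq\<close>)
next
  case (scaleR u c)
  then obtain q where q: "u = abs_uea q" "letters ` Poly_Mapping.keys q \<subseteq> lists V" by blast
  have "Poly_Mapping.keys (free_const c * q) \<subseteq> Poly_Mapping.keys q"
    using Poly_Mapping.keys_mult[of "free_const c" q] unfolding free_const_def
    by (auto split: if_splits)
  then show ?case by (intro exI[of _ "free_const c * q"]) (use q in \<open>auto simp: scaleR_uea.abs_eq\<close>)
next
  case (mult u v)
  then obtain q r where q: "u = abs_uea q" "letters ` Poly_Mapping.keys q \<subseteq> lists V"
    and r: "v = abs_uea r" "letters ` Poly_Mapping.keys r \<subseteq> lists V" by blast
  have "letters ` Poly_Mapping.keys (q * r) \<subseteq> lists V"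
  proof
    fix w assume "w \<in> letters ` Poly_Mapping.keys (q * r)"
    then obtain a b where "w = letters a @ letters b" "a \<in> Poly_Mapping.keys q" "b \<in> Poly_Mapping.keys r"
      using Poly_Mapping.keys_mult[of q r] by fastforce
    then show "w \<in> lists V" using q r by auto
  qed
  then show ?case by (intro exI[of _ "q * r"]) (use q r in \<open>auto simp: times_uea.abs_eq\<close>)
qed

section \<open>Independence of the representative\<close>

context lie_group
begin

context
  fixes p :: "nat \<Rightarrow> 'e::{real_vector,t2_space} \<Rightarrow> real"
  assumes p: "seminorm_space p"
begin

lemma smooth_fun_lders: "smooth_fun G (f :: 'g \<Rightarrow> 'e) \<Longrightarrow> smooth_fun G (lders G w f)"
  by (induction w) (auto intro: smooth_fun_lder[OF p])

lemma lders_add: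
  fixes f h :: "'g \<Rightarrow> 'e"
  assumes "smooth_fun G f" "smooth_fun G h"
  shows "lders G w (\<lambda>x. f x + h x) = (\<lambda>x. lders G w f x + lders G w h x)"
  by (induction w) (use assms lder_add[OF p] smooth_fun_lders in auto)

lemma lders_scaleR:
  fixes f :: "'g \<Rightarrow> 'e"
  assumes "smooth_fun G f"
  shows "lders G w (\<lambda>x. c *\<^sub>R f x) = (\<lambda>x. c *\<^sub>R lders G w f x)"
  by (induction w) (use assms smooth_fun_scaleR[OF p] smooth_fun_lders in auto)

lemma lders_zero: "lders G w (\<lambda>_. 0) = (\<lambda>_. 0 :: 'e)"
  by (induction w) (auto simp: lder_const)

lemma smooth_fun_free_act:
  assumes "smooth_fun G (f :: 'g \<Rightarrow> 'e)"
  shows "smooth_fun G (free_act G q f)"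
proof (induction q rule: tword_alg_induct)
  case (single k v)
  have "free_act G (Poly_Mapping.single k v) f = (\<lambda>g. v *\<^sub>R lders G (letters k) f g)" by auto
  then show ?case using smooth_fun_scaleR(1)[OF p smooth_fun_lders[OF assms]] by simp
next
  case (sum q r)
  have "free_act G (q + r) f = (\<lambda>g. free_act G q f g + free_act G r f g)" by auto
  then show ?case using smooth_fun_add[OF p sum] by simp
qed

lemma free_act_single_mult:
  assumes "smooth_fun G (f :: 'g \<Rightarrow> 'e)"
  shows "free_act G (Poly_Mapping.single k v * q) f g = v *\<^sub>R lders G (letters k) (free_act G q f) g"
proof (induction q arbitrary: g rule: tword_alg_induct)
  case (single l w)
  have "free_act G (Poly_Mapping.single l w) f = (\<lambda>g. w *\<^sub>R lders G (letters l) f g)" by auto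
  then show ?case by (simp add: mult_single lders_scaleR smooth_fun_lders assms)
next
  case (sum q r)
  have "free_act G (q + r) f = (\<lambda>g. free_act G q f g + free_act G r f g)" by auto
  then show ?case
    by (simp add: distrib_left lders_add smooth_fun_free_act assms sum scaleR_add_right)
qed

lemma free_act_mult:
  assumes "smooth_fun G (f :: 'g \<Rightarrow> 'e)"
  shows "free_act G (q * r) f g = free_act G q (free_act G r f) g"
proof (induction q rule: tword_alg_induct)
  case (single k v)
  then show ?case by (simp add: free_act_single_mult assms)
next
  case (sum q s)
  then show ?case by (simp add: distrib_right)
qed

lemma free_act_zero: "free_act G q (\<lambda>_. 0) g = (0 :: 'e)"
  by (simp add: free_act_def lders_zero)

lemma free_act_gen: "free_act G (free_gen x) f g = lder G x f g"
  by (simp add: free_gen_def)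

lemma free_act_const: "free_act G (free_const c) f g = c *\<^sub>R f g"
  by (simp add: free_const_def)

text \<open>Linearity in \<open>X\<close> kills the first kind of relation, the bracket identity the
  second. In a product \<open>r * q * s\<close> the middle factor acts on
  \<open>free_act G s f\<close>, which is again smooth; hence the induction over all smooth
  \<open>f\<close>.\<close>

lemma free_act_ideal:
  "q \<in> uea_ideal \<Longrightarrow> smooth_fun G (f :: 'g \<Rightarrow> 'e) \<Longrightarrow> free_act G q f g = 0"
proof (induction arbitrary: f g rule: uea_ideal.induct)
  case (linear a x b y)
  have gen: "free_act G (free_gen x) f = lder G x f" for x by (auto simp: free_act_gen)
  show ?case
    using linear_add[OF linear_lder[OF p linear, of g], of "a *\<^sub>R x" "b *\<^sub>R y"]
      linear_scale[OF linear_lder[OF p linear, of g]]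
    by (simp add: free_act_mult[OF linear] gen free_act_const)
next
  case (commutator x y)
  have gen: "free_act G (free_gen x) f = lder G x f" for x and f :: "'g \<Rightarrow> 'e" by (auto simp: free_act_gen)
  show ?case
    by (simp add: free_act_mult[OF commutator] gen lder_bracket[OF p commutator])
next
  case (add q r)
  then show ?case by simp
next
  case (mult q r s)
  have s: "smooth_fun G (free_act G s f)" by (rule smooth_fun_free_act[OF mult.prems])
  have "free_act G (q * s) f = (\<lambda>_. 0)"
    using mult.IH[OF s] by (intro ext) (simp add: free_act_mult[OF mult.prems])
  then show ?case by (simp add: mult.assoc free_act_mult[OF mult.prems] free_act_zero)
qed

lemma lop_abs_uea:
  assumes "smooth_fun G (f :: 'g \<Rightarrow> 'e)"
  shows "lop G (abs_uea q) f = free_act G q f"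
proof
  fix g
  have "lop G (abs_uea q) f g = free_act G (rep_uea (abs_uea q)) f g"
    by (simp add: lop_def uea_op_def free_act_def lders_def)
  also have "\<dots> = free_act G q f g"
    using free_act_ideal[OF rep_abs_uea assms, of q g] by simp
  finally show "lop G (abs_uea q) f g = free_act G q f g" .
qed

lemma lop_word:
  assumes "smooth_fun G (f :: 'g \<Rightarrow> 'e)"
  shows "lop G (word_uea w) f = lders G w f"
  by (rule ext) (simp add: word_uea_abs lop_abs_uea[OF assms])

lemma smooth_fun_lop:
  assumes "smooth_fun G (f :: 'g \<Rightarrow> 'e)"
  shows "smooth_fun G (lop G u f)"
  by (rule abs_uea_cases[of u]) (simp add: lop_abs_uea smooth_fun_free_act assms)

lemma lop_zero:
  assumes "smooth_fun G (f :: 'g \<Rightarrow> 'e)"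
  shows "lop G 0 f g = 0"
  by (simp add: zero_uea.abs_eq lop_abs_uea[OF assms] free_act_def)

end

end

section \<open>Spanning by Poincare--Birkhoff--Witt monomials\<close>

lemma span_mult:
  fixes A B :: "'b::real_algebra set"
  assumes "a \<in> span A" "b \<in> span B"
  shows "a * b \<in> span {x * y | x y. x \<in> A \<and> y \<in> B}"
proof -
  let ?C = "span {x * y | x y. x \<in> A \<and> y \<in> B}"
  have 1: "x * b \<in> ?C" if x: "x \<in> A" for x
  proof (rule span_induct[OF assms(2)])
    show "subspace {b. x * b \<in> ?C}"
      by (auto simp: subspace_def span_zero span_add span_scale distrib_left)
    show "x * y \<in> ?C" if "y \<in> B" for y by (rule span_base) (use x that in auto)
  qed
  show ?thesis
  proof (rule span_induct[OF assms(1)])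
    show "subspace {a. a * b \<in> ?C}"
      by (auto simp: subspace_def span_zero span_add span_scale distrib_right)
  qed (rule 1)
qed

lemma count_list_concat_replicate:
  "count_list (concat (map (\<lambda>i. replicate (c i) i) [0..<m])) a = (if a < m then c a else 0)"
proof (induction m)
  case (Suc m)
  have "count_list (replicate n x) y = (if x = y then n else 0)" for n and x y :: nat
    by (induction n) auto
  then show ?case using Suc by (simp add: less_Suc_eq)
qed simp

lemma sorted_concat_replicate:
  "sorted (concat (map (\<lambda>i. replicate (c i) i) [0..<m])) \<and>
   set (concat (map (\<lambda>i. replicate (c i) i) [0..<m])) \<subseteq> {..<m}" for m :: nat
  by (induction m) (auto simp: sorted_append sorted_replicate)

lemma sort_eq_concat_replicate:
  fixes ns :: "nat list"
  assumes "set ns \<subseteq> {..<m}"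
  shows "sort ns = concat (map (\<lambda>i. replicate (count_list ns i) i) [0..<m])"
proof (rule properties_for_sort)
  show "mset (concat (map (\<lambda>i. replicate (count_list ns i) i) [0..<m])) = mset ns"
  proof (rule multiset_eqI)
    fix a
    have "count_list ns a = (if a < m then count_list ns a else 0)"
      using assms by (auto simp: count_list_0_iff)
    then show "count (mset (concat (map (\<lambda>i. replicate (count_list ns i) i) [0..<m]))) a = count (mset ns) a"
      unfolding count_mset count_list_concat_replicate by simp
  qed
  show "sorted (concat (map (\<lambda>i. replicate (count_list ns i) i) [0..<m]))"
    using sorted_concat_replicate by blast
qed

lemma uea_filt_mono: "k \<le> l \<Longrightarrow> uea_filt bs k \<subseteq> uea_filt bs l"
  unfolding uea_filt_def by (intro span_mono image_mono) (auto simp: pbw_idx_def)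

text \<open>Insertion sort modulo shorter words: exchanging neighbours costs a commutator, which is
  a word with one letter less, and the sorted word is a monomial.\<close>

lemma word_uea_indices_filt:
  fixes bs :: "'a::lie_algebra list"
  assumes lower: "\<And>w :: 'a list. length w < n \<Longrightarrow> word_uea w \<in> uea_filt bs (n - 1)"
    and ns: "set ns \<subseteq> {..<length bs}" "length ns = n"
  shows "word_uea (map ((!) bs) ns) \<in> uea_filt bs n"
proof -
  define W where "W = (\<lambda>ns. word_uea (map ((!) bs) ns))"
  define F0 where "F0 = uea_filt bs (n - 1)"
  have F: "0 \<in> F0" "\<And>x y. x \<in> F0 \<Longrightarrow> y \<in> F0 \<Longrightarrow> x + y \<in> F0"
    by (auto simp: F0_def uea_filt_def span_zero span_add)
  have F3: "x - z \<in> F0" if "x - y \<in> F0" "y - z \<in> F0" for x y z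
    using F(2)[OF that] by simp
  \<comment> \<open>The bracket of two basis vectors is a single letter but in general no basis
    vector; for this reason \<open>lower\<close> concerns words in arbitrary letters.\<close>
  have swap: "W (u @ i # j # s) - W (u @ j # i # s) \<in> F0" if "length (u @ i # j # s) = n" for u i j s
  proof -
    have "W (u @ i # j # s) - W (u @ j # i # s)
        = W u * (uea_gen (bs ! i) * uea_gen (bs ! j) - uea_gen (bs ! j) * uea_gen (bs ! i)) * W s"
      by (simp add: W_def algebra_simps)
    also have "\<dots> = word_uea (map ((!) bs) u @ lie_bracket (bs ! i) (bs ! j) # map ((!) bs) s)"
      by (simp add: uea_gen_commutator W_def mult.assoc)
    finally have eq: "W (u @ i # j # s) - W (u @ j # i # s)
        = word_uea (map ((!) bs) u @ lie_bracket (bs ! i) (bs ! j) # map ((!) bs) s)" .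
    show ?thesis unfolding eq F0_def by (rule lower) (use that in simp)
  qed
  have ins: "W (u @ i # s) - W (u @ insort i s) \<in> F0" if "length (u @ i # s) = n" for u i s
    using that
  proof (induction s arbitrary: u)
    case (Cons j s)
    show ?case
    proof (cases "i \<le> j")
      case False
      have "W ((u @ [j]) @ i # s) - W ((u @ [j]) @ insort i s) \<in> F0"
        using Cons.IH[of "u @ [j]"] Cons.prems by simp
      then show ?thesis using F3[OF swap[OF Cons.prems]] False by simp
    qed (simp add: F)
  qed (simp add: F)
  have srt: "W (u @ s) - W (u @ sort s) \<in> F0" if "length (u @ s) = n" for u s
    using that
  proof (induction s arbitrary: u)
    case (Cons i s)
    have "W ((u @ [i]) @ s) - W ((u @ [i]) @ sort s) \<in> F0"
      using Cons.IH[of "u @ [i]"] Cons.prems by simp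
    moreover have "W (u @ i # sort s) - W (u @ insort i (sort s)) \<in> F0" using Cons.prems by (intro ins) simp
    ultimately show ?case using F3 by simp
  qed (simp add: F)
  \<comment> \<open>The multiplicities of the indices. A sorted word is a concatenation of constant
    blocks, which is the order of factors in \<open>pbw_monomial\<close>.\<close>
  define \<beta> where "\<beta> = map (count_list ns) [0..<length bs]"
  have sort: "sort ns = concat (map (\<lambda>i. replicate (count_list ns i) i) [0..<length bs])"
    by (rule sort_eq_concat_replicate[OF ns(1)])
  have "W (concat (map (\<lambda>i. replicate (c i) i) xs)) = prod_list (map (\<lambda>i. uea_gen (bs ! i) ^ c i) xs)" for c xs
  proof (induction xs)
    case (Cons x xs)
    have "W (replicate k x) = uea_gen (bs ! x) ^ k" for k by (induction k) (auto simp: W_def)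
    moreover have "W (u @ v) = W u * W v" for u v by (simp add: W_def)
    ultimately show ?case using Cons by simp
  qed (simp add: W_def)
  then have "W (sort ns) = prod_list (map (\<lambda>i. uea_gen (bs ! i) ^ count_list ns i) [0..<length bs])"
    unfolding sort by blast
  also have "\<dots> = pbw_monomial bs \<beta>"
  proof -
    have "map2 (\<lambda>x i. uea_gen x ^ i) bs \<beta>
        = map2 (\<lambda>x i. uea_gen x ^ i) (map ((!) bs) [0..<length bs]) (map (count_list ns) [0..<length bs])"
      by (simp add: \<beta>_def map_nth)
    then show ?thesis by (simp add: pbw_monomial_def map2_map_map)
  qed
  finally have "W (sort ns) = pbw_monomial bs \<beta>" .
  moreover have "\<beta> \<in> pbw_idx bs n"
  proof -
    have "n = length (sort ns)" using ns by simp
    also have "\<dots> = sum_list \<beta>" unfolding sort by (simp add: length_concat \<beta>_def o_def)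
    finally show ?thesis by (simp add: pbw_idx_def \<beta>_def)
  qed
  ultimately have 1: "W (sort ns) \<in> uea_filt bs n"
    unfolding uea_filt_def by (simp add: span_base)
  have "W ns - W (sort ns) \<in> uea_filt bs n"
    using srt[of "[]" ns] ns uea_filt_mono[of "n - 1" n bs] by (auto simp: F0_def)
  then have "W ns - W (sort ns) + W (sort ns) \<in> uea_filt bs n"
    using 1 unfolding uea_filt_def by (rule span_add)
  then show ?thesis by (simp add: W_def)
qed

text \<open>Expanding each letter in the basis preserves the length of a word, so it suffices to
  sort words in basis vectors, modulo shorter words covered by the induction. This places a
  derivative of order at most \<open>k\<close> under the seminorm of order \<open>k\<close>.\<close>

theorem word_uea_in_filt:
  fixes bs :: "'a::lie_algebra list"
  assumes bs: "basis_of bs UNIV"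
  shows "word_uea w \<in> uea_filt bs (length w)"
proof (induction "length w" arbitrary: w rule: less_induct)
  case less
  have lower: "word_uea v \<in> uea_filt bs (length w - 1)" if "length v < length w" for v :: "'a list"
  proof -
    have le: "length v \<le> length w - 1" using that by linarith
    show ?thesis by (rule subsetD[OF uea_filt_mono[OF le] less[OF that]])
  qed
  have basis: "word_uea v \<in> uea_filt bs (length w)" if v: "v \<in> lists (set bs)" "length v = length w" for v
  proof -
    have "\<exists>ns. set ns \<subseteq> {..<length bs} \<and> v = map ((!) bs) ns" using v(1)
    proof (induction v)
      case (Cons x v)
      then obtain ns where "set ns \<subseteq> {..<length bs}" "v = map ((!) bs) ns" by auto
      moreover obtain i where "i < length bs" "x = bs ! i" using Cons by (auto simp: in_set_conv_nth)
      ultimately show ?case by (intro exI[of _ "i # ns"]) auto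
    qed simp
    then obtain ns where ns: "set ns \<subseteq> {..<length bs}" "v = map ((!) bs) ns" by blast
    show ?thesis using word_uea_indices_filt[OF lower ns(1)] ns(2) v(2) by simp
  qed
  have "word_uea v \<in> span (word_uea ` {b \<in> lists (set bs). length b = length v})" for v :: "'a list"
  proof (induction v)
    case Nil
    then show ?case by (intro span_base) auto
  next
    case (Cons x v)
    have "uea_gen x \<in> span (uea_gen ` set bs)"
      using bs linear_span_image[OF linear_uea_gen, of "set bs"] by (auto simp: basis_of_def)
    from span_mult[OF this Cons]
    have "word_uea (x # v) \<in> span {y * z | y z. y \<in> uea_gen ` set bs
        \<and> z \<in> word_uea ` {b \<in> lists (set bs). length b = length v}}" by simp
    also have "\<dots> \<subseteq> span (word_uea ` {b \<in> lists (set bs). length b = length (x # v)})"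
    proof (rule span_mono, rule subsetI)
      fix u assume "u \<in> {y * z | y z. y \<in> uea_gen ` set bs \<and> z \<in> word_uea ` {b \<in> lists (set bs). length b = length v}}"
      then obtain y b where "u = uea_gen y * word_uea b" "y \<in> set bs" "b \<in> lists (set bs)" "length b = length v"
        by auto
      then show "u \<in> word_uea ` {b \<in> lists (set bs). length b = length (x # v)}"
        by (intro image_eqI[of _ _ "y # b"]) auto
    qed
    finally show ?case .
  qed
  moreover have "span (word_uea ` {b \<in> lists (set bs). length b = length w}) \<subseteq> uea_filt bs (length w)"
    by (rule span_minimal) (use basis in \<open>auto simp: uea_filt_def\<close>)
  ultimately show ?case by blast
qed

section \<open>Leibniz rule and the estimate for the operators\<close>

lemma frechet_seminorm_space: "frechet_space sc p \<Longrightarrow> seminorm_space p"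
proof
  assume fr: "frechet_space sc p"
  show "p j (x + y) \<le> p j x + p j y" for j x y using fr by (simp add: frechet_space_def)
  show "p j (c *\<^sub>R x) = \<bar>c\<bar> * p j x" for j c x
  proof -
    have r: "\<forall>r x. sc (complex_of_real r) x = r *\<^sub>R x"
      using fr unfolding frechet_space_def by (elim conjE)
    have "\<forall>j c x. p j (sc c x) = cmod c * p j x"
      using fr unfolding frechet_space_def by (elim conjE)
    then have "p j (sc (complex_of_real c) x) = cmod (complex_of_real c) * p j x" by blast
    then show ?thesis using r by simp
  qed
  show "open U \<longleftrightarrow> (\<forall>x\<in>U. \<exists>J \<epsilon>. finite J \<and> 0 < \<epsilon> \<and> {y. \<forall>j\<in>J. p j (y - x) < \<epsilon>} \<subseteq> U)" for U
    using fr by (simp add: frechet_space_def)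
qed

lemma frechet_cont_bilinear:
  assumes fr: "frechet_space sc p"
  shows "cont_bilinear sc"
proof -
  interpret seminorm_space p by (rule frechet_seminorm_space[OF fr])
  have vs: "vector_space sc" and r: "\<And>c x. sc (complex_of_real c) x = c *\<^sub>R x"
    and ps: "\<And>j c x. p j (sc c x) = cmod c * p j x" using fr by (auto simp: frechet_space_def)
  interpret vector_space sc by (rule vs)
  have "continuous_on UNIV (\<lambda>z. sc (fst z) (snd z))"
    unfolding continuous_on_def tendsto_p_iff
  proof (intro ballI allI)
    fix z0 :: "complex \<times> 'a" and j
    have f: "(fst \<longlongrightarrow> fst z0) (at z0)" and s: "(snd \<longlongrightarrow> snd z0) (at z0)"
      by (intro tendsto_fst tendsto_snd tendsto_ident_at)+
    have "((\<lambda>z. cmod (fst z) * p j (snd z - snd z0) + cmod (fst z - fst z0) * p j (snd z0)) \<longlongrightarrow>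
        cmod (fst z0) * 0 + cmod (fst z0 - fst z0) * p j (snd z0)) (at z0)"
      using f s unfolding tendsto_p_iff by (intro tendsto_intros) auto
    then have t: "((\<lambda>z. cmod (fst z) * p j (snd z - snd z0) + cmod (fst z - fst z0) * p j (snd z0)) \<longlongrightarrow> 0) (at z0)"
      by simp
    have "p j (sc (fst z) (snd z) - sc (fst z0) (snd z0))
        \<le> cmod (fst z) * p j (snd z - snd z0) + cmod (fst z - fst z0) * p j (snd z0)" for z
    proof -
      have eq: "sc (fst z) (snd z) - sc (fst z0) (snd z0) = sc (fst z) (snd z - snd z0) + sc (fst z - fst z0) (snd z0)"
        by (simp add: scale_right_diff_distrib scale_left_diff_distrib)
      show ?thesis unfolding eq ps[symmetric] by (rule p_add)
    qed
    then show "((\<lambda>z. p j (sc (fst z) (snd z) - sc (fst z0) (snd z0))) \<longlongrightarrow> 0) (at z0 within UNIV)"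
      by (intro tendsto_sandwich[OF _ _ tendsto_const t]) (auto intro!: always_eventually)
  qed
  moreover have "sc (c *\<^sub>R x) y = c *\<^sub>R sc x y" "sc x (c *\<^sub>R y) = c *\<^sub>R sc x y" for c x y
    by (simp_all add: scaleR_conv_of_real r[symmetric] mult.commute)
  ultimately show ?thesis
    unfolding cont_bilinear_def case_prod_beta by (simp add: scale_left_distrib scale_right_distrib)
qed

text \<open>The terms of the Leibniz rule in which at least one letter acts on the first factor.\<close>

primrec splits :: "'a list \<Rightarrow> ('a list \<times> 'a list) list" where
  "splits [] = []"
| "splits (x # w) = ([x], w) # concat (map (\<lambda>(u, v). [(x # u, v), (u, x # v)]) (splits w))"

lemma splits_length:
  "(u, v) \<in> set (splits w) \<Longrightarrow> length u + length v = length w \<and> 0 < length u"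
  by (induction w arbitrary: u v) fastforce+

lemma splits_lists:
  "w \<in> lists A \<Longrightarrow> (u, v) \<in> set (splits w) \<Longrightarrow> u \<in> lists A \<and> v \<in> lists A"
proof (induction w arbitrary: u v)
  case (Cons x w)
  from Cons.prems(2) consider "u = [x]" "v = w"
    | u' where "u = x # u'" "(u', v) \<in> set (splits w)" | v' where "v = x # v'" "(u, v') \<in> set (splits w)"
    by auto
  then show ?case
  proof cases
    case 1
    then show ?thesis using Cons.prems(1) by simp
  next
    case 2
    then show ?thesis using Cons.prems(1) Cons.IH[OF _ 2(2)] by simp
  next
    case 3
    then show ?thesis using Cons.prems(1) Cons.IH[OF _ 3(2)] by simp
  qed
qed simp

context lie_group
begin

lemma lder_sum_list:
  fixes f :: "'i \<Rightarrow> 'g \<Rightarrow> 'e::{real_vector,t2_space}"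
  assumes p: "seminorm_space (p :: nat \<Rightarrow> 'e \<Rightarrow> real)" and "\<And>i. i \<in> set is \<Longrightarrow> smooth_fun G (f i)"
  shows "smooth_fun G (\<lambda>g. \<Sum>i\<leftarrow>is. f i g) \<and>
    (\<forall>g. lder G X (\<lambda>g. \<Sum>i\<leftarrow>is. f i g) g = (\<Sum>i\<leftarrow>is. lder G X (f i) g))"
  using assms(2)
proof (induction "is")
  case Nil
  then show ?case by (simp add: smooth_fun_const lder_const)
next
  case (Cons i "is")
  have 1: "smooth_fun G (f i)" and 2: "smooth_fun G (\<lambda>g. \<Sum>i\<leftarrow>is. f i g)" using Cons by simp_all
  show ?case using smooth_fun_add[OF p 1 2] lder_add[OF p 1 2] Cons by simp
qed

text \<open>The summand in which every letter acts on the second factor is kept apart: in the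
  estimate of an inverse it is the one solved for.\<close>

lemma Leibniz:
  fixes a :: "'g \<Rightarrow> complex" and \<Phi> :: "'g \<Rightarrow> 'e::{real_vector,t2_space}"
    and B :: "complex \<Rightarrow> 'e \<Rightarrow> 'e"
  assumes B: "cont_bilinear B" and p: "seminorm_space (p :: nat \<Rightarrow> 'e \<Rightarrow> real)"
    and a: "smooth_fun G a" and \<Phi>: "smooth_fun G \<Phi>"
  shows "lders G w (\<lambda>g. B (a g) (\<Phi> g)) = (\<lambda>g. B (a g) (lders G w \<Phi> g) +
    (\<Sum>uv\<leftarrow>splits w. B (lders G (fst uv) a g) (lders G (snd uv) \<Phi> g)))"
proof (induction w)
  case (Cons x w)
  let ?t = "\<lambda>uv g. B (lders G (fst uv) a g) (lders G (snd uv) \<Phi> g)"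
  have sa: "smooth_fun G (lders G u a)" for u by (rule smooth_fun_lders[OF seminorm_space_normed a])
  have s\<Phi>: "smooth_fun G (lders G u \<Phi>)" for u by (rule smooth_fun_lders[OF p \<Phi>])
  have st: "smooth_fun G (?t uv)" for uv by (rule smooth_fun_bilinear[OF B p p sa s\<Phi>])
  have dt: "lder G x (\<lambda>g. B (h g) (k g)) g = B (lder G x h g) (k g) + B (h g) (lder G x k g)"
    if "smooth_fun G h" "smooth_fun G k" for h k g
    by (rule lder_bilinear[OF B seminorm_space_normed p p that])
  have s1: "smooth_fun G (\<lambda>g. B (a g) (lders G w \<Phi> g))" by (rule smooth_fun_bilinear[OF B p p a s\<Phi>])
  note sl = lder_sum_list[OF p, of "splits w" ?t x, OF st]
  show ?case
  proof
    fix g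
    have "lders G (x # w) (\<lambda>g. B (a g) (\<Phi> g)) g
        = lder G x (\<lambda>g. B (a g) (lders G w \<Phi> g)) g + (\<Sum>uv\<leftarrow>splits w. lder G x (?t uv) g)"
      using lder_add[OF p s1 conjunct1[OF sl]] sl by (simp add: Cons)
    also have "(\<Sum>uv\<leftarrow>splits w. lder G x (?t uv) g)
        = (\<Sum>uv\<leftarrow>concat (map (\<lambda>(u, v). [(x # u, v), (u, x # v)]) (splits w)). ?t uv g)"
    proof -
      have "(\<Sum>uv\<leftarrow>xs. lder G x (?t uv) g)
        = (\<Sum>uv\<leftarrow>concat (map (\<lambda>(u, v). [(x # u, v), (u, x # v)]) xs). ?t uv g)" for xs
        by (induction xs) (auto simp: dt[OF sa s\<Phi>] split_beta)
      then show ?thesis .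
    qed
    finally show "lders G (x # w) (\<lambda>g. B (a g) (\<Phi> g)) g = B (a g) (lders G (x # w) \<Phi> g) +
        (\<Sum>uv\<leftarrow>splits (x # w). ?t uv g)"
      by (simp add: dt[OF a s\<Phi>] algebra_simps)
  qed
qed simp

text \<open>The Leibniz rule for \<open>\<alpha> * inverse \<alpha> = 1\<close> expresses the
  derivative of the inverse along \<open>w\<close> by its derivatives along shorter words
  \<open>v\<close>. The letters on \<open>\<alpha>\<close> cost one factor \<open>\<nu>\<close>,
  those in \<open>v\<close> cost \<open>\<nu> ^ length v\<close>, and since
  \<open>\<nu> \<ge> 1\<close> the total is at most \<open>\<nu> ^ length w\<close>.\<close>

lemma lders_inverse_bound:
  fixes \<alpha> :: "'g \<Rightarrow> complex" and \<nu> :: "'g \<Rightarrow> real"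
  assumes \<alpha>: "smooth_fun G \<alpha>" "\<And>g. \<alpha> g \<noteq> 0" and \<nu>: "\<And>g. 1 \<le> \<nu> g"
    and bound: "\<And>u. u \<in> lists A \<Longrightarrow> \<exists>C. \<forall>g. cmod (lders G u \<alpha> g) \<le> C * cmod (\<alpha> g) * \<nu> g"
    and w: "w \<in> lists A"
  shows "\<exists>C\<ge>0. \<forall>g. cmod (lders G w (\<lambda>g. inverse (\<alpha> g)) g) \<le> C * (inverse (cmod (\<alpha> g)) * \<nu> g ^ length w)"
  using w
proof (induction "length w" arbitrary: w rule: less_induct)
  case less
  define \<beta> where "\<beta> = (\<lambda>g. inverse (\<alpha> g))"
  have \<beta>: "smooth_fun G \<beta>" unfolding \<beta>_def by (rule smooth_fun_inverse[OF \<alpha>])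
  show ?case
  proof (cases "w = []")
    case True
    then show ?thesis by (intro exI[of _ 1]) (simp add: norm_inverse)
  next
    case False
    have z: "lders G w (\<lambda>_. 1 :: complex) g = 0" for g
    proof -
      obtain v x where w: "w = v @ [x]" using False by (metis rev_exhaust)
      have c: "lder G x (\<lambda>_. 1 :: complex) = (\<lambda>_. 0)" by (rule ext) (rule lder_const)
      show ?thesis by (simp add: w c lders_zero[OF seminorm_space_normed])
    qed
    \<comment> \<open>The word is nonempty, so the derivative of the constant \<open>1\<close>
      vanishes, and the first summand carries the derivative to be estimated.\<close>
    have leib: "\<alpha> g * lders G w \<beta> g + (\<Sum>uv\<leftarrow>splits w. lders G (fst uv) \<alpha> g * lders G (snd uv) \<beta> g) = 0" for g
    proof -
      have "lders G w (\<lambda>g. \<alpha> g * \<beta> g) g = 0" using z \<alpha>(2) by (simp add: \<beta>_def)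
      then show ?thesis
        using Leibniz[OF cont_bilinear_bounded[OF bounded_bilinear_mult] seminorm_space_normed \<alpha>(1) \<beta>, of w] by simp
    qed
    have "\<forall>uv\<in>set (splits w). \<exists>C\<ge>0. \<forall>g. cmod (lders G (fst uv) \<alpha> g * lders G (snd uv) \<beta> g) \<le> C * \<nu> g ^ length w"
    proof
      fix uv assume uv: "uv \<in> set (splits w)"
      obtain u v where [simp]: "uv = (u, v)" by (cases uv)
      have l: "length u + length v = length w" "0 < length u" using splits_length[of u v w] uv by auto
      have A: "u \<in> lists A" "v \<in> lists A" using splits_lists[OF less.prems, of u v] uv by auto
      obtain C1 where C1: "\<And>g. cmod (lders G u \<alpha> g) \<le> C1 * cmod (\<alpha> g) * \<nu> g" using bound[OF A(1)] by auto
      have lv: "length v < length w" using l by linarith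
      from less.hyps[OF lv A(2)] obtain C2 where C2: "0 \<le> C2"
        "\<And>g. cmod (lders G v \<beta> g) \<le> C2 * (inverse (cmod (\<alpha> g)) * \<nu> g ^ length v)"
        unfolding \<beta>_def by auto
      have "cmod (lders G u \<alpha> g * lders G v \<beta> g) \<le> (\<bar>C1\<bar> * C2) * \<nu> g ^ length w" for g
      proof -
        have \<nu>0: "0 \<le> \<nu> g" using \<nu>[of g] by simp
        have "cmod (lders G u \<alpha> g) \<le> \<bar>C1\<bar> * cmod (\<alpha> g) * \<nu> g"
          by (rule order_trans[OF C1]) (intro mult_right_mono abs_ge_self norm_ge_zero \<nu>0)
        then have "cmod (lders G u \<alpha> g * lders G v \<beta> g)
            \<le> (\<bar>C1\<bar> * cmod (\<alpha> g) * \<nu> g) * (C2 * (inverse (cmod (\<alpha> g)) * \<nu> g ^ length v))"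
          unfolding norm_mult using C2 \<nu>0 by (intro mult_mono) auto
        also have "\<dots> = (\<bar>C1\<bar> * C2) * \<nu> g ^ Suc (length v)" using \<alpha>(2)[of g] by (simp add: field_simps)
        also have "\<dots> \<le> (\<bar>C1\<bar> * C2) * \<nu> g ^ length w"
          using C2(1) \<nu>[of g] lv by (intro mult_left_mono power_increasing) auto
        finally show ?thesis .
      qed
      then show "\<exists>C\<ge>0. \<forall>g. cmod (lders G (fst uv) \<alpha> g * lders G (snd uv) \<beta> g) \<le> C * \<nu> g ^ length w"
        using C2(1) by (intro exI[of _ "\<bar>C1\<bar> * C2"]) simp
    qed
    from bchoice[OF this] obtain K where K: "\<forall>uv\<in>set (splits w). 0 \<le> K uv \<and>
        (\<forall>g. cmod (lders G (fst uv) \<alpha> g * lders G (snd uv) \<beta> g) \<le> K uv * \<nu> g ^ length w)" by (elim exE)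
    have "cmod (lders G w \<beta> g) \<le> (\<Sum>uv\<leftarrow>splits w. K uv) * (inverse (cmod (\<alpha> g)) * \<nu> g ^ length w)" for g
    proof -
      have "cmod (\<alpha> g) * cmod (lders G w \<beta> g)
          = cmod (\<Sum>uv\<leftarrow>splits w. lders G (fst uv) \<alpha> g * lders G (snd uv) \<beta> g)"
        using leib[of g] by (simp add: norm_mult[symmetric] eq_neg_iff_add_eq_0[symmetric])
      also have "\<dots> \<le> (\<Sum>uv\<leftarrow>splits w. cmod (lders G (fst uv) \<alpha> g * lders G (snd uv) \<beta> g))"
        by (rule seminorm_space.p_sum_list[OF seminorm_space_normed])
      also have "\<dots> \<le> (\<Sum>uv\<leftarrow>splits w. K uv * \<nu> g ^ length w)"
        by (rule sum_list_mono) (use K in auto)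
      finally have "cmod (\<alpha> g) * cmod (lders G w \<beta> g) \<le> (\<Sum>uv\<leftarrow>splits w. K uv) * \<nu> g ^ length w"
        by (simp add: sum_list_mult_const)
      then show ?thesis using \<alpha>(2)[of g] by (simp add: field_simps)
    qed
    moreover have "0 \<le> (\<Sum>uv\<leftarrow>splits w. K uv)" by (rule sum_list_nonneg) (use K in auto)
    ultimately show ?thesis unfolding \<beta>_def by (intro exI[of _ "\<Sum>uv\<leftarrow>splits w. K uv"]) simp
  qed
qed

text \<open>The constant and the finite set of words are uniform in \<open>F\<close> and
  \<open>g\<close>; they give rise to the constant and the order of the seminorm in the final
  estimate. \<open>X\<close> is a real expression in \<open>F\<close> and \<open>g\<close>, so that
  bounds can be added and multiplied.\<close>

definition dominated :: "('e::{real_vector,t2_space} \<Rightarrow> real) \<Rightarrow> (('g \<Rightarrow> 'e) \<Rightarrow> 'g \<Rightarrow> real) \<Rightarrow> ('g \<Rightarrow> real) \<Rightarrow> bool" where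
  "dominated \<pi> X H \<longleftrightarrow> (\<exists>C\<ge>0. \<exists>W. finite W \<and>
     (\<forall>F g. smooth_fun G F \<longrightarrow> X F g \<le> C * H g * (\<Sum>v\<in>W. \<pi> (lders G v F g))))"

context
  fixes p :: "nat \<Rightarrow> 'e::{real_vector,t2_space} \<Rightarrow> real" and j :: nat
  assumes p: "seminorm_space p"
begin

lemma dominatedI:
  assumes "0 \<le> C" "finite W"
    "\<And>F g. smooth_fun G F \<Longrightarrow> X F g \<le> C * H g * (\<Sum>v\<in>W. p j (lders G v F g))"
  shows "dominated (p j) X H"
  unfolding dominated_def using assms by blast

lemma dominatedE:
  assumes "dominated (p j) X H"
  obtains C W where "0 \<le> C" "finite W"
    "\<forall>F g. smooth_fun G F \<longrightarrow> X F g \<le> C * H g * (\<Sum>v\<in>W. p j (lders G v F g))"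
  using assms unfolding dominated_def by blast

lemma sum_p_nonneg: "0 \<le> (\<Sum>v\<in>W. p j (lders G v F g))"
  by (rule sum_nonneg) (simp add: seminorm_space.p_nonneg[OF p])

lemma dominated_mono:
  assumes "dominated (p j) X H" "\<And>F g. smooth_fun G F \<Longrightarrow> Y F g \<le> X F g" "\<And>g. H g \<le> H' g"
  shows "dominated (p j) Y H'"
proof -
  obtain C W where C: "0 \<le> C" "finite W"
    "\<forall>F g. smooth_fun G F \<longrightarrow> X F g \<le> C * H g * (\<Sum>v\<in>W. p j (lders G v F g))"
    using assms(1) by (rule dominatedE)
  show ?thesis
  proof (rule dominatedI[OF C(1,2)])
    fix F :: "'g \<Rightarrow> 'e" and g assume F: "smooth_fun G F"
    have "Y F g \<le> X F g" by (rule assms(2)[OF F])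
    also have "\<dots> \<le> C * H g * (\<Sum>v\<in>W. p j (lders G v F g))" using C(3) F by simp
    also have "\<dots> \<le> C * H' g * (\<Sum>v\<in>W. p j (lders G v F g))"
      by (intro mult_right_mono mult_left_mono assms(3) C(1) sum_p_nonneg)
    finally show "Y F g \<le> C * H' g * (\<Sum>v\<in>W. p j (lders G v F g))" .
  qed
qed

lemma dominated_add:
  assumes "dominated (p j) X H" "dominated (p j) Y H" "\<And>g. 0 \<le> H g"
  shows "dominated (p j) (\<lambda>F g. X F g + Y F g) H"
proof -
  obtain C W where C: "0 \<le> C" "finite W"
    "\<forall>F g. smooth_fun G F \<longrightarrow> X F g \<le> C * H g * (\<Sum>v\<in>W. p j (lders G v F g))"
    using assms(1) by (rule dominatedE)
  obtain C' W' where C': "0 \<le> C'" "finite W'"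
    "\<forall>F g. smooth_fun G F \<longrightarrow> Y F g \<le> C' * H g * (\<Sum>v\<in>W'. p j (lders G v F g))"
    using assms(2) by (rule dominatedE)
  show ?thesis
  proof (rule dominatedI[of "C + C'" "W \<union> W'"])
    fix F :: "'g \<Rightarrow> 'e" and g assume F: "smooth_fun G F"
    have m: "(\<Sum>v\<in>U. p j (lders G v F g)) \<le> (\<Sum>v\<in>W \<union> W'. p j (lders G v F g))" if "U \<subseteq> W \<union> W'" for U
      by (rule sum_mono2) (use C C' that in \<open>auto simp: seminorm_space.p_nonneg[OF p]\<close>)
    have "X F g \<le> C * H g * (\<Sum>v\<in>W. p j (lders G v F g))" using C(3) F by simp
    also have "\<dots> \<le> C * H g * (\<Sum>v\<in>W \<union> W'. p j (lders G v F g))"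
      by (intro mult_left_mono m mult_nonneg_nonneg C(1) assms(3)) simp
    finally have 1: "X F g \<le> C * H g * (\<Sum>v\<in>W \<union> W'. p j (lders G v F g))" .
    have "Y F g \<le> C' * H g * (\<Sum>v\<in>W'. p j (lders G v F g))" using C'(3) F by simp
    also have "\<dots> \<le> C' * H g * (\<Sum>v\<in>W \<union> W'. p j (lders G v F g))"
      by (intro mult_left_mono m mult_nonneg_nonneg C'(1) assms(3)) simp
    finally show "X F g + Y F g \<le> (C + C') * H g * (\<Sum>v\<in>W \<union> W'. p j (lders G v F g))"
      using 1 by (simp add: distrib_right)
  qed (use C C' in auto)
qed

lemma dominated_zero: "dominated (p j) (\<lambda>F g. 0) H"
  by (rule dominatedI[of 0 "{}"]) auto

lemma dominated_sum_list:
  assumes "\<And>i. i \<in> set is \<Longrightarrow> dominated (p j) (X i) H" "\<And>g. 0 \<le> H g"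
  shows "dominated (p j) (\<lambda>F g. \<Sum>i\<leftarrow>is. X i F g) H"
  using assms(1)
proof (induction "is")
  case (Cons i "is")
  then show ?case using dominated_add[of "X i" H "\<lambda>F g. \<Sum>i\<leftarrow>is. X i F g"] assms(2) by simp
qed (simp add: dominated_zero)

lemma dominated_sum:
  assumes "\<And>i. i \<in> I \<Longrightarrow> dominated (p j) (X i) H" "\<And>g. 0 \<le> H g"
  shows "dominated (p j) (\<lambda>F g. \<Sum>i\<in>I. X i F g) H"
  using assms(1)
proof (induction I rule: infinite_finite_induct)
  case (insert i I)
  then show ?case using dominated_add[of "X i" H "\<lambda>F g. \<Sum>i\<in>I. X i F g"] assms(2) by simp
qed (simp_all add: dominated_zero)

lemma dominated_mult:
  assumes X: "dominated (p j) X H" and nn: "\<And>F g. smooth_fun G F \<Longrightarrow> 0 \<le> X F g" "\<And>g. 0 \<le> c g" "\<And>g. 0 \<le> H g"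
    and c: "0 \<le> K" "\<And>g. c g \<le> K * k g"
  shows "dominated (p j) (\<lambda>F g. c g * X F g) (\<lambda>g. k g * H g)"
proof -
  obtain C W where C: "0 \<le> C" "finite W"
    "\<forall>F g. smooth_fun G F \<longrightarrow> X F g \<le> C * H g * (\<Sum>v\<in>W. p j (lders G v F g))"
    using X by (rule dominatedE)
  show ?thesis
  proof (rule dominatedI[of "K * C" W])
    fix F :: "'g \<Rightarrow> 'e" and g assume F: "smooth_fun G F"
    have "c g * X F g \<le> (K * k g) * (C * H g * (\<Sum>v\<in>W. p j (lders G v F g)))"
      using c(2)[of g] C(3) F nn(1)[OF F] nn(2)[of g] by (intro mult_mono) (auto intro: order_trans)
    then show "c g * X F g \<le> K * C * (k g * H g) * (\<Sum>v\<in>W. p j (lders G v F g))"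
      by (simp add: mult_ac)
  qed (use C c in auto)
qed

text \<open>\<open>h l\<close> bounds derivatives of order \<open>l\<close> of \<open>T F\<close>.
  They are taken along letters of \<open>A\<close>, the directions in which derivatives of the
  multiplier are controlled; the words that end up on \<open>F\<close> itself are
  unrestricted.\<close>

definition op_bounded :: "(('g \<Rightarrow> 'e) \<Rightarrow> 'g \<Rightarrow> 'e) \<Rightarrow> 'a set \<Rightarrow> (nat \<Rightarrow> 'g \<Rightarrow> real) \<Rightarrow> bool" where
  "op_bounded T A h \<longleftrightarrow> (\<forall>F. smooth_fun G F \<longrightarrow> smooth_fun G (T F)) \<and>
     (\<forall>w\<in>lists A. dominated (p j) (\<lambda>F g. p j (lders G w (T F) g)) (h (length w)))"

lemma op_bounded_id: "op_bounded (\<lambda>F. F) A (\<lambda>_ _. 1)"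
  unfolding op_bounded_def
proof (intro conjI ballI allI impI)
  show "dominated (p j) (\<lambda>F g. p j (lders G w F g)) (\<lambda>_. 1)" for w :: "'a list"
    by (rule dominatedI[of 1 "{w}"]) auto
qed

lemma lders_free_act:
  assumes "smooth_fun G (f :: 'g \<Rightarrow> 'e)"
  shows "lders G w (free_act G q f) g
    = (\<Sum>k\<in>Poly_Mapping.keys q. Poly_Mapping.lookup q k *\<^sub>R lders G (w @ letters k) f g)"
proof -
  have "smooth_fun G (\<lambda>g. \<Sum>k\<in>K. c k *\<^sub>R lders G (letters k) f g) \<and>
     (\<forall>g. lders G w (\<lambda>g. \<Sum>k\<in>K. c k *\<^sub>R lders G (letters k) f g) g
        = (\<Sum>k\<in>K. c k *\<^sub>R lders G (w @ letters k) f g))" if "finite K" for K c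
    using that
  proof (induction K rule: finite_induct)
    case empty
    then show ?case by (simp add: smooth_fun_const lders_zero[OF p])
  next
    case (insert k K)
    have s: "smooth_fun G (lders G (letters k) f)" by (rule smooth_fun_lders[OF p assms])
    have 1: "smooth_fun G (\<lambda>g. c k *\<^sub>R lders G (letters k) f g)" by (rule smooth_fun_scaleR(1)[OF p s])
    have 2: "smooth_fun G (\<lambda>g. \<Sum>k\<in>K. c k *\<^sub>R lders G (letters k) f g)" using insert by blast
    show ?case
      using smooth_fun_add[OF p 1 2] lders_add[OF p 1 2, of w] lders_scaleR[OF p s, of w] insert by simp
  qed
  moreover have "free_act G q f = (\<lambda>g. \<Sum>k\<in>Poly_Mapping.keys q. Poly_Mapping.lookup q k *\<^sub>R lders G (letters k) f g)"
    by (rule ext) (simp add: free_act_def)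
  ultimately show ?thesis by simp
qed

text \<open>In the Leibniz rule at most \<open>l\<close> letters meet \<open>1 / \<alpha>\<close>,
  each at the price of one \<open>\<nu>\<close>. Monotonicity of \<open>h\<close> replaces the order
  of the remaining derivative by \<open>l\<close>.\<close>

lemma op_bounded_product:
  fixes sc :: "complex \<Rightarrow> 'e \<Rightarrow> 'e" and \<alpha> :: "'g \<Rightarrow> complex" and \<nu> :: "'g \<Rightarrow> real"
  assumes sc: "cont_bilinear sc" "\<And>c x. p j (sc c x) = cmod c * p j x"
    and \<alpha>: "smooth_fun G \<alpha>" "\<And>g. \<alpha> g \<noteq> 0" and \<nu>: "\<And>g. 1 \<le> \<nu> g"
    and bound: "\<And>u. u \<in> lists A \<Longrightarrow> \<exists>C. \<forall>g. cmod (lders G u \<alpha> g) \<le> C * cmod (\<alpha> g) * \<nu> g"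
    and T: "op_bounded T A h" and h: "\<And>l g. 0 \<le> h l g" "\<And>l l' g. l \<le> l' \<Longrightarrow> h l g \<le> h l' g"
  shows "op_bounded (\<lambda>F g. sc (inverse (\<alpha> g)) (T F g)) A (\<lambda>l g. inverse (cmod (\<alpha> g)) * \<nu> g ^ l * h l g)"
proof -
  define \<beta> where "\<beta> = (\<lambda>g. inverse (\<alpha> g))"
  have \<beta>: "smooth_fun G \<beta>" unfolding \<beta>_def by (rule smooth_fun_inverse[OF \<alpha>])
  have Ts: "smooth_fun G (T F)" if "smooth_fun G F" for F :: "'g \<Rightarrow> 'e" using T that by (simp add: op_bounded_def)
  have s: "smooth_fun G (\<lambda>g. sc (\<beta> g) (T F g))" if "smooth_fun G F" for F :: "'g \<Rightarrow> 'e"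
    by (rule smooth_fun_bilinear[OF sc(1) p p \<beta> Ts[OF that]])
  have "dominated (p j) (\<lambda>F g. p j (lders G w (\<lambda>g. sc (\<beta> g) (T F g)) g))
      (\<lambda>g. inverse (cmod (\<alpha> g)) * \<nu> g ^ length w * h (length w) g)" if w: "w \<in> lists A" for w
  proof -
    let ?H = "\<lambda>g. inverse (cmod (\<alpha> g)) * \<nu> g ^ length w * h (length w) g"
    have \<nu>0: "0 \<le> \<nu> g ^ k" for g k using \<nu>[of g] by simp
    have H: "0 \<le> ?H g" for g using h(1) \<nu>0 by simp
    have dom: "dominated (p j) (\<lambda>F g. cmod (lders G u \<beta> g) * p j (lders G v (T F) g)) ?H"
      if uv: "u \<in> lists A" "v \<in> lists A" "length u \<le> length w" "length v \<le> length w" for u v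
    proof -
      have "\<exists>C\<ge>0. \<forall>g. cmod (lders G u \<beta> g) \<le> C * (inverse (cmod (\<alpha> g)) * \<nu> g ^ length u)"
        unfolding \<beta>_def by (rule lders_inverse_bound[of \<alpha> \<nu> A u, OF \<alpha> \<nu> bound uv(1)])
      then obtain C where C: "0 \<le> C" "\<forall>g. cmod (lders G u \<beta> g) \<le> C * (inverse (cmod (\<alpha> g)) * \<nu> g ^ length u)"
        by (elim exE conjE)
      have "dominated (p j) (\<lambda>F g. p j (lders G v (T F) g)) (h (length v))"
        using T uv(2) by (simp add: op_bounded_def)
      from dominated_mult[OF this _ norm_ge_zero h(1) C(1) C(2)[rule_format]]
      have "dominated (p j) (\<lambda>F g. cmod (lders G u \<beta> g) * p j (lders G v (T F) g))
          (\<lambda>g. inverse (cmod (\<alpha> g)) * \<nu> g ^ length u * h (length v) g)"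
        by (simp add: seminorm_space.p_nonneg[OF p])
      then show ?thesis
      proof (rule dominated_mono)
        show "inverse (cmod (\<alpha> g)) * \<nu> g ^ length u * h (length v) g \<le> ?H g" for g
          using uv \<nu>[of g] by (intro mult_mono mult_left_mono power_increasing h mult_nonneg_nonneg \<nu>0) auto
      qed simp
    qed
    have "dominated (p j) (\<lambda>F g. cmod (lders G [] \<beta> g) * p j (lders G w (T F) g) +
        (\<Sum>uv\<leftarrow>splits w. cmod (lders G (fst uv) \<beta> g) * p j (lders G (snd uv) (T F) g))) ?H"
    proof (intro dominated_add dominated_sum_list H dom)
      fix uv assume "uv \<in> set (splits w)"
      then have uv: "(fst uv, snd uv) \<in> set (splits w)" by simp
      show "fst uv \<in> lists A" "snd uv \<in> lists A" using splits_lists[OF w uv] by auto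
      show "length (fst uv) \<le> length w" "length (snd uv) \<le> length w" using splits_length[OF uv] by auto
    qed (use w in auto)
    then show ?thesis
    proof (rule dominated_mono)
      fix F :: "'g \<Rightarrow> 'e" and g assume F: "smooth_fun G F"
      have "p j (lders G w (\<lambda>g. sc (\<beta> g) (T F g)) g) \<le> p j (sc (\<beta> g) (lders G w (T F) g))
          + p j (\<Sum>uv\<leftarrow>splits w. sc (lders G (fst uv) \<beta> g) (lders G (snd uv) (T F) g))"
        unfolding Leibniz[OF sc(1) p \<beta> Ts[OF F]] by (rule seminorm_space.p_add[OF p])
      also have "\<dots> \<le> p j (sc (\<beta> g) (lders G w (T F) g))
          + (\<Sum>uv\<leftarrow>splits w. p j (sc (lders G (fst uv) \<beta> g) (lders G (snd uv) (T F) g)))"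
        by (intro add_left_mono seminorm_space.p_sum_list[OF p])
      finally show "p j (lders G w (\<lambda>g. sc (\<beta> g) (T F g)) g) \<le> cmod (lders G [] \<beta> g) * p j (lders G w (T F) g) +
        (\<Sum>uv\<leftarrow>splits w. cmod (lders G (fst uv) \<beta> g) * p j (lders G (snd uv) (T F) g))"
        by (simp add: sc(2))
    qed simp
  qed
  then show ?thesis unfolding op_bounded_def using s unfolding \<beta>_def by blast
qed

text \<open>An element of degree at most \<open>b\<close> prolongs every word by at most
  \<open>b\<close> letters of \<open>A\<close>, hence the shift from \<open>l\<close> to
  \<open>l + b\<close>.\<close>

lemma op_bounded_lop:
  assumes T: "op_bounded T A h" and h: "\<And>l g. 0 \<le> h l g" "\<And>l l' g. l \<le> l' \<Longrightarrow> h l g \<le> h l' g"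
    and q: "letters ` Poly_Mapping.keys q \<subseteq> lists A" "\<And>k. k \<in> Poly_Mapping.keys q \<Longrightarrow> length (letters k) \<le> b"
  shows "op_bounded (\<lambda>F. lop G (abs_uea q) (T F)) A (\<lambda>l. h (l + b))"
proof -
  have Ts: "smooth_fun G (T F)" if "smooth_fun G F" for F :: "'g \<Rightarrow> 'e" using T that by (simp add: op_bounded_def)
  have "dominated (p j) (\<lambda>F g. p j (lders G w (lop G (abs_uea q) (T F)) g)) (h (length w + b))"
    if w: "w \<in> lists A" for w
  proof -
    have "dominated (p j) (\<lambda>F g. \<Sum>k\<in>Poly_Mapping.keys q.
        \<bar>Poly_Mapping.lookup q k\<bar> * p j (lders G (w @ letters k) (T F) g)) (h (length w + b))"
    proof (rule dominated_sum)
      fix k assume k: "k \<in> Poly_Mapping.keys q"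
      have "w @ letters k \<in> lists A" using w q(1) k by auto
      then have "dominated (p j) (\<lambda>F g. p j (lders G (w @ letters k) (T F) g)) (h (length (w @ letters k)))"
        using T unfolding op_bounded_def by blast
      then have d: "dominated (p j) (\<lambda>F g. p j (lders G (w @ letters k) (T F) g)) (h (length w + b))"
        by (rule dominated_mono) (use h(2) q(2)[OF k] in auto)
      have "dominated (p j) (\<lambda>F g. \<bar>Poly_Mapping.lookup q k\<bar> * p j (lders G (w @ letters k) (T F) g))
          (\<lambda>g. 1 * h (length w + b) g)"
        by (rule dominated_mult[OF d _ _ h(1), of _ "\<bar>Poly_Mapping.lookup q k\<bar>"])
           (simp_all add: seminorm_space.p_nonneg[OF p])
      then show "dominated (p j) (\<lambda>F g. \<bar>Poly_Mapping.lookup q k\<bar> * p j (lders G (w @ letters k) (T F) g))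
          (h (length w + b))" by simp
    qed (rule h(1))
    then show ?thesis
    proof (rule dominated_mono)
      fix F :: "'g \<Rightarrow> 'e" and g assume F: "smooth_fun G F"
      have "p j (lders G w (lop G (abs_uea q) (T F)) g)
          = p j (\<Sum>k\<in>Poly_Mapping.keys q. Poly_Mapping.lookup q k *\<^sub>R lders G (w @ letters k) (T F) g)"
        by (simp only: lop_abs_uea[OF p Ts[OF F]] lders_free_act[OF Ts[OF F]])
      also have "\<dots> \<le> (\<Sum>k\<in>Poly_Mapping.keys q. p j (Poly_Mapping.lookup q k *\<^sub>R lders G (w @ letters k) (T F) g))"
        by (rule seminorm_space.p_sum[OF p])
      finally show "p j (lders G w (lop G (abs_uea q) (T F)) g) \<le> (\<Sum>k\<in>Poly_Mapping.keys q.
        \<bar>Poly_Mapping.lookup q k\<bar> * p j (lders G (w @ letters k) (T F) g))"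
        by (simp only: seminorm_space.p_scaleR[OF p])
    qed simp
  qed
  then show ?thesis unfolding op_bounded_def using smooth_fun_lop[OF p Ts] by blast
qed

end

end

section \<open>Iterating the operators\<close>

context lie_group
begin

lemma op_bounded_subset:
  assumes p: "seminorm_space p" and "op_bounded p j T A h" "A' \<subseteq> A"
  shows "op_bounded p j T A' h"
  using assms(2,3) lists_mono unfolding op_bounded_def[OF p] by blast

context
  fixes p :: "nat \<Rightarrow> 'e::{real_vector,t2_space} \<Rightarrow> real" and j :: nat
    and sc :: "complex \<Rightarrow> 'e \<Rightarrow> 'e"
  assumes p: "seminorm_space p" and sc: "cont_bilinear sc" "\<And>c x. p j (sc c x) = cmod c * p j x"
begin

text \<open>The \<open>m\<close> operators supply at most \<open>m * b\<close> letters in addition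
  to the \<open>l\<close> given ones, so each of the \<open>m\<close> factors
  \<open>1 / \<alpha>\<close> is hit by at most \<open>l + m * b\<close> of them.\<close>

lemma op_bounded_power:
  fixes \<alpha> :: "'g \<Rightarrow> complex" and \<nu> :: "'g \<Rightarrow> real"
  defines "D \<equiv> \<lambda>q \<Phi>. lop G (abs_uea q) (\<lambda>g. sc (1 / \<alpha> g) (\<Phi> g))"
  assumes \<alpha>: "smooth_fun G \<alpha>" "\<And>g. \<alpha> g \<noteq> 0" and \<nu>: "\<And>g. 1 \<le> \<nu> g"
    and bound: "\<And>u. u \<in> lists A \<Longrightarrow> \<exists>C. \<forall>g. cmod (lders G u \<alpha> g) \<le> C * cmod (\<alpha> g) * \<nu> g"
    and q: "letters ` Poly_Mapping.keys q \<subseteq> lists A" "\<And>k. k \<in> Poly_Mapping.keys q \<Longrightarrow> length (letters k) \<le> b"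
    and T: "op_bounded p j T A h" and h: "\<And>l g. 0 \<le> h l g" "\<And>l l' g. l \<le> l' \<Longrightarrow> h l g \<le> h l' g"
  shows "op_bounded p j (\<lambda>F. (D q ^^ m) (T F)) A
    (\<lambda>l g. inverse (cmod (\<alpha> g)) ^ m * \<nu> g ^ (m * (l + m * b)) * h (l + m * b) g)"
proof (induction m)
  case 0
  then show ?case using T by simp
next
  case (Suc m)
  let ?h = "\<lambda>l g. inverse (cmod (\<alpha> g)) ^ m * \<nu> g ^ (m * (l + m * b)) * h (l + m * b) g"
  have \<nu>0: "0 \<le> \<nu> g ^ k" for g k using \<nu>[of g] by simp
  have h0: "0 \<le> ?h l g" for l g using h(1) \<nu>0 by simp
  have hm: "?h l g \<le> ?h l' g" if "l \<le> l'" for l l' g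
    using that \<nu>[of g] by (intro mult_mono mult_left_mono power_increasing h mult_nonneg_nonneg \<nu>0) auto
  let ?h1 = "\<lambda>l g. inverse (cmod (\<alpha> g)) * \<nu> g ^ l * ?h l g"
  have b1: "op_bounded p j (\<lambda>F g. sc (inverse (\<alpha> g)) ((D q ^^ m) (T F) g)) A ?h1"
    by (rule op_bounded_product[OF p sc \<alpha> \<nu> bound Suc.IH h0 hm])
  have h10: "0 \<le> ?h1 l g" for l g using h0 \<nu>0 by simp
  have h1m: "?h1 l g \<le> ?h1 l' g" if "l \<le> l'" for l l' g
    using that \<nu>[of g] by (intro mult_mono[OF _ hm] mult_left_mono power_increasing h0 mult_nonneg_nonneg \<nu>0) auto
  have b2: "op_bounded p j (\<lambda>F. (D q ^^ Suc m) (T F)) A (\<lambda>l. ?h1 (l + b))"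
    using op_bounded_lop[OF p b1 h10 h1m q] by (simp add: D_def inverse_eq_divide)
  have le: "?h1 (l + b) g \<le> inverse (cmod (\<alpha> g)) ^ Suc m * \<nu> g ^ (Suc m * (l + Suc m * b)) * h (l + Suc m * b) g" for l g
  proof -
    \<comment> \<open>The exact exponent falls short of the claimed one by \<open>m * b\<close>;
      \<open>\<nu> \<ge> 1\<close> absorbs the difference.\<close>
    have "?h1 (l + b) g = inverse (cmod (\<alpha> g)) ^ Suc m * \<nu> g ^ ((l + b) + m * (l + b + m * b)) * h (l + Suc m * b) g"
      by (simp add: power_add mult_ac add_ac)
    also have "\<dots> \<le> inverse (cmod (\<alpha> g)) ^ Suc m * \<nu> g ^ (Suc m * (l + Suc m * b)) * h (l + Suc m * b) g"
      using \<nu>[of g] by (intro mult_right_mono mult_left_mono power_increasing h(1)) (auto simp: algebra_simps)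
    finally show ?thesis .
  qed
  have s: "smooth_fun G F \<Longrightarrow> smooth_fun G ((D q ^^ Suc m) (T F))" for F
    using b2 by (simp add: op_bounded_def[OF p])
  have d: "w \<in> lists A \<Longrightarrow> dominated (p j) (\<lambda>F g. p j (lders G w ((D q ^^ Suc m) (T F)) g)) (?h1 (length w + b))" for w
    using b2 unfolding op_bounded_def[OF p] by (elim conjE) (erule bspec)
  show ?case unfolding op_bounded_def[OF p]
  proof (intro conjI allI impI ballI)
    fix w assume w: "w \<in> lists A"
    show "dominated (p j) (\<lambda>F g. p j (lders G w ((D q ^^ Suc m) (T F)) g))
      (\<lambda>g. inverse (cmod (\<alpha> g)) ^ Suc m * \<nu> g ^ (Suc m * (length w + Suc m * b)) * h (length w + Suc m * b) g)"
      by (rule dominated_mono[OF p d[OF w] order_refl le])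
  qed (rule s)
qed

text \<open>Downward induction on \<open>n\<close>, since the operators with larger index act
  earlier. The factor \<open>1 / \<alpha> k\<close> is met by the letters of the operators with
  index \<open>i \<le> k\<close> only; they lie in \<open>A i \<subseteq> A k\<close>, where the
  bound for \<open>\<alpha> k\<close> holds.\<close>

lemma op_bounded_D_vec:
  fixes \<alpha> :: "nat \<Rightarrow> 'g \<Rightarrow> complex" and \<nu> :: "nat \<Rightarrow> 'g \<Rightarrow> real" and q :: "nat \<Rightarrow> 'a tword \<Rightarrow>\<^sub>0 real"
  defines "D \<equiv> \<lambda>n \<Phi>. lop G (abs_uea (q n)) (\<lambda>g. sc (1 / \<alpha> n g) (\<Phi> g))"
  assumes \<alpha>: "\<And>n. n \<le> N \<Longrightarrow> smooth_fun G (\<alpha> n)" "\<And>n g. n \<le> N \<Longrightarrow> \<alpha> n g \<noteq> 0"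
    and \<nu>: "\<And>n g. n \<le> N \<Longrightarrow> 1 \<le> \<nu> n g"
    and bound: "\<And>n u. n \<le> N \<Longrightarrow> u \<in> lists (A n) \<Longrightarrow> \<exists>C. \<forall>g. cmod (lders G u (\<alpha> n) g) \<le> C * cmod (\<alpha> n g) * \<nu> n g"
    and q: "\<And>n. n \<le> N \<Longrightarrow> letters ` Poly_Mapping.keys (q n) \<subseteq> lists (A n)"
      "\<And>n k. n \<le> N \<Longrightarrow> k \<in> Poly_Mapping.keys (q n) \<Longrightarrow> length (letters k) \<le> b n"
    and A: "\<And>n. A n \<subseteq> A (Suc n)" and n: "n \<le> Suc N"
  shows "op_bounded p j (foldr (\<lambda>n. D n ^^ r n) [n..<Suc N]) (A n)
    (\<lambda>l g. \<Prod>k=n..N. inverse (cmod (\<alpha> k g)) ^ r k * \<nu> k g ^ (r k * (l + (\<Sum>i=n..k. r i * b i))))"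
  using n
proof (induction rule: inc_induct)
  case base
  then show ?case using op_bounded_id[OF p] by simp
next
  case (step n)
  then have n: "n \<le> N" by simp
  let ?h = "\<lambda>l g. \<Prod>k=Suc n..N. inverse (cmod (\<alpha> k g)) ^ r k * \<nu> k g ^ (r k * (l + (\<Sum>i=Suc n..k. r i * b i)))"
  let ?T = "foldr (\<lambda>n. D n ^^ r n) [Suc n..<Suc N]"
  have T: "op_bounded p j ?T (A n) ?h" by (rule op_bounded_subset[OF p step.IH A])
  have f0: "0 \<le> inverse (cmod (\<alpha> k g)) ^ r k * \<nu> k g ^ e" if "k \<in> {Suc n..N}" for k g e
    using \<nu>[of k g] that by simp
  have h0: "0 \<le> ?h l g" for l g by (rule prod_nonneg) (use f0 in blast)
  have hm: "?h l g \<le> ?h l' g" if "l \<le> l'" for l l' g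
  proof (rule prod_mono)
    fix k assume k: "k \<in> {Suc n..N}"
    show "0 \<le> inverse (cmod (\<alpha> k g)) ^ r k * \<nu> k g ^ (r k * (l + (\<Sum>i=Suc n..k. r i * b i))) \<and>
       inverse (cmod (\<alpha> k g)) ^ r k * \<nu> k g ^ (r k * (l + (\<Sum>i=Suc n..k. r i * b i)))
         \<le> inverse (cmod (\<alpha> k g)) ^ r k * \<nu> k g ^ (r k * (l' + (\<Sum>i=Suc n..k. r i * b i)))"
      using f0[OF k] \<nu>[of k g] k that by (intro conjI mult_left_mono power_increasing mult_le_mono2) auto
  qed
  have "op_bounded p j (\<lambda>F. (D n ^^ r n) (?T F)) (A n)
      (\<lambda>l g. inverse (cmod (\<alpha> n g)) ^ r n * \<nu> n g ^ (r n * (l + r n * b n)) * ?h (l + r n * b n) g)"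
    unfolding D_def
    by (rule op_bounded_power[OF \<alpha>[OF n] \<nu>[OF n] bound[OF n] q[OF n] T[unfolded D_def] h0 hm])
  moreover have "(\<lambda>F. (D n ^^ r n) (?T F)) = foldr (\<lambda>n. D n ^^ r n) [n..<Suc N]"
    using n by (auto simp: upt_conv_Cons simp del: upt_Suc)
  moreover have "inverse (cmod (\<alpha> n g)) ^ r n * \<nu> n g ^ (r n * (l + r n * b n)) * ?h (l + r n * b n) g
      = (\<Prod>k=n..N. inverse (cmod (\<alpha> k g)) ^ r k * \<nu> k g ^ (r k * (l + (\<Sum>i=n..k. r i * b i))))" for l g
  proof -
    have e: "l + r n * b n + (\<Sum>i=Suc n..k. r i * b i) = l + (\<Sum>i=n..k. r i * b i)" if "n \<le> k" for k
      using that by (simp add: sum.atLeast_Suc_atMost)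
    have "?h (l + r n * b n) g
        = (\<Prod>k=Suc n..N. inverse (cmod (\<alpha> k g)) ^ r k * \<nu> k g ^ (r k * (l + (\<Sum>i=n..k. r i * b i))))"
    proof (rule prod.cong[OF refl])
      fix k assume "k \<in> {Suc n..N}"
      then have k: "n \<le> k" by simp
      show "inverse (cmod (\<alpha> k g)) ^ r k * \<nu> k g ^ (r k * (l + r n * b n + (\<Sum>i=Suc n..k. r i * b i)))
          = inverse (cmod (\<alpha> k g)) ^ r k * \<nu> k g ^ (r k * (l + (\<Sum>i=n..k. r i * b i)))"
        by (simp only: e[OF k])
    qed
    then show ?thesis unfolding prod.atLeast_Suc_atMost[OF n] by simp
  qed
  ultimately show ?case by simp
qed

end

end

section \<open>Polynomial volume growth\<close>

lemma tempered_map_bound: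
  assumes "tempered_map f"
  shows "\<exists>C\<ge>0. \<exists>k. \<forall>x. norm (f x) \<le> C * (1 + norm x) ^ k"
proof -
  obtain C k where C: "\<forall>x. norm (f x) \<le> C * (1 + norm x) ^ k"
    using assms unfolding tempered_map_def by (metis foldr_Nil id_apply lists.Nil)
  have "norm (f x) \<le> \<bar>C\<bar> * (1 + norm x) ^ k" for x
    by (rule order_trans[OF C[rule_format]]) (intro mult_right_mono, auto)
  then show ?thesis by (intro exI[of _ "\<bar>C\<bar>"]) auto
qed

text \<open>The first partial derivatives grow polynomially and balls are convex, so the mean value
  inequality along the segment applies.\<close>

lemma tempered_map_lipschitz:
  fixes f :: "'a::euclidean_space \<Rightarrow> 'b::real_normed_vector"
  assumes f: "tempered_map f"
  shows "\<exists>C\<ge>0. \<exists>k. \<forall>R\<ge>0. \<forall>x y. norm x \<le> R \<longrightarrow> norm y \<le> R \<longrightarrow> norm (f x - f y) \<le> C * (1 + R) ^ k * norm (x - y)"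
proof -
  have sm: "smooth_on UNIV f" using f by (simp add: tempered_map_def)
  have "\<forall>b\<in>Basis. \<exists>Ck. \<forall>x. norm (pd b f x) \<le> fst Ck * (1 + norm x) ^ snd Ck"
  proof
    fix b :: 'a assume b: "b \<in> Basis"
    then have "[b] \<in> lists Basis" by simp
    then obtain C k where "\<forall>x. norm (foldr pd [b] f x) \<le> C * (1 + norm x) ^ k"
      using f unfolding tempered_map_def by metis
    then show "\<exists>Ck. \<forall>x. norm (pd b f x) \<le> fst Ck * (1 + norm x) ^ snd Ck"
      by (intro exI[of _ "(C, k)"]) simp
  qed
  from bchoice[OF this] obtain Ck where Ck: "\<And>b x. b \<in> Basis \<Longrightarrow> norm (pd b f x) \<le> fst (Ck b) * (1 + norm x) ^ snd (Ck b)"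
    by auto
  define C where "C = (\<Sum>b\<in>Basis. \<bar>fst (Ck b)\<bar>)"
  define k where "k = (\<Sum>b\<in>Basis. snd (Ck b))"
  have "norm (f x - f y) \<le> C * (1 + R) ^ k * norm (x - y)" if R: "0 \<le> R" "norm x \<le> R" "norm y \<le> R" for R x y
  proof -
    \<comment> \<open>With comparison vector \<open>0\<close> the segment estimate bounds the
      increment itself.\<close>
    have "norm (f (y + 1 *\<^sub>R (x - y)) - f (y + 0 *\<^sub>R (x - y)) - 1 *\<^sub>R 0) \<le> \<bar>1\<bar> * (C * (1 + R) ^ k * norm (x - y))"
    proof (rule seminorm_space.segment_estimate[OF seminorm_space_normed,
        where c = "\<lambda>s. f (y + s *\<^sub>R (x - y))" and c' = "\<lambda>s. dir_deriv f (y + s *\<^sub>R (x - y)) (x - y)"])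
      fix s :: real assume s: "s \<in> closed_segment 0 1"
      define z where "z = y + s *\<^sub>R (x - y)"
      have "has_dq (\<lambda>h. z + h *\<^sub>R (x - y)) z (x - y)"
        unfolding has_dq_def
        by (rule tendsto_eventually) (simp add: eventually_at_filter)
      from seminorm_space.has_dq_chain[OF seminorm_space_normed smooth_on_Ck[OF sm] open_UNIV UNIV_I this]
      show "has_dq (\<lambda>h. f (y + (s + h) *\<^sub>R (x - y))) (f (y + s *\<^sub>R (x - y))) (dir_deriv f (y + s *\<^sub>R (x - y)) (x - y))"
        by (simp add: z_def algebra_simps)
      have "z = (1 - s) *\<^sub>R y + s *\<^sub>R x" by (simp add: z_def algebra_simps)
      moreover have "0 \<le> s" "s \<le> 1" using s by (auto simp: closed_segment_eq_real_ivl)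
      ultimately have "z \<in> closed_segment y x" unfolding in_segment by blast
      then have zR: "norm z \<le> R"
        using closed_segment_subset[of y "cball 0 R" x] R by (auto simp: subset_iff)
      have "norm (dir_deriv f z (x - y)) \<le> (\<Sum>b\<in>Basis. norm (((x - y) \<bullet> b) *\<^sub>R pd b f z))"
        unfolding dir_deriv_def by (rule norm_sum)
      also have "\<dots> \<le> (\<Sum>b\<in>Basis. norm (x - y) * (\<bar>fst (Ck b)\<bar> * (1 + R) ^ k))"
      proof (rule sum_mono)
        fix b :: 'a assume b: "b \<in> Basis"
        have "norm (pd b f z) \<le> fst (Ck b) * (1 + norm z) ^ snd (Ck b)" by (rule Ck[OF b])
        also have "\<dots> \<le> \<bar>fst (Ck b)\<bar> * (1 + norm z) ^ snd (Ck b)" by (intro mult_right_mono) auto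
        also have "\<dots> \<le> \<bar>fst (Ck b)\<bar> * (1 + R) ^ snd (Ck b)"
          using zR by (intro mult_left_mono power_mono) auto
        also have "\<dots> \<le> \<bar>fst (Ck b)\<bar> * (1 + R) ^ k"
          using R(1) b unfolding k_def by (intro mult_left_mono power_increasing member_le_sum) auto
        finally show "norm (((x - y) \<bullet> b) *\<^sub>R pd b f z) \<le> norm (x - y) * (\<bar>fst (Ck b)\<bar> * (1 + R) ^ k)"
          unfolding norm_scaleR using Basis_le_norm[OF b, of "x - y"] by (intro mult_mono) auto
      qed
      also have "\<dots> = C * (1 + R) ^ k * norm (x - y)"
        by (simp add: C_def sum_distrib_left sum_distrib_right mult_ac)
      finally show "norm (dir_deriv f (y + s *\<^sub>R (x - y)) (x - y) - 0) \<le> C * (1 + R) ^ k * norm (x - y)"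
        by (simp add: z_def)
    qed
    then show ?thesis by simp
  qed
  moreover have "0 \<le> C" by (simp add: C_def sum_nonneg)
  ultimately show ?thesis by blast
qed

text \<open>Cells of a grid of side \<open>s\<close>, labelled by integer parts. Points are picked
  from the nonempty cells rather than taken as cell centres, so that they lie in the ball, where the
  Lipschitz bound for translations holds. Two points of a cell differ by at most \<open>s\<close> in
  each coordinate.\<close>

lemma cball_cover:
  fixes R s :: real
  assumes R: "0 \<le> R" and s: "0 < s"
  shows "\<exists>P. finite P \<and> P \<subseteq> cball (0::'a::euclidean_space) R \<and> real (card P) \<le> (2 * (R / s + 1) + 1) ^ DIM('a)
    \<and> (\<forall>x\<in>cball 0 R. \<exists>\<xi>\<in>P. norm (x - \<xi>) \<le> real DIM('a) * s)"
proof -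
  define cell where "cell = (\<lambda>x::'a. \<lambda>b\<in>Basis. \<lfloor>(x \<bullet> b) / s\<rfloor>)"
  define L where "L = \<lceil>R / s\<rceil>"
  have "0 \<le> R / s" using R s by simp
  then have L0: "0 \<le> L" unfolding L_def by linarith
  have in_cell: "cell x \<in> Basis \<rightarrow>\<^sub>E {- L..L}" if x: "x \<in> cball 0 R" for x
  proof
    fix b :: 'a assume b: "b \<in> Basis"
    have "\<bar>x \<bullet> b\<bar> \<le> R" using Basis_le_norm[OF b, of x] x by simp
    then have "- (R / s) \<le> (x \<bullet> b) / s" "(x \<bullet> b) / s \<le> R / s"
      using s by (auto simp: field_simps)
    then have "- L \<le> \<lfloor>(x \<bullet> b) / s\<rfloor>" "\<lfloor>(x \<bullet> b) / s\<rfloor> \<le> L" unfolding L_def by linarith+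
    then show "cell x b \<in> {- L..L}" using b by (simp add: cell_def)
  qed (simp add: cell_def)
  have fin: "finite (Basis \<rightarrow>\<^sub>E {- L..L} :: ('a \<Rightarrow> int) set)" by (intro finite_PiE) auto
  have sub: "cell ` cball 0 R \<subseteq> Basis \<rightarrow>\<^sub>E {- L..L}" using in_cell by blast
  define P where "P = inv_into (cball 0 R) cell ` (cell ` cball 0 R)"
  have finc: "finite (cell ` cball 0 R)" by (rule finite_subset[OF sub fin])
  have "card P \<le> card (cell ` cball 0 R)" unfolding P_def by (rule card_image_le[OF finc])
  also have "\<dots> \<le> card (Basis \<rightarrow>\<^sub>E {- L..L} :: ('a \<Rightarrow> int) set)" by (rule card_mono[OF fin sub])
  also have "\<dots> = nat (2 * L + 1) ^ DIM('a)" by (simp add: card_PiE)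
  finally have "real (card P) \<le> real (nat (2 * L + 1) ^ DIM('a))" by (simp only: of_nat_le_iff)
  also have "\<dots> = (2 * real_of_int L + 1) ^ DIM('a)" using L0 by simp
  also have "\<dots> \<le> (2 * (R / s + 1) + 1) ^ DIM('a)"
  proof (rule power_mono)
    show "2 * real_of_int L + 1 \<le> 2 * (R / s + 1) + 1"
      unfolding L_def by (intro add_right_mono mult_left_mono of_int_ceiling_le_add_one) simp
    show "0 \<le> 2 * real_of_int L + 1" using L0 by simp
  qed
  finally have card: "real (card P) \<le> (2 * (R / s + 1) + 1) ^ DIM('a)" .
  have "\<exists>\<xi>\<in>P. norm (x - \<xi>) \<le> real DIM('a) * s" if x: "x \<in> cball 0 R" for x
  proof
    define \<xi> where "\<xi> = inv_into (cball 0 R) cell (cell x)"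
    show "\<xi> \<in> P" using x by (simp add: P_def \<xi>_def)
    have e: "cell \<xi> = cell x" unfolding \<xi>_def by (rule f_inv_into_f) (use x in blast)
    have "norm (x - \<xi>) \<le> (\<Sum>b\<in>Basis. \<bar>(x - \<xi>) \<bullet> b\<bar>)" by (rule norm_le_l1)
    also have "\<dots> \<le> (\<Sum>b\<in>(Basis::'a set). s)"
    proof (rule sum_mono)
      fix b :: 'a assume b: "b \<in> Basis"
      have "\<lfloor>(\<xi> \<bullet> b) / s\<rfloor> = \<lfloor>(x \<bullet> b) / s\<rfloor>" using fun_cong[OF e, of b] b by (simp add: cell_def)
      then have "\<bar>(x \<bullet> b) / s - (\<xi> \<bullet> b) / s\<bar> \<le> 1" by linarith
      then show "\<bar>(x - \<xi>) \<bullet> b\<bar> \<le> s" using s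
        by (simp add: inner_diff_left diff_divide_distrib[symmetric] divide_le_eq)
    qed
    finally show "norm (x - \<xi>) \<le> real DIM('a) * s" by simp
  qed
  moreover have "P \<subseteq> cball 0 R"
    unfolding P_def by (rule image_subsetI) (rule inv_into_into)
  moreover have "finite P" using finc by (simp add: P_def)
  ultimately show ?thesis using card by (intro exI[of _ P]) simp
qed


context lie_group
begin

context
  fixes S :: "'g \<Rightarrow> real"
  assumes temp: "tempered_pair G S"
begin

lemma moment_facts:
  shows moment_inv: "moment G S (inv_into UNIV (moment G S) \<xi>) = \<xi>"
    and inv_moment: "inv_into UNIV (moment G S) (moment G S g) = g"
    and continuous_moment: "continuous_on UNIV (moment G S)"
    and continuous_inv_moment: "continuous_on UNIV (inv_into UNIV (moment G S))"
    and tempered_mult: "tempered_map (\<lambda>(\<xi>, \<eta>). moment G S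
      (inv_into UNIV (moment G S) \<xi> \<otimes> inv_into UNIV (moment G S) \<eta>))"
    and tempered_inv: "tempered_map (\<lambda>\<xi>. moment G S (inv (inv_into UNIV (moment G S) \<xi>)))"
    and smooth_phase: "smooth_fun G S"
proof -
  note t = temp[unfolded tempered_pair_def Let_def]
  have b: "bij (moment G S)" using t by simp
  show "moment G S (inv_into UNIV (moment G S) \<xi>) = \<xi>" using b by (simp add: bij_is_surj surj_f_inv_f)
  show "inv_into UNIV (moment G S) (moment G S g) = g" using b by (simp add: bij_is_inj)
  show "continuous_on UNIV (moment G S)" using t by (intro smooth_fun_continuous) simp
  show "continuous_on UNIV (inv_into UNIV (moment G S))" using t by (simp add: smooth_into_def)
  show "tempered_map (\<lambda>(\<xi>, \<eta>). moment G S
      (inv_into UNIV (moment G S) \<xi> \<otimes> inv_into UNIV (moment G S) \<eta>))" using t by simp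
  show "tempered_map (\<lambda>\<xi>. moment G S (inv (inv_into UNIV (moment G S) \<xi>)))" using t by simp
  show "smooth_fun G S" using t by simp
qed

text \<open>The two points compared are the products of \<open>inv x\<close> with \<open>y\<close>
  and with \<open>x\<close>, and the second one is \<open>\<one>\<close>. Temperedness of the
  inversion keeps \<open>inv x\<close> in a ball of polynomial radius, on which the multiplication
  has a polynomial Lipschitz constant. The bound \<open>1 \<le> C\<close> serves the grid size in
  \<open>volume_growth\<close>.\<close>

lemma translation_lipschitz:
  "\<exists>C\<ge>1. \<exists>k. \<forall>R\<ge>0. \<forall>x y. norm (moment G S x) \<le> R \<longrightarrow> norm (moment G S y) \<le> R \<longrightarrow>
     norm (moment G S (inv x \<otimes> y) - moment G S \<one>) \<le> C * (1 + R) ^ k * norm (moment G S y - moment G S x)"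
proof -
  define \<phi> where "\<phi> = moment G S"
  define \<psi> where "\<psi> = inv_into UNIV \<phi>"
  have \<psi>\<phi>: "\<psi> (\<phi> g) = g" for g unfolding \<psi>_def \<phi>_def by (rule inv_moment)
  define m where "m = (\<lambda>(\<xi>, \<eta>). \<phi> (\<psi> \<xi> \<otimes> \<psi> \<eta>))"
  have m: "tempered_map m" using tempered_mult by (simp add: m_def \<phi>_def \<psi>_def)
  have "tempered_map (\<lambda>\<xi>. \<phi> (inv (\<psi> \<xi>)))" using tempered_inv by (simp add: \<phi>_def \<psi>_def)
  from tempered_map_bound[OF this] obtain C1 k1 where C1: "0 \<le> C1"
    "\<forall>\<xi>. norm (\<phi> (inv (\<psi> \<xi>))) \<le> C1 * (1 + norm \<xi>) ^ k1" by blast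
  obtain C2 k2 where C2: "0 \<le> C2" "\<forall>R\<ge>0. \<forall>z w. norm z \<le> R \<longrightarrow> norm w \<le> R \<longrightarrow>
      norm (m z - m w) \<le> C2 * (1 + R) ^ k2 * norm (z - w)" using tempered_map_lipschitz[OF m] by blast
  define C where "C = C2 * (C1 + 1) ^ k2 + 1"
  define k where "k = (k1 + 1) * k2"
  have "norm (\<phi> (inv x \<otimes> y) - \<phi> \<one>) \<le> C * (1 + R) ^ k * norm (\<phi> y - \<phi> x)"
    if R: "0 \<le> R" "norm (\<phi> x) \<le> R" "norm (\<phi> y) \<le> R" for R x y
  proof -
    define a where "a = \<phi> (inv x)"
    \<comment> \<open>A radius for the pairs \<open>(a, \<phi> y)\<close> and
      \<open>(a, \<phi> x)\<close>: the bound for the inverse plus \<open>R\<close>.\<close>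
    define R' where "R' = C1 * (1 + R) ^ k1 + R"
    have "norm a \<le> C1 * (1 + norm (\<phi> x)) ^ k1" using C1(2)[rule_format, of "\<phi> x"] by (simp add: \<psi>\<phi> a_def)
    also have "\<dots> \<le> C1 * (1 + R) ^ k1" using R C1(1) by (intro mult_left_mono power_mono) auto
    finally have a: "norm a \<le> C1 * (1 + R) ^ k1" .
    have R'0: "0 \<le> R'" using R C1 by (simp add: R'_def)
    have n: "norm (a, \<phi> z) \<le> R'" if "norm (\<phi> z) \<le> R" for z
      using norm_Pair_le[of a "\<phi> z"] a that by (simp add: R'_def)
    have "norm (m (a, \<phi> y) - m (a, \<phi> x)) \<le> C2 * (1 + R') ^ k2 * norm ((a, \<phi> y) - (a, \<phi> x))"
      using C2(2) R'0 n[OF R(3)] n[OF R(2)] by blast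
    then have "norm (\<phi> (inv x \<otimes> y) - \<phi> \<one>) \<le> C2 * (1 + R') ^ k2 * norm (\<phi> y - \<phi> x)"
      by (simp add: m_def a_def \<psi>\<phi> norm_Pair)
    also have "\<dots> \<le> C * (1 + R) ^ k * norm (\<phi> y - \<phi> x)"
    proof (rule mult_right_mono)
      have p1: "1 \<le> (1 + R) ^ k1" using R(1) by (intro one_le_power) simp
      have "1 + R' \<le> C1 * (1 + R) ^ (k1 + 1) + (1 + R) ^ (k1 + 1)"
      proof -
        have "C1 * (1 + R) ^ k1 \<le> C1 * (1 + R) ^ (k1 + 1)"
          using R(1) C1(1) by (intro mult_left_mono power_increasing) auto
        moreover have "1 + R \<le> (1 + R) ^ (k1 + 1)" using p1 R(1) by simp
        ultimately show ?thesis unfolding R'_def by linarith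
      qed
      then have "1 + R' \<le> (C1 + 1) * (1 + R) ^ (k1 + 1)" by (simp add: distrib_right)
      then have "(1 + R') ^ k2 \<le> ((C1 + 1) * (1 + R) ^ (k1 + 1)) ^ k2" using R'0 by (intro power_mono) auto
      also have "\<dots> = (C1 + 1) ^ k2 * (1 + R) ^ k"
        unfolding power_mult_distrib k_def power_mult[symmetric] ..
      finally have "C2 * (1 + R') ^ k2 \<le> C2 * ((C1 + 1) ^ k2 * (1 + R) ^ k)" using C2(1) by (rule mult_left_mono)
      also have "\<dots> \<le> C * (1 + R) ^ k" using R(1) by (simp add: C_def distrib_right mult.assoc)
      finally show "C2 * (1 + R') ^ k2 \<le> C * (1 + R) ^ k" .
    qed simp
    finally show ?thesis .
  qed
  moreover have "1 \<le> C" using C1 C2 by (simp add: C_def)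
  ultimately show ?thesis unfolding \<phi>_def by blast
qed

text \<open>Read off in the global chart, where the multiplication is a tempered map. It makes
  translates of compact sets compact, hence measurable.\<close>

lemma continuous_left_mult: "continuous_on UNIV (\<lambda>h. g \<otimes> h)"
proof -
  let ?\<phi> = "moment G S" and ?\<psi> = "inv_into UNIV (moment G S)"
  have "continuous_on UNIV (\<lambda>(\<xi>, \<eta>). ?\<phi> (?\<psi> \<xi> \<otimes> ?\<psi> \<eta>))"
    using tempered_mult Ck_on_continuous[OF smooth_on_Ck] unfolding tempered_map_def by blast
  then have "continuous_on UNIV (\<lambda>h. (\<lambda>(\<xi>, \<eta>). ?\<phi> (?\<psi> \<xi> \<otimes> ?\<psi> \<eta>)) (?\<phi> g, ?\<phi> h))"
    by (rule continuous_on_compose2) (auto intro!: continuous_intros continuous_moment)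
  then have "continuous_on UNIV (\<lambda>h. ?\<phi> (g \<otimes> h))" by (simp add: inv_moment)
  then have "continuous_on UNIV (\<lambda>h. ?\<psi> (?\<phi> (g \<otimes> h)))"
    by (rule continuous_on_compose2[OF continuous_inv_moment]) simp
  then show ?thesis by (simp add: inv_moment)
qed

context
  fixes M :: "'g measure"
  assumes haar: "left_haar_measure G M"
begin

lemma sets_haar: "sets M = sets borel"
  using haar by (simp add: left_haar_measure_def)

text \<open>
  In the global chart a ball of radius \<open>R\<close> is covered by polynomially many translates of a fixed
  compact set, which bounds its measure without computing the density of the Haar measure.
\<close>

theorem volume_growth:
  "\<exists>C\<ge>0. \<exists>k. \<forall>R\<ge>0. emeasure M {g. norm (moment G S g) \<le> R} \<le> ennreal (C * (1 + R) ^ k)"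
proof -
  define \<phi> where "\<phi> = moment G S"
  define \<psi> where "\<psi> = inv_into UNIV \<phi>"
  have \<psi>\<phi>: "\<psi> (\<phi> g) = g" for g unfolding \<psi>_def \<phi>_def by (rule inv_moment)
  have \<phi>\<psi>: "\<phi> (\<psi> \<xi>) = \<xi>" for \<xi> unfolding \<psi>_def \<phi>_def by (rule moment_inv)
  define d where "d = real DIM('a)"
  have d: "1 \<le> d" using DIM_positive[where 'a='a] by (simp add: d_def Suc_le_eq)
  \<comment> \<open>The fixed compact set is the unit ball around the identity in the moment
    coordinates.\<close>
  define W where "W = \<psi> ` cball (\<phi> \<one>) 1"
  have cW: "compact W" unfolding W_def
    by (rule compact_continuous_image) (use continuous_inv_moment in \<open>auto simp: \<psi>_def \<phi>_def intro: continuous_on_subset\<close>)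
  have fin: "emeasure M W < \<infinity>" using haar cW by (simp add: left_haar_measure_def)
  define w where "w = enn2real (emeasure M W)"
  have w: "emeasure M W = ennreal w" "0 \<le> w" using fin by (simp_all add: w_def)
  obtain C1 k1 where C1: "1 \<le> C1" "\<forall>R\<ge>0. \<forall>x y. norm (\<phi> x) \<le> R \<longrightarrow> norm (\<phi> y) \<le> R \<longrightarrow>
     norm (\<phi> (inv x \<otimes> y) - \<phi> \<one>) \<le> C1 * (1 + R) ^ k1 * norm (\<phi> y - \<phi> x)"
    using translation_lipschitz unfolding \<phi>_def by blast
  have tr: "emeasure M ((\<lambda>h. g \<otimes> h) ` W) = ennreal w" "(\<lambda>h. g \<otimes> h) ` W \<in> sets M" for g
  proof -
    have "W \<in> sets borel" using cW by (simp add: borel_compact)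
    then show "emeasure M ((\<lambda>h. g \<otimes> h) ` W) = ennreal w"
      using haar w(1) by (simp add: left_haar_measure_def)
    have "compact ((\<lambda>h. g \<otimes> h) ` W)"
      by (rule compact_continuous_image[OF continuous_on_subset[OF continuous_left_mult] cW]) simp
    then show "(\<lambda>h. g \<otimes> h) ` W \<in> sets M" by (simp add: sets_haar borel_compact)
  qed
  \<comment> \<open>The number of grid points is at most
    \<open>(2 * (R / s + 1) + 1) ^ DIM('a)\<close>, and \<open>R / s\<close> equals
    \<open>d * C1 * R * (1 + R) ^ k1\<close> for the side \<open>s\<close> chosen below.\<close>
  define C where "C = (2 * d * C1 + 3) ^ DIM('a) * w"
  define k where "k = (k1 + 1) * DIM('a)"
  have "emeasure M {g. norm (\<phi> g) \<le> R} \<le> ennreal (C * (1 + R) ^ k)" if R: "0 \<le> R" for R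
  proof -
    define L where "L = C1 * (1 + R) ^ k1"
    have L: "1 \<le> L" unfolding L_def using C1(1) R mult_mono[of 1 C1 1 "(1 + R) ^ k1"] one_le_power[of "1 + R" k1] by simp
    \<comment> \<open>The side is such that \<open>d * s = 1 / L\<close>: a point of the ball
      differs by at most \<open>1 / L\<close> from some grid point, and \<open>L\<close> is the
      Lipschitz constant, so translating that grid point to the identity moves the point into
      \<open>W\<close>.\<close>
    define s where "s = 1 / (d * L)"
    have s: "0 < s" "d * s = 1 / L" using d L by (simp_all add: s_def)
    obtain P where P: "finite P" "P \<subseteq> cball (0::'a) R" "real (card P) \<le> (2 * (R / s + 1) + 1) ^ DIM('a)"
      "\<forall>x\<in>cball 0 R. \<exists>\<xi>\<in>P. norm (x - \<xi>) \<le> d * s"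
      using cball_cover[OF R s(1), where 'a='a] unfolding d_def by blast
    have "{g. norm (\<phi> g) \<le> R} \<subseteq> (\<Union>\<xi>\<in>P. (\<lambda>h. \<psi> \<xi> \<otimes> h) ` W)"
    proof
      fix g assume "g \<in> {g. norm (\<phi> g) \<le> R}"
      then have g: "norm (\<phi> g) \<le> R" by simp
      then have "\<phi> g \<in> cball 0 R" by simp
      then obtain \<xi> where \<xi>: "\<xi> \<in> P" "norm (\<phi> g - \<xi>) \<le> 1 / L"
        using P(4) unfolding s(2) by blast
      have \<xi>R: "norm (\<phi> (\<psi> \<xi>)) \<le> R" using P(2) \<xi>(1) by (auto simp: \<phi>\<psi>)
      have "norm (\<phi> (inv (\<psi> \<xi>) \<otimes> g) - \<phi> \<one>) \<le> L * norm (\<phi> g - \<phi> (\<psi> \<xi>))"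
        using C1(2) R \<xi>R g unfolding L_def by blast
      also have "\<dots> \<le> L * (1 / L)" using \<xi>(2) L by (intro mult_left_mono) (auto simp: \<phi>\<psi>)
      finally have "\<phi> (inv (\<psi> \<xi>) \<otimes> g) \<in> cball (\<phi> \<one>) 1" using L by (simp add: dist_norm norm_minus_commute)
      then have "\<psi> (\<phi> (inv (\<psi> \<xi>) \<otimes> g)) \<in> W" unfolding W_def by (rule imageI)
      then have "inv (\<psi> \<xi>) \<otimes> g \<in> W" by (simp add: \<psi>\<phi>)
      moreover have "\<psi> \<xi> \<otimes> (inv (\<psi> \<xi>) \<otimes> g) = g" by (simp add: m_assoc[symmetric])
      ultimately show "g \<in> (\<Union>\<xi>\<in>P. (\<lambda>h. \<psi> \<xi> \<otimes> h) ` W)" using \<xi>(1) by force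
    qed
    then have "emeasure M {g. norm (\<phi> g) \<le> R} \<le> emeasure M (\<Union>\<xi>\<in>P. (\<lambda>h. \<psi> \<xi> \<otimes> h) ` W)"
      by (rule emeasure_mono) (use P(1) tr(2) in auto)
    also have "\<dots> \<le> (\<Sum>\<xi>\<in>P. emeasure M ((\<lambda>h. \<psi> \<xi> \<otimes> h) ` W))"
      by (rule emeasure_subadditive_finite) (use P(1) tr(2) in auto)
    also have "\<dots> = ennreal (real (card P) * w)"
      using w(2) by (simp add: tr(1) ennreal_mult ennreal_of_nat_eq_real_of_nat)
    also have "\<dots> \<le> ennreal (C * (1 + R) ^ k)"
    proof (rule ennreal_leI)
      have "2 * (R / s + 1) + 1 = 2 * d * C1 * (R * (1 + R) ^ k1) + 3" by (simp add: s_def L_def)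
      also have "\<dots> \<le> 2 * d * C1 * (1 + R) ^ (k1 + 1) + 3 * (1 + R) ^ (k1 + 1)"
      proof (rule add_mono)
        show "2 * d * C1 * (R * (1 + R) ^ k1) \<le> 2 * d * C1 * (1 + R) ^ (k1 + 1)"
          using d C1(1) R by (intro mult_left_mono) (auto intro!: mult_right_mono)
        show "3 \<le> 3 * (1 + R) ^ (k1 + 1)" using R one_le_power[of "1 + R" "k1 + 1"] by simp
      qed
      also have "\<dots> = (2 * d * C1 + 3) * (1 + R) ^ (k1 + 1)" by (simp only: distrib_right)
      finally have "(2 * (R / s + 1) + 1) ^ DIM('a) \<le> ((2 * d * C1 + 3) * (1 + R) ^ (k1 + 1)) ^ DIM('a)"
        using R s(1) by (intro power_mono) auto
      also have "\<dots> = (2 * d * C1 + 3) ^ DIM('a) * (1 + R) ^ k"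
        unfolding power_mult_distrib k_def power_mult[symmetric] ..
      finally have "real (card P) \<le> (2 * d * C1 + 3) ^ DIM('a) * (1 + R) ^ k" using P(3) by linarith
      then have "real (card P) * w \<le> (2 * d * C1 + 3) ^ DIM('a) * (1 + R) ^ k * w" using w(2) by (rule mult_right_mono)
      then show "real (card P) * w \<le> C * (1 + R) ^ k" by (simp add: C_def mult_ac)
    qed
    finally show ?thesis .
  qed
  moreover have "0 \<le> C" using w(2) d C1(1) by (simp add: C_def)
  ultimately show ?thesis unfolding \<phi>_def by blast
qed

text \<open>With volume growth of degree \<open>k\<close> the exponent \<open>k + 2\<close>
  suffices. The integrand is dominated by a series of indicators of balls of radius
  \<open>n + 1\<close> with weights \<open>(n + 1) ^ - (k + 2)\<close>, whose integrals are at most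
  a multiple of \<open>(n + 1) ^ - 2\<close>.\<close>

theorem integrable_decay:
  "\<exists>K. (\<integral>\<^sup>+g. ennreal (inverse ((1 + norm (moment G S g)) ^ K)) \<partial>M) < \<infinity>"
proof -
  obtain C k where C: "0 \<le> C" "\<forall>R\<ge>0. emeasure M {g. norm (moment G S g) \<le> R} \<le> ennreal (C * (1 + R) ^ k)"
    using volume_growth by blast
  define B where "B = (\<lambda>n. {g. norm (moment G S g) \<le> real (Suc n)})"
  have B: "B n \<in> sets M" for n
  proof -
    have "closed (B n)" unfolding B_def
      by (intro closed_Collect_le continuous_intros continuous_moment)
    then show ?thesis by (simp add: sets_haar)
  qed
  define a where "a = (\<lambda>n. inverse (real (Suc n) ^ (k + 2)))"
  have le: "ennreal (inverse ((1 + norm (moment G S g)) ^ (k + 2))) \<le> suminf (\<lambda>n. ennreal (a n) * indicator (B n) g)" for g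
  proof -
    \<comment> \<open>With the integer part of the norm, \<open>g\<close> lies in the ball of radius
      \<open>n + 1\<close>, and \<open>1 + norm\<close> is still at least
      \<open>n + 1\<close>.\<close>
    define n where "n = nat \<lfloor>norm (moment G S g)\<rfloor>"
    have n: "real n \<le> norm (moment G S g)" "norm (moment G S g) \<le> real (Suc n)"
      unfolding n_def by (auto simp: of_nat_nat) linarith
    have "inverse ((1 + norm (moment G S g)) ^ (k + 2)) \<le> a n"
      unfolding a_def using n(1) by (intro le_imp_inverse_le power_mono) auto
    then have "ennreal (inverse ((1 + norm (moment G S g)) ^ (k + 2))) \<le> ennreal (a n) * indicator (B n) g"
      using n(2) by (simp add: B_def ennreal_leI)
    also have "\<dots> \<le> suminf (\<lambda>n. ennreal (a n) * indicator (B n) g)"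
    proof -
      define t where "t = (\<lambda>n. ennreal (a n) * indicator (B n) g)"
      have "sum t {n} \<le> suminf t" by (rule sum_le_suminf) auto
      moreover have "sum t {n} = t n" by simp
      ultimately have "t n \<le> suminf t" by (simp only:)
      then show ?thesis unfolding t_def .
    qed
    finally show ?thesis .
  qed
  have "(\<integral>\<^sup>+g. ennreal (inverse ((1 + norm (moment G S g)) ^ (k + 2))) \<partial>M)
      \<le> (\<integral>\<^sup>+g. suminf (\<lambda>n. ennreal (a n) * indicator (B n) g) \<partial>M)"
    by (rule nn_integral_mono) (rule le)
  also have "\<dots> = suminf (\<lambda>n. \<integral>\<^sup>+g. ennreal (a n) * indicator (B n) g \<partial>M)"
    by (rule nn_integral_suminf) (use B in auto)
  also have "\<dots> = suminf (\<lambda>n. ennreal (a n) * emeasure M (B n))"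
    using B by (simp add: nn_integral_cmult_indicator)
  also have "\<dots> \<le> suminf (\<lambda>n. ennreal (C * 2 ^ k * inverse (real (Suc n) ^ 2)))"
  proof (rule suminf_le)
    fix n
    have "emeasure M (B n) \<le> ennreal (C * (1 + real (Suc n)) ^ k)" 
      unfolding B_def by (rule C(2)[rule_format]) simp
    also have "\<dots> \<le> ennreal (C * (2 * real (Suc n)) ^ k)"
      using C(1) by (intro ennreal_leI mult_left_mono power_mono) auto
    finally have "ennreal (a n) * emeasure M (B n) \<le> ennreal (a n) * ennreal (C * (2 * real (Suc n)) ^ k)"
      by (rule mult_left_mono) simp
    also have "\<dots> = ennreal (a n * (C * (2 * real (Suc n)) ^ k))"
      using C(1) by (intro ennreal_mult[symmetric]) (auto simp: a_def)
    also have "a n * (C * (2 * real (Suc n)) ^ k) = C * 2 ^ k * inverse (real (Suc n) ^ 2)"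
    proof -
      have "inverse (x ^ (k + 2)) * (C * (2 * x) ^ k) = C * 2 ^ k * inverse (x ^ 2)" if "0 < x" for x :: real
        using that by (simp add: power_add power_mult_distrib field_simps power2_eq_square)
      then show ?thesis unfolding a_def by (simp only: of_nat_0_less_iff zero_less_Suc)
    qed
    finally show "ennreal (a n) * emeasure M (B n) \<le> ennreal (C * 2 ^ k * inverse (real (Suc n) ^ 2))" .
  qed auto
  also have "\<dots> < \<infinity>"
  proof -
    have "summable (\<lambda>n. C * 2 ^ k * inverse (real (Suc n) ^ 2))"
      using inverse_power_summable[of 2, where 'a=real] summable_Suc_iff[of "\<lambda>n. inverse (real n ^ 2)"]
      by (intro summable_mult) blast
    then have "suminf (\<lambda>n. ennreal (C * 2 ^ k * inverse (real (Suc n) ^ 2)))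
        = ennreal (suminf (\<lambda>n. C * 2 ^ k * inverse (real (Suc n) ^ 2)))"
      using C(1) by (intro suminf_ennreal2) auto
    then show ?thesis by simp
  qed
  finally show ?thesis by blast
qed

end

end

end

section \<open>Coordinates adapted to the decomposition\<close>

lemma direct_sum_projections:
  assumes "direct_sum_decomp N V"
  shows "\<exists>\<pi>. (\<forall>n. linear (\<pi> n)) \<and> (\<forall>n\<le>N. \<forall>x. \<pi> n x \<in> V n) \<and> (\<forall>x. x = (\<Sum>n\<le>N. \<pi> n x)) \<and>
     (\<forall>n. \<forall>m\<le>N. \<forall>x\<in>V m. \<pi> n x = (if n = m then x else 0))"
proof -
  define dec where "dec = (\<lambda>x v. (\<forall>n\<le>N. v n \<in> V n) \<and> (\<forall>n>N. v n = 0) \<and> x = (\<Sum>n\<le>N. v n))"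
  have sub: "subspace (V n)" if "n \<le> N" for n using assms that by (simp add: direct_sum_decomp_def)
  have ex1: "\<exists>!v. dec x v" for x using assms unfolding direct_sum_decomp_def dec_def by (elim conjE) (erule spec)
  define c where "c = (\<lambda>x. THE v. dec x v)"
  have dec: "dec x (c x)" for x unfolding c_def by (rule theI'[OF ex1])
  have uniq: "c x = v" if "dec x v" for x v using ex1[of x] dec[of x] that by auto
  have "linear (\<lambda>x. c x n)" for n
  proof (rule linearI)
    show "c (x + y) n = c x n + c y n" for x y
    proof -
      have "dec (x + y) (\<lambda>n. c x n + c y n)"
        using dec[of x] dec[of y] sub by (auto simp: dec_def sum.distrib subspace_add)
      from uniq[OF this] show ?thesis by simp
    qed
    show "c (r *\<^sub>R x) n = r *\<^sub>R c x n" for r x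
    proof -
      have "dec (r *\<^sub>R x) (\<lambda>n. r *\<^sub>R c x n)"
        using dec[of x] sub unfolding dec_def by (auto simp: scaleR_sum_right[symmetric] subspace_scale)
      from uniq[OF this] show ?thesis by simp
    qed
  qed
  moreover have "c x n \<in> V n" if "n \<le> N" for x n using dec[of x] that by (simp add: dec_def)
  moreover have "x = (\<Sum>n\<le>N. c x n)" for x using dec[of x] by (simp add: dec_def)
  moreover have "c x n = (if n = m then x else 0)" if "m \<le> N" "x \<in> V m" for n m x
  proof -
    have "dec x (\<lambda>n. if n = m then x else 0)"
      using that sub by (auto simp: dec_def subspace_0)
    from uniq[OF this] show ?thesis by simp
  qed
  ultimately show ?thesis by (intro exI[of _ "\<lambda>n x. c x n"]) simp
qed

text \<open>Applied with a basis of V_n, this controls a functional on V_n by the Euclidean norm of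
  the coordinates x_n.\<close>

lemma inner_span_le_L2_set:
  fixes es :: "'a::real_inner list"
  assumes "v \<in> span (set es)"
  shows "\<exists>c\<ge>0. \<forall>\<xi>. \<bar>\<xi> \<bullet> v\<bar> \<le> c * L2_set (\<lambda>j. \<xi> \<bullet> (es ! j)) {..<length es}"
proof (rule span_induct[OF assms])
  let ?Y = "\<lambda>\<xi>. L2_set (\<lambda>j. \<xi> \<bullet> (es ! j)) {..<length es}"
  show "subspace {v. \<exists>c\<ge>0. \<forall>\<xi>. \<bar>\<xi> \<bullet> v\<bar> \<le> c * ?Y \<xi>}"
    unfolding subspace_def
  proof (intro conjI ballI allI)
    show "0 \<in> {v. \<exists>c\<ge>0. \<forall>\<xi>. \<bar>\<xi> \<bullet> v\<bar> \<le> c * ?Y \<xi>}" by (auto intro: exI[of _ 0])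
    fix x y assume "x \<in> {v. \<exists>c\<ge>0. \<forall>\<xi>. \<bar>\<xi> \<bullet> v\<bar> \<le> c * ?Y \<xi>}" "y \<in> {v. \<exists>c\<ge>0. \<forall>\<xi>. \<bar>\<xi> \<bullet> v\<bar> \<le> c * ?Y \<xi>}"
    then obtain c d where c: "0 \<le> c" "\<forall>\<xi>. \<bar>\<xi> \<bullet> x\<bar> \<le> c * ?Y \<xi>" and d: "0 \<le> d" "\<forall>\<xi>. \<bar>\<xi> \<bullet> y\<bar> \<le> d * ?Y \<xi>"
      by auto
    have "\<bar>\<xi> \<bullet> (x + y)\<bar> \<le> (c + d) * ?Y \<xi>" for \<xi>
      using c(2)[rule_format, of \<xi>] d(2)[rule_format, of \<xi>] abs_triangle_ineq[of "\<xi> \<bullet> x" "\<xi> \<bullet> y"]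
      by (simp add: inner_add_right distrib_right)
    then show "x + y \<in> {v. \<exists>c\<ge>0. \<forall>\<xi>. \<bar>\<xi> \<bullet> v\<bar> \<le> c * ?Y \<xi>}" using c(1) d(1) by (auto intro!: exI[of _ "c + d"])
  next
    fix r x assume "x \<in> {v. \<exists>c\<ge>0. \<forall>\<xi>. \<bar>\<xi> \<bullet> v\<bar> \<le> c * ?Y \<xi>}"
    then obtain c where c: "0 \<le> c" "\<forall>\<xi>. \<bar>\<xi> \<bullet> x\<bar> \<le> c * ?Y \<xi>" by auto
    have "\<bar>\<xi> \<bullet> (r *\<^sub>R x)\<bar> \<le> (\<bar>r\<bar> * c) * ?Y \<xi>" for \<xi>
      using mult_left_mono[OF c(2)[rule_format, of \<xi>], of "\<bar>r\<bar>"] by (simp add: abs_mult mult.assoc)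
    then show "r *\<^sub>R x \<in> {v. \<exists>c\<ge>0. \<forall>\<xi>. \<bar>\<xi> \<bullet> v\<bar> \<le> c * ?Y \<xi>}" using c(1) by (auto intro!: exI[of _ "\<bar>r\<bar> * c"])
  qed
  fix x assume "x \<in> set es"
  then obtain j where j: "j < length es" "x = es ! j" by (auto simp: in_set_conv_nth)
  have "\<bar>\<xi> \<bullet> x\<bar> \<le> ?Y \<xi>" for \<xi>
    using member_le_L2_set[of "{..<length es}" j "\<lambda>j. \<bar>\<xi> \<bullet> (es ! j)\<bar>"] j by (simp add: L2_set_def)
  then show "\<exists>c\<ge>0. \<forall>\<xi>. \<bar>\<xi> \<bullet> x\<bar> \<le> c * ?Y \<xi>" by (intro exI[of _ 1]) simp
qed

text \<open>The blocks outside \<open>A\<close> can be set to zero without changing those in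
  \<open>A\<close>, and the result is controlled by the latter alone. For the full index set nothing
  changes.\<close>

lemma restrict_coords:
  fixes V :: "nat \<Rightarrow> 'a::euclidean_space set"
  assumes V: "direct_sum_decomp N V" and e: "\<forall>n\<le>N. basis_of (e n) (V n)"
  shows "\<exists>K\<ge>0. \<forall>A\<subseteq>{..N}. \<forall>\<xi>. \<exists>\<eta>. (\<forall>m\<in>A. \<forall>i<length (e m). \<eta> \<bullet> (e m ! i) = \<xi> \<bullet> (e m ! i)) \<and>
     norm \<eta> \<le> K * (\<Sum>m\<in>A. L2_set (\<lambda>i. \<xi> \<bullet> (e m ! i)) {..<length (e m)}) \<and> (A = {..N} \<longrightarrow> \<eta> = \<xi>)"
proof -
  obtain \<pi> where \<pi>: "\<forall>n. linear (\<pi> n)" "\<forall>n\<le>N. \<forall>x. \<pi> n x \<in> V n" "\<forall>x. x = (\<Sum>n\<le>N. \<pi> n x)"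
     "\<forall>n. \<forall>m\<le>N. \<forall>x\<in>V m. \<pi> n x = (if n = m then x else 0)"
    using direct_sum_projections[OF V] by (elim exE conjE)
  let ?Y = "\<lambda>m \<xi>. L2_set (\<lambda>i. \<xi> \<bullet> (e m ! i)) {..<length (e m)}"
  have "\<forall>m\<in>{..N}. \<forall>b\<in>Basis. \<exists>c\<ge>0. \<forall>\<xi>. \<bar>\<xi> \<bullet> \<pi> m b\<bar> \<le> c * ?Y m \<xi>"
    using \<pi>(2) e by (intro ballI inner_span_le_L2_set) (auto simp: basis_of_def)
  then have "\<forall>z\<in>{..N} \<times> Basis. \<exists>c\<ge>0. \<forall>\<xi>. \<bar>\<xi> \<bullet> \<pi> (fst z) (snd z)\<bar> \<le> c * ?Y (fst z) \<xi>" by auto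
  from bchoice[OF this] obtain c where c: "\<forall>z\<in>{..N} \<times> Basis. 0 \<le> c z \<and> (\<forall>\<xi>. \<bar>\<xi> \<bullet> \<pi> (fst z) (snd z)\<bar> \<le> c z * ?Y (fst z) \<xi>)"
    by (elim exE)
  define k where "k = (\<Sum>z\<in>{..N} \<times> (Basis :: 'a set). c z)"
  have k0: "0 \<le> k" unfolding k_def by (rule sum_nonneg) (use c in auto)
  have k: "\<bar>\<xi> \<bullet> \<pi> m b\<bar> \<le> k * ?Y m \<xi>" if "m \<le> N" "b \<in> Basis" for m b \<xi>
  proof -
    have z: "(m, b) \<in> {..N} \<times> Basis" using that by simp
    have "c (m, b) \<le> k" unfolding k_def by (rule member_le_sum[OF z]) (use c in auto)
    moreover have "\<bar>\<xi> \<bullet> \<pi> m b\<bar> \<le> c (m, b) * ?Y m \<xi>" using c z by force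
    ultimately show ?thesis using mult_right_mono[of "c (m, b)" k "?Y m \<xi>"] L2_set_nonneg by (meson order_trans)
  qed
  \<comment> \<open>The vector representing the functional that is \<xi> on the summands V_m with
    \<open>m \<in> A\<close> and zero on the others, assembled from the projections.\<close>
  define ext where "ext = (\<lambda>A \<xi>. \<Sum>b\<in>Basis. (\<Sum>m\<in>A. \<xi> \<bullet> \<pi> m b) *\<^sub>R (b :: 'a))"
  have inner: "ext A \<xi> \<bullet> x = (\<Sum>m\<in>A. \<xi> \<bullet> \<pi> m x)" for A \<xi> x
  proof -
    have \<pi>x: "\<pi> m x = (\<Sum>b\<in>Basis. (x \<bullet> b) *\<^sub>R \<pi> m b)" for m
    proof -
      have "\<pi> m x = \<pi> m (\<Sum>b\<in>Basis. (x \<bullet> b) *\<^sub>R b)" by (simp add: euclidean_representation)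
      also have "\<dots> = (\<Sum>b\<in>Basis. (x \<bullet> b) *\<^sub>R \<pi> m b)"
        using \<pi>(1) by (simp add: linear_sum linear_scale)
      finally show ?thesis .
    qed
    have "ext A \<xi> \<bullet> x = (\<Sum>b\<in>Basis. \<Sum>m\<in>A. (\<xi> \<bullet> \<pi> m b) * (x \<bullet> b))"
      by (simp add: ext_def inner_sum_right sum_distrib_right inner_commute[of _ x])
    also have "\<dots> = (\<Sum>m\<in>A. \<Sum>b\<in>Basis. (\<xi> \<bullet> \<pi> m b) * (x \<bullet> b))" by (rule sum.swap)
    also have "\<dots> = (\<Sum>m\<in>A. \<xi> \<bullet> \<pi> m x)"
      by (rule sum.cong[OF refl], subst \<pi>x) (simp add: inner_sum_right mult.commute)
    finally show ?thesis .
  qed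
  have "\<exists>\<eta>. (\<forall>m\<in>A. \<forall>i<length (e m). \<eta> \<bullet> (e m ! i) = \<xi> \<bullet> (e m ! i)) \<and>
     norm \<eta> \<le> (real DIM('a) * k) * (\<Sum>m\<in>A. ?Y m \<xi>) \<and> (A = {..N} \<longrightarrow> \<eta> = \<xi>)" if A: "A \<subseteq> {..N}" for A \<xi>
  proof (intro exI[of _ "ext A \<xi>"] conjI ballI allI impI)
    have finA: "finite A" using A finite_subset by blast
    fix m i assume m: "m \<in> A" "i < length (e m)"
    then have mN: "m \<le> N" using A by auto
    have "V m = span (set (e m))" using e mN by (simp add: basis_of_def)
    then have "e m ! i \<in> V m" using span_base nth_mem[OF m(2)] by metis
    then have "\<xi> \<bullet> \<pi> n (e m ! i) = (if n = m then \<xi> \<bullet> (e m ! i) else 0)" for n using \<pi>(4) mN by simp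
    then show "ext A \<xi> \<bullet> (e m ! i) = \<xi> \<bullet> (e m ! i)" unfolding inner using finA m(1) by simp
  next
    have "norm (ext A \<xi>) \<le> (\<Sum>b\<in>Basis. \<bar>ext A \<xi> \<bullet> b\<bar>)" by (rule norm_le_l1)
    also have "\<dots> \<le> (\<Sum>b\<in>(Basis :: 'a set). k * (\<Sum>m\<in>A. ?Y m \<xi>))"
    proof (rule sum_mono)
      fix b :: 'a assume b: "b \<in> Basis"
      have "\<bar>ext A \<xi> \<bullet> b\<bar> \<le> (\<Sum>m\<in>A. \<bar>\<xi> \<bullet> \<pi> m b\<bar>)" unfolding inner by (rule sum_abs)
      also have "\<dots> \<le> (\<Sum>m\<in>A. k * ?Y m \<xi>)" by (rule sum_mono, rule k[OF _ b]) (use A in auto)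
      finally show "\<bar>ext A \<xi> \<bullet> b\<bar> \<le> k * (\<Sum>m\<in>A. ?Y m \<xi>)" by (simp add: sum_distrib_left)
    qed
    finally show "norm (ext A \<xi>) \<le> (real DIM('a) * k) * (\<Sum>m\<in>A. ?Y m \<xi>)" by simp
  next
    assume A: "A = {..N}"
    show "ext A \<xi> = \<xi>"
    proof (rule euclidean_eqI)
      fix b :: 'a
      have "(\<Sum>m\<in>A. \<xi> \<bullet> \<pi> m b) = \<xi> \<bullet> (\<Sum>m\<le>N. \<pi> m b)" unfolding A by (rule inner_sum_right[symmetric])
      also have "\<dots> = \<xi> \<bullet> b" using \<pi>(3) by metis
      finally show "ext A \<xi> \<bullet> b = \<xi> \<bullet> b" unfolding inner .
    qed
  qed
  then show ?thesis using k0 by (intro exI[of _ "real DIM('a) * k"]) simp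
qed

text \<open>Expanding the product of the \<open>1 + y i\<close> gives the bound. The product is
  written as an exponential because all later growth estimates are linear in the logarithms.\<close>

lemma sum_le_prod_add_one:
  fixes y :: "'i \<Rightarrow> real"
  assumes "finite A" "\<And>i. i \<in> A \<Longrightarrow> 0 \<le> y i"
  shows "1 + sum y A \<le> exp (\<Sum>i\<in>A. ln (1 + y i))"
  using assms
proof (induction A rule: finite_induct)
  case (insert i A)
  have y: "0 \<le> y i" "0 \<le> sum y A" using insert.prems by (auto intro: sum_nonneg)
  have "1 + sum y (insert i A) \<le> (1 + y i) * (1 + sum y A)"
    using insert.hyps y mult_nonneg_nonneg[OF y] by (simp add: algebra_simps)
  also have "\<dots> \<le> (1 + y i) * exp (\<Sum>i\<in>A. ln (1 + y i))"
    using insert y by (intro mult_left_mono) auto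
  also have "\<dots> = exp (\<Sum>i\<in>insert i A. ln (1 + y i))" using insert.hyps y by (simp add: exp_add)
  finally show ?case .
qed simp

context lie_group
begin

context
  fixes S :: "'g \<Rightarrow> real" and N :: nat and V :: "nat \<Rightarrow> 'a set" and e :: "nat \<Rightarrow> 'a list"
  assumes temp: "tempered_pair G S" and V: "direct_sum_decomp N V" and e: "\<forall>n\<le>N. basis_of (e n) (V n)"
begin

lemma moment_inner: "moment G S g \<bullet> X = lder G X S g"
proof -
  have l: "linear (\<lambda>X. lder G X S g)"
    by (rule linear_lder[OF seminorm_space_normed smooth_phase[OF temp]])
  have "lder G X S g = lder G (\<Sum>b\<in>Basis. (X \<bullet> b) *\<^sub>R b) S g" by (simp add: euclidean_representation)
  also have "\<dots> = (\<Sum>b\<in>Basis. (X \<bullet> b) * lder G b S g)"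
    using linear_sum[OF l, of "\<lambda>b. (X \<bullet> b) *\<^sub>R b" Basis] linear_scale[OF l] by simp
  finally show ?thesis by (simp add: moment_def inner_sum_right inner_commute[of _ X] mult.commute)
qed

lemma coord_moment: "coord G S e n i g = moment G S g \<bullet> (e n ! i)"
  by (simp add: coord_def moment_inner)

lemma coord_norm_moment:
  "coord_norm G S e n g = L2_set (\<lambda>i. moment G S g \<bullet> (e n ! i)) {..<length (e n)}"
  by (simp add: coord_norm_def coord_moment)

lemma coord_norm_nonneg: "0 \<le> coord_norm G S e n g"
  by (simp add: coord_norm_def L2_set_nonneg)

abbreviation "log_coord n g \<equiv> ln (1 + coord_norm G S e n g)"

lemma restrict_point:
  "\<exists>K\<ge>0. \<forall>A\<subseteq>{..N}. \<forall>g. \<exists>h. (\<forall>m\<in>A. \<forall>i<length (e m). coord G S e m i h = coord G S e m i g) \<and>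
     1 + norm (moment G S h) \<le> (1 + K) * exp (\<Sum>m\<in>A. log_coord m g) \<and> (A = {..N} \<longrightarrow> h = g)"
proof -
  let ?\<phi> = "moment G S" and ?\<psi> = "inv_into UNIV (moment G S)"
  obtain K where K: "0 \<le> K" "\<forall>A\<subseteq>{..N}. \<forall>\<xi>. \<exists>\<eta>. (\<forall>m\<in>A. \<forall>i<length (e m). \<eta> \<bullet> (e m ! i) = \<xi> \<bullet> (e m ! i)) \<and>
     norm \<eta> \<le> K * (\<Sum>m\<in>A. L2_set (\<lambda>i. \<xi> \<bullet> (e m ! i)) {..<length (e m)}) \<and> (A = {..N} \<longrightarrow> \<eta> = \<xi>)"
    using restrict_coords[OF V e] by (elim exE conjE)
  have "\<exists>h. (\<forall>m\<in>A. \<forall>i<length (e m). coord G S e m i h = coord G S e m i g) \<and>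
     1 + norm (?\<phi> h) \<le> (1 + K) * exp (\<Sum>m\<in>A. log_coord m g) \<and> (A = {..N} \<longrightarrow> h = g)" if A: "A \<subseteq> {..N}" for A g
  proof -
    obtain \<eta> where \<eta>: "\<forall>m\<in>A. \<forall>i<length (e m). \<eta> \<bullet> (e m ! i) = ?\<phi> g \<bullet> (e m ! i)"
     "norm \<eta> \<le> K * (\<Sum>m\<in>A. coord_norm G S e m g)" "A = {..N} \<longrightarrow> \<eta> = ?\<phi> g"
      using K(2)[rule_format, OF A, of "?\<phi> g"] unfolding coord_norm_moment by (elim exE conjE)
    have finA: "finite A" using A finite_subset by blast
    have h: "?\<phi> (?\<psi> \<eta>) = \<eta>" by (rule moment_inv[OF temp])
    have s0: "0 \<le> (\<Sum>m\<in>A. coord_norm G S e m g)" by (intro sum_nonneg coord_norm_nonneg)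
    have "1 + norm \<eta> \<le> (1 + K) * (1 + (\<Sum>m\<in>A. coord_norm G S e m g))"
      using \<eta>(2) K(1) s0 by (simp add: algebra_simps)
    also have "\<dots> \<le> (1 + K) * exp (\<Sum>m\<in>A. log_coord m g)"
      using K(1) by (intro mult_left_mono sum_le_prod_add_one finA coord_norm_nonneg) auto
    finally show ?thesis
      using \<eta>(1,3) by (intro exI[of _ "?\<psi> \<eta>"]) (simp add: coord_moment h inv_moment[OF temp])
  qed
  then show ?thesis using K(1) by (intro exI[of _ K]) simp
qed

text \<open>A function that sees the coordinates in \<open>A\<close> alone has at \<open>g\<close>
  the same value as at the point with the other coordinates removed, whose moment is bounded by the
  coordinates in \<open>A\<close>; polynomial growth at that point is the claim. For
  \<open>A = {..N}\<close> that point is \<open>g\<close>, so no dependence condition is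
  imposed.\<close>

lemma tempered_fun_bound:
  assumes f: "tempered_fun G S f" and A: "A \<subseteq> {..N}"
    and dep: "A = {..N} \<or> (\<forall>g h. (\<forall>m\<in>A. \<forall>i<length (e m). coord G S e m i h = coord G S e m i g) \<longrightarrow> f h = f g)"
  shows "\<exists>C\<ge>0. \<exists>q::nat. \<forall>g. \<bar>f g\<bar> \<le> C * exp (real q * (\<Sum>m\<in>A. log_coord m g))"
proof -
  obtain K where K: "0 \<le> K" "\<forall>A\<subseteq>{..N}. \<forall>g. \<exists>h. (\<forall>m\<in>A. \<forall>i<length (e m). coord G S e m i h = coord G S e m i g) \<and>
     1 + norm (moment G S h) \<le> (1 + K) * exp (\<Sum>m\<in>A. log_coord m g) \<and> (A = {..N} \<longrightarrow> h = g)"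
    using restrict_point by (elim exE conjE)
  obtain C q where C: "0 \<le> C" "\<forall>x. norm ((f \<circ> inv_into UNIV (moment G S)) x) \<le> C * (1 + norm x) ^ q"
    using tempered_map_bound[OF f[unfolded tempered_fun_def]] by (elim exE conjE)
  have "\<bar>f g\<bar> \<le> (C * (1 + K) ^ q) * exp (real q * (\<Sum>m\<in>A. log_coord m g))" for g
  proof -
    obtain h where h: "\<forall>m\<in>A. \<forall>i<length (e m). coord G S e m i h = coord G S e m i g"
     "1 + norm (moment G S h) \<le> (1 + K) * exp (\<Sum>m\<in>A. log_coord m g)" "A = {..N} \<longrightarrow> h = g"
      using K(2)[rule_format, OF A, of g] by (elim exE conjE)
    have "f h = f g"
    proof (cases "A = {..N}")
      case True
      then show ?thesis using h(3) by simp
    next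
      case False
      then show ?thesis using dep h(1) by blast
    qed
    then have "\<bar>f g\<bar> \<le> C * (1 + norm (moment G S h)) ^ q"
      using C(2)[rule_format, of "moment G S h"] by (simp add: inv_moment[OF temp])
    also have "\<dots> \<le> C * ((1 + K) * exp (\<Sum>m\<in>A. log_coord m g)) ^ q"
      using C(1) h(2) by (intro mult_left_mono power_mono) auto
    also have "\<dots> = (C * (1 + K) ^ q) * exp (real q * (\<Sum>m\<in>A. log_coord m g))"
      by (simp add: power_mult_distrib exp_of_nat_mult)
    finally show ?thesis .
  qed
  then show ?thesis using C(1) K(1) by (intro exI[of _ "C * (1 + K) ^ q"]) auto
qed

lemma moment_bound: "\<exists>C\<ge>0. \<forall>g. 1 + norm (moment G S g) \<le> C * exp (\<Sum>m\<le>N. log_coord m g)"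
proof -
  obtain K where K: "0 \<le> K" "\<forall>A\<subseteq>{..N}. \<forall>g. \<exists>h. (\<forall>m\<in>A. \<forall>i<length (e m). coord G S e m i h = coord G S e m i g) \<and>
     1 + norm (moment G S h) \<le> (1 + K) * exp (\<Sum>m\<in>A. log_coord m g) \<and> (A = {..N} \<longrightarrow> h = g)"
    using restrict_point by (elim exE conjE)
  have "1 + norm (moment G S g) \<le> (1 + K) * exp (\<Sum>m\<le>N. log_coord m g)" for g
    using K(2)[rule_format, OF order_refl, of g] by (elim exE conjE) simp
  then show ?thesis using K(1) by (intro exI[of _ "1 + K"]) simp
qed

end

end

section \<open>Choice of the exponents\<close>

text \<open>Turns the lower bound of a multiplier into a multiple of
  \<open>(1 + y) powr \<rho>\<close>, which is exp (\<rho> z) for z = ln (1 + y).\<close>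

lemma one_add_powr_le:
  fixes y \<rho> :: real
  assumes "0 \<le> y" "0 < \<rho>"
  shows "(1 + y) powr \<rho> \<le> 2 powr \<rho> * (1 + y powr \<rho>)"
proof -
  have "(1 + y) powr \<rho> \<le> (2 * max 1 y) powr \<rho>" using assms by (intro powr_mono2) auto
  also have "\<dots> = 2 powr \<rho> * max 1 y powr \<rho>" using assms by (simp add: powr_mult)
  also have "\<dots> \<le> 2 powr \<rho> * (1 + y powr \<rho>)" by (intro mult_left_mono) (auto simp: max_def)
  finally show ?thesis .
qed

lemma ex_exponents:
  fixes \<rho> :: "nat \<Rightarrow> real" and b :: "nat \<Rightarrow> nat" and K q :: real
  assumes "\<And>n. n \<le> N \<Longrightarrow> 0 < \<rho> n"
  shows "\<exists>r :: nat \<Rightarrow> nat. \<forall>n\<le>N. K + q * (\<Sum>k<n. real (r k * (\<Sum>i=0..k. r i * b i))) \<le> \<rho> n * real (r n)"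
proof -
  have "\<exists>r :: nat \<Rightarrow> nat. \<forall>n<m. K + q * (\<Sum>k<n. real (r k * (\<Sum>i=0..k. r i * b i))) \<le> \<rho> n * real (r n)" if "m \<le> Suc N" for m
    using that
  proof (induction m)
    case (Suc m)
    then obtain r :: "nat \<Rightarrow> nat" where r: "\<forall>n<m. K + q * (\<Sum>k<n. real (r k * (\<Sum>i=0..k. r i * b i))) \<le> \<rho> n * real (r n)"
      by auto
    let ?c = "K + q * (\<Sum>k<m. real (r k * (\<Sum>i=0..k. r i * b i)))"
    obtain x :: nat where x: "?c / \<rho> m \<le> real x" using real_arch_simple by blast
    have \<rho>: "0 < \<rho> m" using assms Suc.prems by simp
    \<comment> \<open>The inequalities with index below \<open>m\<close>, as well as the left-hand
      side of the one for \<open>m\<close>, involve no \<open>r i\<close> with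
      \<open>i \<ge> m\<close>, so the update affects none of them.\<close>
    define r' where "r' = r(m := x)"
    have same: "(\<Sum>k<n. real (r' k * (\<Sum>i=0..k. r' i * b i))) = (\<Sum>k<n. real (r k * (\<Sum>i=0..k. r i * b i)))" if "n \<le> m" for n
    proof (rule sum.cong[OF refl])
      fix k assume "k \<in> {..<n}"
      then have k: "k < m" using that by simp
      have "(\<Sum>i=0..k. r' i * b i) = (\<Sum>i=0..k. r i * b i)" by (rule sum.cong) (use k in \<open>auto simp: r'_def\<close>)
      then show "real (r' k * (\<Sum>i=0..k. r' i * b i)) = real (r k * (\<Sum>i=0..k. r i * b i))" using k by (simp add: r'_def)
    qed
    have "K + q * (\<Sum>k<n. real (r' k * (\<Sum>i=0..k. r' i * b i))) \<le> \<rho> n * real (r' n)" if "n < Suc m" for n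
    proof (cases "n = m")
      case True
      have "?c \<le> \<rho> m * real x" using x \<rho> by (simp add: divide_le_eq mult.commute)
      then show ?thesis unfolding True same[OF order_refl] by (simp add: r'_def)
    next
      case False
      then have n: "n < m" using that by simp
      then have "r' n = r n" by (simp add: r'_def)
      then show ?thesis using r n same[of n] by simp
    qed
    then show ?case by blast
  qed simp
  from this[of "Suc N"] show ?thesis by (simp add: less_Suc_eq_le)
qed

text \<open>Factor \<open>k\<close> grows in the variables \<open>z m\<close> with
  \<open>m > k\<close>; regrouping by \<open>m\<close> collects what the exponent \<open>r m\<close>
  has to outweigh.\<close>

lemma sum_triangle_swap:
  fixes z :: "nat \<Rightarrow> real"
  shows "(\<Sum>k=0..N. c k * (\<Sum>m\<in>{k<..N}. z m)) = (\<Sum>m=0..N. z m * (\<Sum>k<m. c k))"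
proof -
  have "(\<Sum>k=0..N. c k * (\<Sum>m\<in>{k<..N}. z m)) = (\<Sum>k=0..N. \<Sum>m=0..N. if k < m then c k * z m else 0)"
  proof (rule sum.cong[OF refl])
    fix k
    have "(\<Sum>m\<in>{k<..N}. c k * z m) = (\<Sum>m=0..N. if k < m then c k * z m else 0)"
      by (rule sum.mono_neutral_cong_left) auto
    then show "c k * (\<Sum>m\<in>{k<..N}. z m) = (\<Sum>m=0..N. if k < m then c k * z m else 0)" by (simp add: sum_distrib_left)
  qed
  also have "\<dots> = (\<Sum>m=0..N. \<Sum>k=0..N. if k < m then c k * z m else 0)" by (rule sum.swap)
  also have "\<dots> = (\<Sum>m=0..N. z m * (\<Sum>k<m. c k))"
  proof (rule sum.cong[OF refl])
    fix m assume m: "m \<in> {0..N}"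
    have "(\<Sum>k<m. c k * z m) = (\<Sum>k=0..N. if k < m then c k * z m else 0)"
      by (rule sum.mono_neutral_cong_left) (use m in auto)
    then show "(\<Sum>k=0..N. if k < m then c k * z m else 0) = z m * (\<Sum>k<m. c k)"
      by (simp add: sum_distrib_left mult.commute)
  qed
  finally show ?thesis .
qed

text \<open>
  The exponents \<open>r\<close> are chosen in the order \<open>r 0, r 1, \<dots>\<close>: the growth in the variable \<open>z m\<close> that
  differentiation produces is determined by the \<open>r k\<close> with \<open>k < m\<close>.
\<close>

lemma weighted_product_decay:
  fixes a \<nu> z :: "nat \<Rightarrow> real" and r b :: "nat \<Rightarrow> nat" and \<rho> :: "nat \<Rightarrow> real"
  assumes D: "1 \<le> D" and z: "\<And>n. n \<le> N \<Longrightarrow> 0 \<le> z n"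
    and a: "\<And>n. n \<le> N \<Longrightarrow> 0 \<le> a n \<and> a n \<le> D * exp (- \<rho> n * z n)"
    and \<nu>: "\<And>n. n \<le> N \<Longrightarrow> 0 \<le> \<nu> n \<and> \<nu> n \<le> D * exp (q * (\<Sum>m\<in>{n<..N}. z m))"
    and w: "0 \<le> w" "w \<le> D * exp (q * (\<Sum>m=0..N. z m))"
    and r: "\<And>n. n \<le> N \<Longrightarrow> K + q + q * (\<Sum>k<n. real (r k * (\<Sum>i=0..k. r i * b i))) \<le> \<rho> n * real (r n)"
  shows "(\<Prod>k=0..N. a k ^ r k * \<nu> k ^ (r k * (\<Sum>i=0..k. r i * b i))) * w
    \<le> D ^ Suc (\<Sum>k=0..N. r k + r k * (\<Sum>i=0..k. r i * b i)) * exp (- K * (\<Sum>m=0..N. z m))"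
proof -
  define c where "c = (\<lambda>k. r k * (\<Sum>i=0..k. r i * b i))"
  have "(\<Prod>k=0..N. a k ^ r k * \<nu> k ^ c k)
      \<le> (\<Prod>k=0..N. D ^ (r k + c k) * exp (real (r k) * (- \<rho> k * z k) + real (c k) * (q * (\<Sum>m\<in>{k<..N}. z m))))"
  proof (rule prod_mono)
    fix k assume "k \<in> {0..N}"
    then have k: "k \<le> N" by simp
    have "a k ^ r k * \<nu> k ^ c k \<le> (D * exp (- \<rho> k * z k)) ^ r k * (D * exp (q * (\<Sum>m\<in>{k<..N}. z m))) ^ c k"
      using a[OF k] \<nu>[OF k] D by (intro mult_mono power_mono) auto
    also have "\<dots> = D ^ (r k + c k) * exp (real (r k) * (- \<rho> k * z k) + real (c k) * (q * (\<Sum>m\<in>{k<..N}. z m)))"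
      unfolding power_mult_distrib exp_of_nat_mult[symmetric] power_add exp_add by (simp add: mult_ac)
    finally show "0 \<le> a k ^ r k * \<nu> k ^ c k \<and> a k ^ r k * \<nu> k ^ c k
        \<le> D ^ (r k + c k) * exp (real (r k) * (- \<rho> k * z k) + real (c k) * (q * (\<Sum>m\<in>{k<..N}. z m)))"
      using a[OF k] \<nu>[OF k] by simp
  qed
  also have "\<dots> = D ^ (\<Sum>k=0..N. r k + c k) *
      exp (\<Sum>k=0..N. real (r k) * (- \<rho> k * z k) + real (c k) * (q * (\<Sum>m\<in>{k<..N}. z m)))"
    by (simp only: prod.distrib power_sum exp_sum[OF finite_atLeastAtMost])
  finally have 1: "(\<Prod>k=0..N. a k ^ r k * \<nu> k ^ c k) \<le> \<dots>" .
  have "(\<Prod>k=0..N. a k ^ r k * \<nu> k ^ c k) * w \<le> (D ^ (\<Sum>k=0..N. r k + c k) *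
      exp (\<Sum>k=0..N. real (r k) * (- \<rho> k * z k) + real (c k) * (q * (\<Sum>m\<in>{k<..N}. z m))))
      * (D * exp (q * (\<Sum>m=0..N. z m)))"
    using D w by (intro mult_mono[OF 1]) auto
  also have "\<dots> = D ^ Suc (\<Sum>k=0..N. r k + c k) *
      exp ((\<Sum>k=0..N. real (r k) * (- \<rho> k * z k) + real (c k) * (q * (\<Sum>m\<in>{k<..N}. z m))) + q * (\<Sum>m=0..N. z m))"
    unfolding exp_add by (simp add: mult_ac)
  also have "\<dots> \<le> D ^ Suc (\<Sum>k=0..N. r k + c k) * exp (- K * (\<Sum>m=0..N. z m))"
  proof -
    have "(\<Sum>k=0..N. real (c k) * (q * (\<Sum>m\<in>{k<..N}. z m))) = (\<Sum>m=0..N. z m * (\<Sum>k<m. real (c k) * q))"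
      using sum_triangle_swap[of "\<lambda>k. real (c k) * q" z N] by (simp add: mult.assoc)
    then have "(\<Sum>k=0..N. real (r k) * (- \<rho> k * z k) + real (c k) * (q * (\<Sum>m\<in>{k<..N}. z m))) + q * (\<Sum>m=0..N. z m)
        = (\<Sum>m=0..N. real (r m) * (- \<rho> m * z m) + z m * (\<Sum>k<m. real (c k) * q) + q * z m)"
      by (simp only: sum.distrib sum_distrib_left[of q])
    also have "\<dots> \<le> (\<Sum>m=0..N. - K * z m)"
    proof (rule sum_mono)
      fix m assume "m \<in> {0..N}"
      then have m: "m \<le> N" by simp
      \<comment> \<open>The coefficient of \<open>z m\<close>: \<open>K\<close> is the decay to be
        left over, \<open>q\<close> pays for the weight \<open>w\<close>, and the sum pays for the
        factors \<open>\<nu> k\<close> with \<open>k < m\<close>.\<close>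
      have "z m * (K + q + q * (\<Sum>k<m. real (c k))) \<le> z m * (\<rho> m * real (r m))"
        using r[OF m] z[OF m] unfolding c_def by (intro mult_left_mono) auto
      then show "real (r m) * (- \<rho> m * z m) + z m * (\<Sum>k<m. real (c k) * q) + q * z m \<le> - K * z m"
        by (simp add: algebra_simps sum_distrib_left)
    qed
    also have "\<dots> = - K * (\<Sum>m=0..N. z m)" by (simp add: sum_distrib_left)
    finally show ?thesis using D by (intro mult_left_mono) auto
  qed
  finally show ?thesis unfolding c_def .
qed

section \<open>From the symbol seminorms to a pointwise bound\<close>

lemma pbw_norm_nonneg: "0 \<le> pbw_norm bs k u"
  by (simp add: pbw_norm_def sum_nonneg)

lemma finite_pbw_idx: "finite (pbw_idx bs k)"
proof (rule finite_subset)
  show "pbw_idx bs k \<subseteq> {\<beta>. set \<beta> \<subseteq> {..k} \<and> length \<beta> = length bs}"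
    using member_le_sum_list by (fastforce simp: pbw_idx_def)
qed (simp add: finite_lists_length_eq)

text \<open>Positivity allows clearing the denominator in \<open>B_seminorm\<close>. If the norm
  vanished, so would all coefficients and hence \<open>u\<close>, once the coefficients picked by
  \<open>pbw_coeffs\<close> are known to represent \<open>u\<close>.\<close>

lemma pbw_norm_pos:
  assumes u: "u \<in> uea_filt bs k" "u \<noteq> 0"
  shows "0 < pbw_norm bs k u"
proof -
  have "\<exists>c. u = (\<Sum>v\<in>pbw_monomial bs ` pbw_idx bs k. c v *\<^sub>R v)"
    using u(1) finite_pbw_idx[of bs k] unfolding uea_filt_def by (auto simp: span_finite)
  then obtain c where c: "u = (\<Sum>v\<in>pbw_monomial bs ` pbw_idx bs k. c v *\<^sub>R v)" by (elim exE)
  \<comment> \<open>The span gives a combination indexed by monomials, while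
    \<open>pbw_coeffs\<close> is indexed by exponents. \<open>J\<close> selects one exponent for
    each monomial; the others get coefficient zero.\<close>
  obtain J where J: "J \<subseteq> pbw_idx bs k" "inj_on (pbw_monomial bs) J"
      "pbw_monomial bs ` pbw_idx bs k = pbw_monomial bs ` J"
    using subset_image_inj[of "pbw_monomial bs ` pbw_idx bs k" "pbw_monomial bs" "pbw_idx bs k"] by auto
  have "u = (\<Sum>\<beta>\<in>J. c (pbw_monomial bs \<beta>) *\<^sub>R pbw_monomial bs \<beta>)"
    unfolding c J(3) by (simp add: sum.reindex[OF J(2)])
  also have "\<dots> = (\<Sum>\<beta>\<in>pbw_idx bs k. (if \<beta> \<in> J then c (pbw_monomial bs \<beta>) else 0) *\<^sub>R pbw_monomial bs \<beta>)"
    by (rule sum.mono_neutral_cong_left[OF finite_pbw_idx J(1)]) auto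
  finally have "\<exists>d. u = (\<Sum>\<beta>\<in>pbw_idx bs k. d \<beta> *\<^sub>R pbw_monomial bs \<beta>)"
    by (rule exI[of _ "\<lambda>\<beta>. if \<beta> \<in> J then c (pbw_monomial bs \<beta>) else 0"])
  then have coeffs: "u = (\<Sum>\<beta>\<in>pbw_idx bs k. pbw_coeffs bs k u \<beta> *\<^sub>R pbw_monomial bs \<beta>)"
    unfolding pbw_coeffs_def by (rule someI_ex)
  have "pbw_norm bs k u \<noteq> 0"
  proof
    assume "pbw_norm bs k u = 0"
    then have "\<forall>\<beta>\<in>pbw_idx bs k. pbw_coeffs bs k u \<beta> = 0"
      unfolding pbw_norm_def by (subst (asm) sum_nonneg_eq_0_iff[OF finite_pbw_idx]) auto
    then have "u = 0" using coeffs by simp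
    then show False using u(2) by simp
  qed
  then show ?thesis using pbw_norm_nonneg[of bs k u] by simp
qed

lemma Vupto_mono: "Vupto V n \<subseteq> Vupto V (Suc n)"
  unfolding Vupto_def by (rule span_mono) (force intro: le_SucI)

context lie_group
begin

text \<open>The word is one of the elements over which the supremum is taken, unless it vanishes in
  the enveloping algebra. The supremum excludes zero, but then the derivative is zero
  itself.\<close>

lemma lders_le_B_seminorm:
  fixes F :: "'g \<Rightarrow> 'e::{real_vector,t2_space}"
  assumes p: "seminorm_space p" and bs: "basis_of bs UNIV" and F: "smooth_fun G F"
    and \<mu>: "\<And>g. 0 < \<mu> j g" and le: "B_seminorm G bs p \<mu> j k F \<le> ennreal \<beta>" "0 \<le> \<beta>" and v: "length v \<le> k"
  shows "p j (lders G v F g) \<le> \<beta> * pbw_norm bs k (word_uea v) * \<mu> j g"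
proof (cases "word_uea v = (0 :: 'a uea)")
  case True
  have "lders G v F g = 0" using lop_word[OF p F, of v] lop_zero[OF p F, of g] True by simp
  moreover have "0 \<le> \<beta> * pbw_norm bs k (word_uea v) * \<mu> j g"
    by (intro mult_nonneg_nonneg le(2) pbw_norm_nonneg less_imp_le[OF \<mu>])
  ultimately show ?thesis by (simp add: seminorm_space.p_zero[OF p])
next
  case False
  have filt: "word_uea v \<in> uea_filt bs k" by (rule subsetD[OF uea_filt_mono[OF v] word_uea_in_filt[OF bs]])
  have pos: "0 < \<mu> j g * pbw_norm bs k (word_uea v)" using pbw_norm_pos[OF filt False] \<mu> by simp
  have "ennreal (p j (lop G (word_uea v) F g) / (\<mu> j g * pbw_norm bs k (word_uea v))) \<le> B_seminorm G bs p \<mu> j k F"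
    unfolding B_seminorm_def
    by (rule SUP_upper2[of "word_uea v"], use filt False in blast, rule SUP_upper, rule UNIV_I)
  also have "\<dots> \<le> ennreal \<beta>" by (rule le(1))
  finally have "p j (lders G v F g) / (\<mu> j g * pbw_norm bs k (word_uea v)) \<le> \<beta>"
    using le(2) by (simp add: lop_word[OF p F])
  then show ?thesis using pos by (simp add: divide_le_eq mult_ac)
qed

lemma smooth_fun_multiplier:
  assumes S: "smooth_fun G S"
  shows "smooth_fun G (multiplier G S A)"
proof -
  define E where "E = (\<lambda>x. exp (\<i> * complex_of_real (S x)))"
  have E: "smooth_fun G E" unfolding E_def by (rule smooth_fun_exp_ii[OF S])
  have "smooth_fun G (\<lambda>g. lop G A E g * inverse (E g))"
    by (rule smooth_fun_bilinear[OF cont_bilinear_bounded[OF bounded_bilinear_mult] seminorm_space_normed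
      seminorm_space_normed smooth_fun_lop[OF seminorm_space_normed E] smooth_fun_inverse[OF E]])
      (simp add: E_def)
  moreover have "multiplier G S A = (\<lambda>g. lop G A E g * inverse (E g))"
    by (rule ext) (simp add: multiplier_def E_def Let_def divide_inverse)
  ultimately show ?thesis by simp
qed

text \<open>\<open>K\<close> is arbitrary here and will be the integrability exponent. The weight
  stands on the left so that the exponents \<open>r\<close> absorb its growth too; it cancels later
  against the weight in the seminorm. \<open>r\<close>, \<open>C\<close> and \<open>W\<close> do not
  depend on \<open>F\<close>.\<close>

lemma D_vec_pointwise_bound:
  fixes p :: "nat \<Rightarrow> 'e::{real_vector,t2_space} \<Rightarrow> real"
  assumes temp: "tempered_pair G S" and adm: "admissible_by G M S N V e X" and fr: "frechet_space sc p"
    and \<mu>: "\<And>g. 0 < \<mu> g" "tempered_fun G S \<mu>"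
  shows "\<exists>r C W. 0 \<le> C \<and> finite W \<and> (\<forall>F g. smooth_fun G F \<longrightarrow>
    p j (D_vec G M S N V X sc r F g) * \<mu> g
      \<le> C * inverse ((1 + norm (moment G S g)) ^ K) * (\<Sum>v\<in>W. p j (lders G v F g)))"
proof -
  have p: "seminorm_space p" by (rule frechet_seminorm_space[OF fr])
  have sc: "cont_bilinear sc" by (rule frechet_cont_bilinear[OF fr])
  have "\<forall>j c x. p j (sc c x) = cmod c * p j x" using fr unfolding frechet_space_def by (elim conjE)
  then have psc: "p j (sc c x) = cmod c * p j x" for c x by blast
  have S: "smooth_fun G S" by (rule smooth_phase[OF temp])
  define \<alpha> where "\<alpha> = (\<lambda>n. multiplier G S (X n))"
  define A where "A = Vupto V"
  have V: "direct_sum_decomp N V" and e: "\<forall>n\<le>N. basis_of (e n) (V n)"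
    and adj: "\<forall>n\<le>N. \<forall>A\<in>uea_sub (V n). \<exists>B\<in>uea_sub (Vupto V n). is_formal_adjoint G M A B"
    and XV: "\<forall>n\<le>N. X n \<in> uea_sub (V n)"
    and ell: "\<forall>n\<le>N. \<exists>C \<rho>. 0 < C \<and> 0 < \<rho> \<and> (\<forall>g. C * (1 + coord_norm G S e n g powr \<rho>) \<le> cmod (\<alpha> n g))"
    and ex\<nu>: "\<forall>n\<le>N. \<exists>\<mu>. (\<forall>g. 0 < \<mu> g) \<and> tempered_fun G S \<mu> \<and> indep_of_coords_upto G S N e n \<mu> \<and>
           (\<forall>B\<in>uea_sub (A n). \<exists>C. \<forall>g. cmod (lop G B (\<alpha> n) g) \<le> C * cmod (\<alpha> n g) * \<mu> g)"
    using adm unfolding admissible_by_def \<alpha>_def A_def by (simp_all) blast+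
  have "\<forall>n\<in>{..N}. \<exists>C\<rho>. 0 < fst C\<rho> \<and> 0 < snd C\<rho> \<and>
      (\<forall>g. fst C\<rho> * (1 + coord_norm G S e n g powr snd C\<rho>) \<le> cmod (\<alpha> n g))"
    using ell by auto
  from bchoice[OF this] obtain C\<rho> where C\<rho>: "\<And>n. n \<le> N \<Longrightarrow> 0 < fst (C\<rho> n) \<and> 0 < snd (C\<rho> n) \<and>
      (\<forall>g. fst (C\<rho> n) * (1 + coord_norm G S e n g powr snd (C\<rho> n)) \<le> cmod (\<alpha> n g))" by auto
  define \<rho> where "\<rho> = (\<lambda>n. snd (C\<rho> n))"
  have \<rho>: "0 < \<rho> n" if "n \<le> N" for n using C\<rho>[OF that] by (simp add: \<rho>_def)
  have "\<forall>n\<in>{..N}. \<exists>\<mu>. (\<forall>g. 0 < \<mu> g) \<and> tempered_fun G S \<mu> \<and> indep_of_coords_upto G S N e n \<mu> \<and>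
           (\<forall>B\<in>uea_sub (A n). \<exists>C. \<forall>g. cmod (lop G B (\<alpha> n) g) \<le> C * cmod (\<alpha> n g) * \<mu> g)"
    using ex\<nu> by simp
  from bchoice[OF this] obtain \<mu>' where \<mu>'_all: "\<forall>n\<in>{..N}. (\<forall>g. 0 < \<mu>' n g) \<and> tempered_fun G S (\<mu>' n) \<and>
           indep_of_coords_upto G S N e n (\<mu>' n) \<and>
           (\<forall>B\<in>uea_sub (A n). \<exists>C. \<forall>g. cmod (lop G B (\<alpha> n) g) \<le> C * cmod (\<alpha> n g) * \<mu>' n g)" by (elim exE)
  have \<mu>': "(\<forall>g. 0 < \<mu>' n g) \<and> tempered_fun G S (\<mu>' n) \<and> indep_of_coords_upto G S N e n (\<mu>' n) \<and>
           (\<forall>B\<in>uea_sub (A n). \<exists>C. \<forall>g. cmod (lop G B (\<alpha> n) g) \<le> C * cmod (\<alpha> n g) * \<mu>' n g)" if "n \<le> N" for n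
    by (rule bspec[OF \<mu>'_all]) (use that in simp)
  \<comment> \<open>Adding \<open>1\<close> makes powers monotone in the exponent, as the counting
    of letters requires.\<close>
  define \<nu> where "\<nu> = (\<lambda>n g. 1 + \<mu>' n g)"
  define z where "z = (\<lambda>m g. ln (1 + coord_norm G S e m g))"
  note cn0 = coord_norm_nonneg[OF temp V e]
  have z0: "0 \<le> z m g" for m g using cn0 by (simp add: z_def)
  have \<alpha>s: "smooth_fun G (\<alpha> n)" for n unfolding \<alpha>_def by (rule smooth_fun_multiplier[OF S])
  \<comment> \<open>The bound from below in the logarithmic variable; it also shows that the
    multiplier has no zeros, so that its inverse is smooth.\<close>
  have \<alpha>lower: "inverse (cmod (\<alpha> n g)) \<le> (2 powr \<rho> n / fst (C\<rho> n)) * exp (- \<rho> n * z n g) \<and> \<alpha> n g \<noteq> 0" if n: "n \<le> N" for n g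
  proof -
    let ?y = "coord_norm G S e n g"
    have c: "0 < fst (C\<rho> n)" "fst (C\<rho> n) * (1 + ?y powr \<rho> n) \<le> cmod (\<alpha> n g)"
      using C\<rho>[OF n] by (auto simp: \<rho>_def)
    have y: "0 \<le> ?y" by (rule cn0)
    have "(1 + ?y) powr \<rho> n = exp (\<rho> n * z n g)" using y by (simp add: powr_def z_def)
    then have "exp (\<rho> n * z n g) \<le> 2 powr \<rho> n * (1 + ?y powr \<rho> n)" using one_add_powr_le[OF y \<rho>[OF n]] by simp
    then have "fst (C\<rho> n) * exp (\<rho> n * z n g) \<le> fst (C\<rho> n) * (2 powr \<rho> n * (1 + ?y powr \<rho> n))"
      using c(1) by (intro mult_left_mono) auto
    also have "\<dots> = 2 powr \<rho> n * (fst (C\<rho> n) * (1 + ?y powr \<rho> n))" by (simp only: mult_ac)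
    also have "\<dots> \<le> 2 powr \<rho> n * cmod (\<alpha> n g)" using c(2) by (rule mult_left_mono) simp
    finally have le: "fst (C\<rho> n) * exp (\<rho> n * z n g) \<le> 2 powr \<rho> n * cmod (\<alpha> n g)" .
    have "0 < fst (C\<rho> n) * exp (\<rho> n * z n g)" using c(1) by simp
    then have "0 < 2 powr \<rho> n * cmod (\<alpha> n g)" using le by (rule less_le_trans)
    then have pos: "0 < cmod (\<alpha> n g)" by (rule zero_less_mult_pos) simp
    have "inverse (cmod (\<alpha> n g)) \<le> (2 powr \<rho> n / fst (C\<rho> n)) * exp (- \<rho> n * z n g)"
      using le pos c(1) by (simp add: exp_minus field_simps)
    then show ?thesis using pos by simp
  qed
  have \<nu>1: "1 \<le> \<nu> n g" if "n \<le> N" for n g using \<mu>'[OF that] by (simp add: \<nu>_def less_imp_le)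
  \<comment> \<open>The independence condition says that the coordinates with index in
    \<open>{n<..N}\<close> determine the value, so these are the only ones in the exponent.\<close>
  have \<nu>bound: "\<exists>C\<ge>0. \<exists>q::nat. \<forall>g. \<bar>\<mu>' n g\<bar> \<le> C * exp (real q * (\<Sum>m\<in>{n<..N}. z m g))" if n: "n \<le> N" for n
    unfolding z_def
  proof (rule tempered_fun_bound[OF temp V e])
    show "tempered_fun G S (\<mu>' n)" using \<mu>'[OF n] by simp
    have "indep_of_coords_upto G S N e n (\<mu>' n)" using \<mu>'[OF n] by simp
    then have "\<mu>' n h = \<mu>' n g" if "\<forall>m\<in>{n<..N}. \<forall>i<length (e m). coord G S e m i h = coord G S e m i g" for g h
      using that unfolding indep_of_coords_upto_def by (metis greaterThanAtMost_iff)
    then show "{n<..N} = {..N} \<or> (\<forall>g h. (\<forall>m\<in>{n<..N}. \<forall>i<length (e m). coord G S e m i h = coord G S e m i g)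
        \<longrightarrow> \<mu>' n h = \<mu>' n g)" by blast
  qed auto
  have "\<forall>n\<in>{..N}. \<exists>Cq. 0 \<le> fst Cq \<and> (\<forall>g. \<bar>\<mu>' n g\<bar> \<le> fst Cq * exp (real (snd Cq :: nat) * (\<Sum>m\<in>{n<..N}. z m g)))"
  proof
    fix n assume "n \<in> {..N}"
    then have "n \<le> N" by simp
    from \<nu>bound[OF this] obtain C q where "0 \<le> C" "\<forall>g. \<bar>\<mu>' n g\<bar> \<le> C * exp (real (q::nat) * (\<Sum>m\<in>{n<..N}. z m g))"
      by (elim exE conjE)
    then show "\<exists>Cq. 0 \<le> fst Cq \<and> (\<forall>g. \<bar>\<mu>' n g\<bar> \<le> fst Cq * exp (real (snd Cq :: nat) * (\<Sum>m\<in>{n<..N}. z m g)))"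
      by (intro exI[of _ "(C, q)"]) simp
  qed
  from bchoice[OF this] obtain Cq where Cq: "\<And>n. n \<le> N \<Longrightarrow> 0 \<le> fst (Cq n) \<and>
      (\<forall>g. \<bar>\<mu>' n g\<bar> \<le> fst (Cq n) * exp (real (snd (Cq n) :: nat) * (\<Sum>m\<in>{n<..N}. z m g)))" by auto
  obtain Cw qw where Cw: "0 \<le> Cw" "\<forall>g. \<bar>\<mu> g\<bar> \<le> Cw * exp (real (qw::nat) * (\<Sum>m\<le>N. z m g))"
    using tempered_fun_bound[OF temp V e \<mu>(2) order_refl disjI1[OF refl]] unfolding z_def by (elim exE conjE)
  obtain Cm where Cm: "0 \<le> Cm" "\<forall>g. 1 + norm (moment G S g) \<le> Cm * exp (\<Sum>m\<le>N. z m g)"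
    using moment_bound[OF temp V e] unfolding z_def by (elim exE conjE)
  \<comment> \<open>A common exponent for the weight and all \<mu>_n, as \<open>D\<close> is a
    common constant. Enlarging the exponents is harmless because every \<open>z m g\<close> is
    nonnegative.\<close>
  define q :: real where "q = real (qw + (\<Sum>n\<le>N. snd (Cq n)))"
  define D where "D = 1 + Cw + (\<Sum>n\<le>N. 2 powr \<rho> n / fst (C\<rho> n) + (1 + fst (Cq n)))"
  have term0: "0 \<le> 2 powr \<rho> n / fst (C\<rho> n)" "0 \<le> 1 + fst (Cq n)" if "n \<le> N" for n
    using C\<rho>[OF that] Cq[OF that] by auto
  have sumD: "2 powr \<rho> n / fst (C\<rho> n) + (1 + fst (Cq n)) \<le> (\<Sum>n\<le>N. 2 powr \<rho> n / fst (C\<rho> n) + (1 + fst (Cq n)))"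
    if "n \<le> N" for n
    by (rule member_le_sum[where f = "\<lambda>n. 2 powr \<rho> n / fst (C\<rho> n) + (1 + fst (Cq n))"])
       (use that term0 in \<open>auto intro!: add_nonneg_nonneg\<close>)
  have sum0: "0 \<le> (\<Sum>n\<le>N. 2 powr \<rho> n / fst (C\<rho> n) + (1 + fst (Cq n)))"
    by (rule sum_nonneg) (use term0 in \<open>auto intro!: add_nonneg_nonneg\<close>)
  have D: "1 \<le> D" "Cw \<le> D" using sum0 Cw(1) by (auto simp: D_def)
  have Dn: "2 powr \<rho> n / fst (C\<rho> n) \<le> D" "1 + fst (Cq n) \<le> D" if "n \<le> N" for n
    using sumD[OF that] term0[OF that] Cw(1) by (auto simp: D_def)
  have a: "0 \<le> inverse (cmod (\<alpha> n g)) \<and> inverse (cmod (\<alpha> n g)) \<le> D * exp (- \<rho> n * z n g)" if n: "n \<le> N" for n g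
  proof -
    have "(2 powr \<rho> n / fst (C\<rho> n)) * exp (- \<rho> n * z n g) \<le> D * exp (- \<rho> n * z n g)"
      using Dn(1)[OF n] by (rule mult_right_mono) simp
    then show ?thesis using \<alpha>lower[OF n, of g] by (auto intro: order_trans)
  qed
  have \<nu>D: "0 \<le> \<nu> n g \<and> \<nu> n g \<le> D * exp (q * (\<Sum>m\<in>{n<..N}. z m g))" if n: "n \<le> N" for n g
  proof -
    let ?s = "\<Sum>m\<in>{n<..N}. z m g"
    have s0: "0 \<le> ?s" by (intro sum_nonneg z0)
    have "snd (Cq n) \<le> (\<Sum>n\<le>N. snd (Cq n))" by (rule member_le_sum) (use n in auto)
    then have "real (snd (Cq n)) \<le> q" unfolding q_def of_nat_le_iff by linarith
    then have qs: "exp (real (snd (Cq n)) * ?s) \<le> exp (q * ?s)" using s0 by (simp add: mult_right_mono)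
    have "0 \<le> q" unfolding q_def by (rule of_nat_0_le_iff)
    then have "1 \<le> exp (q * ?s)" using s0 by simp
    moreover have "\<mu>' n g \<le> fst (Cq n) * exp (q * ?s)"
    proof -
      have "\<mu>' n g \<le> fst (Cq n) * exp (real (snd (Cq n)) * ?s)" using Cq[OF n] abs_ge_self order_trans by metis
      also have "\<dots> \<le> fst (Cq n) * exp (q * ?s)" using qs Cq[OF n] by (intro mult_left_mono) auto
      finally show ?thesis .
    qed
    ultimately have "\<nu> n g \<le> (1 + fst (Cq n)) * exp (q * ?s)"
      unfolding \<nu>_def distrib_right by (simp only: mult_1 add_mono)
    also have "\<dots> \<le> D * exp (q * ?s)" using Dn(2)[OF n] by (rule mult_right_mono) simp
    finally show ?thesis using \<nu>1[OF n, of g] by simp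
  qed
  have w: "0 \<le> \<mu> g \<and> \<mu> g \<le> D * exp (q * (\<Sum>m=0..N. z m g))" for g
  proof -
    let ?s = "\<Sum>m\<le>N. z m g"
    have s0: "0 \<le> ?s" by (intro sum_nonneg z0)
    have "\<mu> g \<le> Cw * exp (real qw * ?s)" using Cw(2) abs_ge_self order_trans by metis
    also have "\<dots> \<le> D * exp (q * ?s)"
    proof (rule mult_mono)
      have "real qw \<le> q" unfolding q_def of_nat_le_iff by simp
      then show "exp (real qw * ?s) \<le> exp (q * ?s)" using s0 by (simp add: mult_right_mono)
    qed (use D in auto)
    finally show ?thesis using \<mu>(1)[of g] by (simp add: atMost_atLeast0 less_imp_le)
  qed
  \<comment> \<open>Representatives are chosen for every \<open>n\<close>, with the condition on the
    letters for \<open>n \<le> N\<close> alone, so that \<open>D_op\<close> can be rewritten for all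
    indices at once.\<close>
  have "\<forall>n. \<exists>Q. adjoint_elem G M V n (X n) = abs_uea Q \<and> (n \<le> N \<longrightarrow> letters ` Poly_Mapping.keys Q \<subseteq> lists (A n))"
  proof
    fix n
    show "\<exists>Q. adjoint_elem G M V n (X n) = abs_uea Q \<and> (n \<le> N \<longrightarrow> letters ` Poly_Mapping.keys Q \<subseteq> lists (A n))"
    proof (cases "n \<le> N")
      case True
      then have "\<exists>B. B \<in> uea_sub (Vupto V n) \<and> is_formal_adjoint G M (X n) B" using adj XV by blast
      then have "adjoint_elem G M V n (X n) \<in> uea_sub (Vupto V n)"
        unfolding adjoint_elem_def by (rule someI2_ex) simp
      from uea_sub_rep[OF this] show ?thesis by (auto simp: A_def)
    next
      case False
      then show ?thesis using abs_uea_cases by metis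
    qed
  qed
  from choice[OF this] obtain Q where Q: "\<And>n. adjoint_elem G M V n (X n) = abs_uea (Q n)"
    "\<And>n. n \<le> N \<Longrightarrow> letters ` Poly_Mapping.keys (Q n) \<subseteq> lists (A n)" by auto
  \<comment> \<open>A crude bound for the degree of \<open>Q n\<close>: the total length of its
    words.\<close>
  define b where "b = (\<lambda>n. \<Sum>k\<in>Poly_Mapping.keys (Q n). length (letters k))"
  have b: "length (letters k) \<le> b n" if "k \<in> Poly_Mapping.keys (Q n)" for n k
    unfolding b_def by (rule member_le_sum[OF that]) auto
  \<comment> \<open>The prescribed decay is \<open>K\<close>; the additional \<open>q\<close>
    compensates the weight.\<close>
  have "\<exists>r. \<forall>n\<le>N. (real K + q) + q * (\<Sum>k<n. real (r k * (\<Sum>i=0..k. r i * b i))) \<le> \<rho> n * real (r n)"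
    by (rule ex_exponents[of N \<rho> "real K + q" q b, OF \<rho>])
  then obtain r where r: "\<forall>n\<le>N. (real K + q) + q * (\<Sum>k<n. real (r k * (\<Sum>i=0..k. r i * b i))) \<le> \<rho> n * real (r n)"
    by (elim exE)
  have bound: "\<exists>C. \<forall>g. cmod (lders G u (\<alpha> n) g) \<le> C * cmod (\<alpha> n g) * \<nu> n g" if n: "n \<le> N" and u: "u \<in> lists (A n)" for n u
  proof -
    have "word_uea u \<in> uea_sub (A n)" by (rule word_uea_in_uea_sub[OF u])
    then obtain C where C: "\<forall>g. cmod (lop G (word_uea u) (\<alpha> n) g) \<le> C * cmod (\<alpha> n g) * \<mu>' n g"
      using \<mu>'[OF n] by blast
    have "cmod (lders G u (\<alpha> n) g) \<le> \<bar>C\<bar> * cmod (\<alpha> n g) * \<nu> n g" for g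
    proof -
      have "cmod (lders G u (\<alpha> n) g) \<le> C * cmod (\<alpha> n g) * \<mu>' n g"
        using C by (simp add: lop_word[OF seminorm_space_normed \<alpha>s])
      also have "\<dots> \<le> \<bar>C\<bar> * cmod (\<alpha> n g) * \<nu> n g"
        using \<mu>'[OF n] by (intro mult_mono mult_right_mono) (auto simp: \<nu>_def less_imp_le)
      finally show ?thesis .
    qed
    then show ?thesis by blast
  qed
  have "op_bounded p j (foldr (\<lambda>n. (\<lambda>\<Phi>. lop G (abs_uea (Q n)) (\<lambda>g. sc (1 / \<alpha> n g) (\<Phi> g))) ^^ r n) [0..<Suc N]) (A 0)
    (\<lambda>l g. \<Prod>k=0..N. inverse (cmod (\<alpha> k g)) ^ r k * \<nu> k g ^ (r k * (l + (\<Sum>i=0..k. r i * b i))))"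
  proof (rule op_bounded_D_vec[OF p sc psc \<alpha>s _ \<nu>1 bound Q(2) b])
    show "A n \<subseteq> A (Suc n)" for n unfolding A_def by (rule Vupto_mono)
  qed (use \<alpha>lower in auto)
  moreover have "foldr (\<lambda>n. (\<lambda>\<Phi>. lop G (abs_uea (Q n)) (\<lambda>g. sc (1 / \<alpha> n g) (\<Phi> g))) ^^ r n) [0..<Suc N]
      = D_vec G M S N V X sc r"
  proof (rule ext)
    fix F :: "'g \<Rightarrow> 'e"
    have "D_op G M S V X sc n = (\<lambda>\<Phi>. lop G (abs_uea (Q n)) (\<lambda>g. sc (1 / \<alpha> n g) (\<Phi> g)))" for n
      by (rule ext) (simp add: D_op_def Q(1) \<alpha>_def)
    then show "foldr (\<lambda>n. (\<lambda>\<Phi>. lop G (abs_uea (Q n)) (\<lambda>g. sc (1 / \<alpha> n g) (\<Phi> g))) ^^ r n) [0..<Suc N] F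
      = D_vec G M S N V X sc r F" by (simp only: D_vec_def)
  qed
  ultimately have "op_bounded p j (D_vec G M S N V X sc r) (A 0)
    (\<lambda>l g. \<Prod>k=0..N. inverse (cmod (\<alpha> k g)) ^ r k * \<nu> k g ^ (r k * (l + (\<Sum>i=0..k. r i * b i))))" by simp
  \<comment> \<open>The empty word gives the value of the operator itself, with \<open>l = 0\<close>
    in the exponents.\<close>
  then have "dominated (p j) (\<lambda>F g. p j (lders G [] (D_vec G M S N V X sc r F) g))
     (\<lambda>g. \<Prod>k=0..N. inverse (cmod (\<alpha> k g)) ^ r k * \<nu> k g ^ (r k * (length ([] :: 'a list) + (\<Sum>i=0..k. r i * b i))))"
    unfolding op_bounded_def[OF p] by (elim conjE) (erule bspec, simp)
  then obtain C W where CW: "0 \<le> C" "finite W" "\<forall>F g. smooth_fun G F \<longrightarrow> p j (D_vec G M S N V X sc r F g)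
      \<le> C * (\<Prod>k=0..N. inverse (cmod (\<alpha> k g)) ^ r k * \<nu> k g ^ (r k * (\<Sum>i=0..k. r i * b i))) * (\<Sum>v\<in>W. p j (lders G v F g))"
    unfolding dominated_def by (elim exE conjE) simp
  \<comment> \<open>\<open>Cm ^ K\<close> arises when decay in the sum of the \<open>z m\<close> is
    converted into decay in the norm of the moment map.\<close>
  define D1 where "D1 = D ^ Suc (\<Sum>k=0..N. r k + r k * (\<Sum>i=0..k. r i * b i)) * Cm ^ K"
  have decay: "(\<Prod>k=0..N. inverse (cmod (\<alpha> k g)) ^ r k * \<nu> k g ^ (r k * (\<Sum>i=0..k. r i * b i))) * \<mu> g
      \<le> D1 * inverse ((1 + norm (moment G S g)) ^ K)" for g
  proof -
    let ?s = "\<Sum>m=0..N. z m g"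
    have "(\<Prod>k=0..N. inverse (cmod (\<alpha> k g)) ^ r k * \<nu> k g ^ (r k * (\<Sum>i=0..k. r i * b i))) * \<mu> g
        \<le> D ^ Suc (\<Sum>k=0..N. r k + r k * (\<Sum>i=0..k. r i * b i)) * exp (- real K * ?s)"
      by (rule weighted_product_decay[where z = "\<lambda>m. z m g" and \<rho> = \<rho> and q = q])
         (use D(1) z0 a \<nu>D w r in auto)
    also have "\<dots> \<le> D ^ Suc (\<Sum>k=0..N. r k + r k * (\<Sum>i=0..k. r i * b i)) * (Cm ^ K * inverse ((1 + norm (moment G S g)) ^ K))"
    proof (rule mult_left_mono)
      have n1: "0 < 1 + norm (moment G S g)" by (simp add: add_pos_nonneg)
      have "(1 + norm (moment G S g)) ^ K \<le> (Cm * exp ?s) ^ K"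
        using Cm(2) n1 by (intro power_mono) (auto simp: atMost_atLeast0)
      also have "\<dots> = Cm ^ K * exp (real K * ?s)" by (simp add: power_mult_distrib exp_of_nat_mult)
      finally have "(1 + norm (moment G S g)) ^ K \<le> Cm ^ K * exp (real K * ?s)" .
      then show "exp (- real K * ?s) \<le> Cm ^ K * inverse ((1 + norm (moment G S g)) ^ K)"
        using n1 by (simp add: exp_minus field_simps)
    qed (use D(1) in simp)
    finally show ?thesis by (simp add: D1_def mult_ac)
  qed
  have "p j (D_vec G M S N V X sc r F g) * \<mu> g
      \<le> (C * D1) * inverse ((1 + norm (moment G S g)) ^ K) * (\<Sum>v\<in>W. p j (lders G v F g))"
    if F: "smooth_fun G F" for F g
  proof -
    let ?P = "\<Prod>k=0..N. inverse (cmod (\<alpha> k g)) ^ r k * \<nu> k g ^ (r k * (\<Sum>i=0..k. r i * b i))"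
    let ?\<Sigma> = "\<Sum>v\<in>W. p j (lders G v F g)"
    have "p j (D_vec G M S N V X sc r F g) * \<mu> g \<le> (C * ?P * ?\<Sigma>) * \<mu> g"
      using CW(3) F \<mu>(1)[of g] by (intro mult_right_mono) (auto simp: less_imp_le)
    also have "\<dots> = C * ?\<Sigma> * (?P * \<mu> g)" by (simp only: mult_ac)
    also have "\<dots> \<le> C * ?\<Sigma> * (D1 * inverse ((1 + norm (moment G S g)) ^ K))"
      by (intro mult_left_mono decay mult_nonneg_nonneg CW(1) sum_p_nonneg[OF p])
    finally show ?thesis by (simp only: mult_ac)
  qed
  moreover have "0 \<le> C * D1" using CW(1) D(1) Cm(1) by (simp add: D1_def)
  ultimately show ?thesis using CW(2) by (intro exI[of _ r] exI[of _ "C * D1"] exI[of _ W]) simp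
qed

end

section \<open>Integration of the pointwise bound\<close>

theorem proposition1p29:
  fixes G :: "('g::{t2_space,second_countable_topology}, 'a::{euclidean_space,lie_algebra}) lie_group_data"
    and M :: "'g measure"
    and S :: "'g \<Rightarrow> real"
    and bs :: "'a list"
    and N :: nat
    and V :: "nat \<Rightarrow> 'a set"
    and e :: "nat \<Rightarrow> 'a list"
    and X :: "nat \<Rightarrow> 'a uea"
    and sc :: "complex \<Rightarrow> 'e \<Rightarrow> 'e::{real_vector,t2_space}"
    and p :: "nat \<Rightarrow> 'e \<Rightarrow> real"
    and \<mu> :: "nat \<Rightarrow> 'g \<Rightarrow> real"
  assumes "lie_group G"
    and "connected (UNIV :: 'g set)"
    and "\<not> compact (UNIV :: 'g set)"
    and "left_haar_measure G M"
    and "basis_of bs UNIV"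
    and "tempered_pair G S"
    and "admissible_by G M S N V e X"
    and "frechet_space sc p"
    and "\<And>j. weight G (\<mu> j) \<and> tempered_fun G S (\<mu> j)"
  shows "\<forall>j. \<exists>(r :: nat \<Rightarrow> nat) (C :: real) (k :: nat). 0 < C \<and>
           (\<forall>F\<in>B_space G p \<mu>.
              (\<integral>\<^sup>+g. ennreal (p j (D_vec G M S N V X sc r F g)) \<partial>M)
                \<le> ennreal C * B_seminorm G bs p \<mu> j k F)"
proof
  fix j
  interpret lie_group G by fact
  note haar = assms(4) and bs = assms(5) and temp = assms(6) and adm = assms(7) and fr = assms(8)
  have p: "seminorm_space p" by (rule frechet_seminorm_space[OF fr])
  have \<mu>: "0 < \<mu> j g" "tempered_fun G S (\<mu> j)" for g using assms(9)[of j] by (auto simp: weight_def)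
  obtain K where K: "(\<integral>\<^sup>+g. ennreal (inverse ((1 + norm (moment G S g)) ^ K)) \<partial>M) < \<infinity>"
    using integrable_decay[OF temp haar] by (elim exE)
  define h where "h = (\<lambda>g. inverse ((1 + norm (moment G S g)) ^ K))"
  define I where "I = enn2real (\<integral>\<^sup>+g. ennreal (h g) \<partial>M)"
  have I: "(\<integral>\<^sup>+g. ennreal (h g) \<partial>M) = ennreal I" "0 \<le> I" using K by (simp_all add: I_def h_def)
  have hm: "(\<lambda>g. ennreal (h g)) \<in> borel_measurable M"
  proof -
    have "continuous_on UNIV h" unfolding h_def
      by (intro continuous_intros continuous_moment[OF temp])
         (metis add_pos_nonneg norm_ge_zero power_not_zero less_irrefl zero_less_one)
    then have "h \<in> borel_measurable borel" by (rule borel_measurable_continuous_onI)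
    then have "h \<in> borel_measurable M" using measurable_cong_sets[OF sets_haar[OF temp haar] refl] by blast
    then show ?thesis by simp
  qed
  obtain r C W where rC: "0 \<le> C" "finite W" "\<forall>F g. smooth_fun G F \<longrightarrow>
      p j (D_vec G M S N V X sc r F g) * \<mu> j g \<le> C * h g * (\<Sum>v\<in>W. p j (lders G v F g))"
    using D_vec_pointwise_bound[OF temp adm fr \<mu>, of j K] unfolding h_def by (elim exE conjE)
  \<comment> \<open>The total length bounds the length of every word in \<open>W\<close>, so a
    single seminorm of this order controls them all.\<close>
  define k where "k = (\<Sum>v\<in>W. length v)"
  have k: "length v \<le> k" if "v \<in> W" for v unfolding k_def by (rule member_le_sum[OF that]) (use rC in auto)
  \<comment> \<open>Each word enters with its PBW norm, the factor by which its derivative may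
    exceed the seminorm times the weight.\<close>
  define c where "c = (\<Sum>v\<in>W. pbw_norm bs k (word_uea v))"
  have c0: "0 \<le> c" unfolding c_def by (intro sum_nonneg pbw_norm_nonneg)
  have "(\<integral>\<^sup>+g. ennreal (p j (D_vec G M S N V X sc r F g)) \<partial>M) \<le> ennreal (C * c * I + 1) * B_seminorm G bs p \<mu> j k F"
    if "F \<in> B_space G p \<mu>" for F
  proof (cases "B_seminorm G bs p \<mu> j k F")
    case (real \<beta>)
    have F: "smooth_fun G F" using that by (simp add: B_space_def)
    have "p j (D_vec G M S N V X sc r F g) \<le> (C * c * \<beta>) * h g" for g
    proof -
      have "(\<Sum>v\<in>W. p j (lders G v F g)) \<le> (\<Sum>v\<in>W. \<beta> * pbw_norm bs k (word_uea v) * \<mu> j g)"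
        by (rule sum_mono, rule lders_le_B_seminorm[where \<mu> = \<mu> and j = j, OF p bs F \<mu>(1)]) (use real k in auto)
      also have "\<dots> = \<beta> * c * \<mu> j g" by (simp add: c_def sum_distrib_left sum_distrib_right)
      finally have s: "(\<Sum>v\<in>W. p j (lders G v F g)) \<le> \<beta> * c * \<mu> j g" .
      have "p j (D_vec G M S N V X sc r F g) * \<mu> j g \<le> C * h g * (\<Sum>v\<in>W. p j (lders G v F g))"
        using rC(3) F by blast
      also have "\<dots> \<le> C * h g * (\<beta> * c * \<mu> j g)"
        using rC(1) by (intro mult_left_mono s) (simp add: h_def)
      finally have "p j (D_vec G M S N V X sc r F g) * \<mu> j g \<le> ((C * c * \<beta>) * h g) * \<mu> j g" by (simp add: mult_ac)
      \<comment> \<open>The weight from the pointwise bound cancels against the one from the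
        seminorm, which leaves the integrable function \<open>h\<close>.\<close>
      then show ?thesis using \<mu>(1)[of g] by (rule mult_right_le_imp_le)
    qed
    then have "(\<integral>\<^sup>+g. ennreal (p j (D_vec G M S N V X sc r F g)) \<partial>M) \<le> (\<integral>\<^sup>+g. ennreal (C * c * \<beta>) * ennreal (h g) \<partial>M)"
      using rC(1) c0 real(1) by (intro nn_integral_mono) (simp add: ennreal_mult'[symmetric] ennreal_leI)
    also have "\<dots> = ennreal (C * c * \<beta>) * ennreal I" using I(1) by (simp add: nn_integral_cmult[OF hm])
    also have "\<dots> = ennreal (C * c * I) * ennreal \<beta>"
      using rC(1) c0 real(1) I(2) by (simp add: ennreal_mult[symmetric] mult_ac)
    also have "\<dots> \<le> ennreal (C * c * I + 1) * ennreal \<beta>" by (intro mult_right_mono ennreal_leI) auto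
    finally show ?thesis using real by simp
  next
    \<comment> \<open>An infinite seminorm times a positive constant is infinite, so the bound is
      trivial.\<close>
    case top
    have "0 < C * c * I + 1" using rC(1) c0 I(2) by (simp add: add_nonneg_pos)
    then show ?thesis using top by (simp add: ennreal_mult_top)
  qed
  \<comment> \<open>The summand \<open>1\<close> keeps the constant positive when \<open>C\<close>,
    \<open>c\<close> or \<open>I\<close> is zero.\<close>
  moreover have "0 < C * c * I + 1" using rC(1) c0 I(2) by (simp add: add_nonneg_pos)
  ultimately show "\<exists>(r :: nat \<Rightarrow> nat) (C :: real) (k :: nat). 0 < C \<and>
           (\<forall>F\<in>B_space G p \<mu>.
              (\<integral>\<^sup>+g. ennreal (p j (D_vec G M S N V X sc r F g)) \<partial>M)
                \<le> ennreal C * B_seminorm G bs p \<mu> j k F)" by blast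
qed

end
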